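(* Let $n\ge 4$. When defined over a field of odd characteristic $p$, the Specht module $S^{(n-2,2)}$ is indecomposable, and its vertex is equal (up to conjugacy in $S_n$) to the defect group of the $p$-block of $S_n$ in which it lies.
   Context: Here $p$ is an odd prime. Specht modules (permutations act on the right): for a partition $\lambda$ of $n$, a $\lambda$-tableau is a filling of the boxes of the Young diagram of $\lambda$ with $1,\ldots,n$, all entries distinct. The tabloid $\mathbf{t}$ of a tableau $t$ is its equivalence class under reordering entries within rows; $M^\lambda$ is the permutation module of $S_n$ on $\lambda$-tabloids over the ground field. Let $C(t)\le S_n$ be the group fixing setwise each column of $t$; $e_t=\sum_{g\in C(t)}\operatorname{sgn}(g)\,\mathbf{t}g$, and the Specht module $S^\lambda$ is the submodule of $M^\lambda$ spanned by all $e_t$. Vertices: for a finite group $G$, a field $F$ of characteristic $p$ and an indecomposable $FG$-module $M$, $Q\le G$ is a vertex of $M$ if there is an indecomposable $FQ$-module $N$ such that $M$ is a direct summand of $N\uparrow_Q^G$ and $Q$ is minimal with this property; vertices are unique up to conjugacy in $G$. Defect groups: a $p$-block $B$ of $G$, regarded as an $F(G\times G)$-module via $x(g,g')=g^{-1}xg'$, has a vertex of the form $\Delta D=\{(g,g):g\in D\}$ for some $D\le G$; such a $D$ (unique up to conjugacy in $G$) is a defect group of $B$. *)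

theory Defs
  imports
    "HOL-Algebra.Sym_Groups"
    "HOL-Algebra.Ideal"
    "HOL-Combinatorics.Permutations"
    "HOL-Computational_Algebra.Computational_Algebra"
    "HOL-Library.Function_Algebras"
begin

section \<open>Finite-dimensional right modules for group algebras\<close>

text \<open>
  The underlying space \<open>space M\<close> is a subspace of an ambient vector space \<open>'v\<close>, and
  \<open>act M v g\<close> is \<open>v g\<close>. Outside of \<open>space M\<close> and of the carrier of the group the action is
  irrelevant.
\<close>

record ('k, 'v, 'g) gmodule =
  scale :: "'k \<Rightarrow> 'v \<Rightarrow> 'v"
  space :: "'v set"
  act :: "'v \<Rightarrow> 'g \<Rightarrow> 'v"

definition fg_module ::
    "('g, 'm) monoid_scheme \<Rightarrow> ('k::field, 'v::ab_group_add, 'g) gmodule \<Rightarrow> bool" where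
  "fg_module G M \<longleftrightarrow>
     group G \<and> vector_space (scale M) \<and> module.subspace (scale M) (space M) \<and>
     (\<exists>S. finite S \<and> module.span (scale M) S = space M) \<and>
     (\<forall>v\<in>space M. \<forall>g\<in>carrier G. act M v g \<in> space M) \<and>
     (\<forall>v\<in>space M. \<forall>w\<in>space M. \<forall>g\<in>carrier G. act M (v + w) g = act M v g + act M w g) \<and>
     (\<forall>c. \<forall>v\<in>space M. \<forall>g\<in>carrier G. act M (scale M c v) g = scale M c (act M v g)) \<and>
     (\<forall>v\<in>space M. act M v \<one>\<^bsub>G\<^esub> = v) \<and>
     (\<forall>v\<in>space M. \<forall>g\<in>carrier G. \<forall>h\<in>carrier G. act M (act M v g) h = act M v (g \<otimes>\<^bsub>G\<^esub> h))"

definition fg_submodule ::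
    "('g, 'm) monoid_scheme \<Rightarrow> ('k::field, 'v::ab_group_add, 'g) gmodule \<Rightarrow> 'v set \<Rightarrow> bool" where
  "fg_submodule G M U \<longleftrightarrow>
     U \<subseteq> space M \<and> module.subspace (scale M) U \<and> (\<forall>u\<in>U. \<forall>g\<in>carrier G. act M u g \<in> U)"

definition fg_direct_sum ::
    "('g, 'm) monoid_scheme \<Rightarrow> ('k::field, 'v::ab_group_add, 'g) gmodule \<Rightarrow> 'v set \<Rightarrow> 'v set \<Rightarrow> bool"
  where
  "fg_direct_sum G M U W \<longleftrightarrow>
     fg_submodule G M U \<and> fg_submodule G M W \<and> U \<inter> W = {0} \<and>
     space M = {u + w | u w. u \<in> U \<and> w \<in> W}"

definition fg_indecomposable ::
    "('g, 'm) monoid_scheme \<Rightarrow> ('k::field, 'v::ab_group_add, 'g) gmodule \<Rightarrow> bool" where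
  "fg_indecomposable G M \<longleftrightarrow>
     fg_module G M \<and> space M \<noteq> {0} \<and> (\<forall>U W. fg_direct_sum G M U W \<longrightarrow> U = {0} \<or> W = {0})"

definition fg_isomorphic ::
    "('g, 'm) monoid_scheme \<Rightarrow> ('k::field, 'v::ab_group_add, 'g) gmodule \<Rightarrow>
     ('k, 'w::ab_group_add, 'g) gmodule \<Rightarrow> bool" where
  "fg_isomorphic G M N \<longleftrightarrow>
     (\<exists>f. bij_betw f (space M) (space N) \<and>
        (\<forall>v\<in>space M. \<forall>w\<in>space M. f (v + w) = f v + f w) \<and>
        (\<forall>c. \<forall>v\<in>space M. f (scale M c v) = scale N c (f v)) \<and>
        (\<forall>v\<in>space M. \<forall>g\<in>carrier G. f (act M v g) = act N (f v) g))"

definition fg_direct_summand ::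
    "('g, 'm) monoid_scheme \<Rightarrow> ('k::field, 'v::ab_group_add, 'g) gmodule \<Rightarrow>
     ('k, 'w::ab_group_add, 'g) gmodule \<Rightarrow> bool" where
  "fg_direct_summand G M X \<longleftrightarrow>
     (\<exists>U W. fg_direct_sum G X U W \<and> fg_isomorphic G M (X\<lparr>space := U\<rparr>))"


section \<open>Induction and vertices\<close>

text \<open>
  \<open>induced G Q N\<close> is \<open>N \<otimes>\<^bsub>FQ\<^esub> FG\<close>. The function \<open>f\<close> stands for the tensor \<open>\<Sum> f x \<otimes> x\<close>, where \<open>x\<close>
  runs over representatives of the cosets \<open>Q x\<close>; as \<open>f x \<otimes> x = f x q\<^sup>-\<^sup>1 \<otimes> q x\<close>, this does not depend
  on the representatives when \<open>f (q x) = f x q\<^sup>-\<^sup>1\<close>. Since \<open>(n \<otimes> x) h = n \<otimes> x h\<close>, the action is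
  translation of the argument.
\<close>

definition induced ::
    "('g, 'm) monoid_scheme \<Rightarrow> 'g set \<Rightarrow> ('k::field, 'v::ab_group_add, 'g) gmodule \<Rightarrow>
     ('k, 'g \<Rightarrow> 'v, 'g) gmodule" where
  "induced G Q N =
     \<lparr>scale = (\<lambda>c f x. scale N c (f x)),
      space = {f. (\<forall>x\<in>carrier G. f x \<in> space N) \<and> (\<forall>x. x \<notin> carrier G \<longrightarrow> f x = 0) \<and>
                  (\<forall>q\<in>Q. \<forall>x\<in>carrier G. f (q \<otimes>\<^bsub>G\<^esub> x) = act N (f x) (inv\<^bsub>G\<^esub> q))},
      act = (\<lambda>f h x. if x \<in> carrier G then f (x \<otimes>\<^bsub>G\<^esub> inv\<^bsub>G\<^esub> h) else 0)\<rparr>"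

text \<open>
  The module \<open>N\<close> below ranges over modules inside the infinite-dimensional space \<open>nat \<Rightarrow> 'k\<close>, which
  contains a copy of every finite-dimensional module.
\<close>

definition summand_of_induced ::
    "('g, 'm) monoid_scheme \<Rightarrow> ('k::field, 'v::ab_group_add, 'g) gmodule \<Rightarrow> 'g set \<Rightarrow> bool" where
  "summand_of_induced G M Q \<longleftrightarrow>
     subgroup Q G \<and>
     (\<exists>N :: ('k, nat \<Rightarrow> 'k, 'g) gmodule.
        fg_indecomposable (G\<lparr>carrier := Q\<rparr>) N \<and> fg_direct_summand G M (induced G Q N))"

definition is_vertex ::
    "('g, 'm) monoid_scheme \<Rightarrow> ('k::field, 'v::ab_group_add, 'g) gmodule \<Rightarrow> 'g set \<Rightarrow> bool" where
  "is_vertex G M Q \<longleftrightarrow>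
     summand_of_induced G M Q \<and> (\<forall>R. R \<subset> Q \<longrightarrow> \<not> summand_of_induced G M R)"

definition conjugate_subgroups :: "('g, 'm) monoid_scheme \<Rightarrow> 'g set \<Rightarrow> 'g set \<Rightarrow> bool" where
  "conjugate_subgroups G Q D \<longleftrightarrow>
     (\<exists>g\<in>carrier G. Q = (\<lambda>d. inv\<^bsub>G\<^esub> g \<otimes>\<^bsub>G\<^esub> d \<otimes>\<^bsub>G\<^esub> g) ` D)"


section \<open>The group algebra, blocks and defect groups\<close>

text \<open>The function \<open>x\<close> stands for \<open>\<Sum>g. x g \<cdot> g\<close>, for a finite group.\<close>

definition group_algebra :: "('g, 'm) monoid_scheme \<Rightarrow> ('g \<Rightarrow> 'k::field) ring" where
  "group_algebra G =
     \<lparr>carrier = {x. \<forall>g. g \<notin> carrier G \<longrightarrow> x g = 0},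
      mult = (\<lambda>x y g. if g \<in> carrier G
                then \<Sum>h\<in>carrier G. x h * y (inv\<^bsub>G\<^esub> h \<otimes>\<^bsub>G\<^esub> g) else 0),
      one = (\<lambda>g. if g = \<one>\<^bsub>G\<^esub> then 1 else 0),
      zero = 0,
      add = (+)\<rparr>"

definition group_elem :: "'g \<Rightarrow> 'g \<Rightarrow> 'k::field" where
  "group_elem g = (\<lambda>h. if h = g then 1 else 0)"

text \<open>Blocks are the indecomposable direct summands of \<open>FG\<close> as a two-sided ideal.\<close>

definition is_block :: "('g, 'm) monoid_scheme \<Rightarrow> ('g \<Rightarrow> 'k::field) set \<Rightarrow> bool" where
  "is_block G B \<longleftrightarrow>
     ideal B (group_algebra G) \<and> B \<noteq> {0} \<and>
     (\<exists>C. ideal C (group_algebra G) \<and> B \<inter> C = {0} \<and>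
          B <+>\<^bsub>group_algebra G\<^esub> C = carrier (group_algebra G)) \<and>
     (\<forall>I J. ideal I (group_algebra G) \<and> ideal J (group_algebra G) \<and> I \<inter> J = {0} \<and>
            I <+>\<^bsub>group_algebra G\<^esub> J = B \<longrightarrow> I = {0} \<or> J = {0})"

definition algebra_act ::
    "('g, 'm) monoid_scheme \<Rightarrow> ('k::field, 'v::ab_group_add, 'g) gmodule \<Rightarrow> 'v \<Rightarrow> ('g \<Rightarrow> 'k) \<Rightarrow> 'v"
  where
  "algebra_act G M v x = (\<Sum>g\<in>carrier G. scale M (x g) (act M v g))"

text \<open>\<open>M\<close> lies in \<open>B\<close> if \<open>M B = M\<close> and \<open>M B' = 0\<close> for all other blocks \<open>B'\<close>.\<close>

definition lies_in_block ::
    "('g, 'm) monoid_scheme \<Rightarrow> ('k::field, 'v::ab_group_add, 'g) gmodule \<Rightarrow> ('g \<Rightarrow> 'k) set \<Rightarrow> bool"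
  where
  "lies_in_block G M B \<longleftrightarrow>
     is_block G B \<and>
     module.span (scale M) {algebra_act G M v b | v b. v \<in> space M \<and> b \<in> B} = space M \<and>
     (\<forall>B'. is_block G B' \<and> B' \<noteq> B \<longrightarrow> (\<forall>v\<in>space M. \<forall>b\<in>B'. algebra_act G M v b = 0))"

definition fun_scale :: "'k::field \<Rightarrow> ('i \<Rightarrow> 'k) \<Rightarrow> 'i \<Rightarrow> 'k" where
  "fun_scale c v = (\<lambda>i. c * v i)"

definition block_module ::
    "('g, 'm) monoid_scheme \<Rightarrow> ('g \<Rightarrow> 'k::field) set \<Rightarrow> ('k, 'g \<Rightarrow> 'k, 'g \<times> 'g) gmodule" where
  "block_module G B =
     \<lparr>scale = fun_scale,
      space = B,
      act = (\<lambda>x (g, g'). group_elem (inv\<^bsub>G\<^esub> g) \<otimes>\<^bsub>group_algebra G\<^esub> x \<otimes>\<^bsub>group_algebra G\<^esub> group_elem g')\<rparr>"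

definition is_defect_group ::
    "('g, 'm) monoid_scheme \<Rightarrow> ('g \<Rightarrow> 'k::field) set \<Rightarrow> 'g set \<Rightarrow> bool" where
  "is_defect_group G B D \<longleftrightarrow>
     subgroup D G \<and> is_vertex (G \<times>\<times> G) (block_module G B) {(g, g) | g. g \<in> D}"


section \<open>Specht modules\<close>

text \<open>Permutations act on the right, so \<open>g h\<close> means first \<open>g\<close>, then \<open>h\<close>.\<close>

definition sym_right :: "nat \<Rightarrow> (nat \<Rightarrow> nat) monoid" where
  "sym_right n = (sym_group n)\<lparr>mult := (\<lambda>g h. h \<circ> g)\<rparr>"

text \<open>
  A partition is the list of its parts in weakly decreasing order. The box \<open>(i, j)\<close> lies in row \<open>i\<close> and
  column \<open>j\<close>, both counted from \<open>0\<close>. A tableau maps boxes to entries and is \<open>undefined\<close> outside of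
  the diagram.
\<close>

definition diagram :: "nat list \<Rightarrow> (nat \<times> nat) set" where
  "diagram \<mu> = {(i, j). i < length \<mu> \<and> j < \<mu> ! i}"

definition diagram_row :: "nat list \<Rightarrow> nat \<Rightarrow> (nat \<times> nat) set" where
  "diagram_row \<mu> i = {b \<in> diagram \<mu>. fst b = i}"

definition diagram_col :: "nat list \<Rightarrow> nat \<Rightarrow> (nat \<times> nat) set" where
  "diagram_col \<mu> j = {b \<in> diagram \<mu>. snd b = j}"

type_synonym tableau = "nat \<times> nat \<Rightarrow> nat"

definition tableaux :: "nat list \<Rightarrow> tableau set" where
  "tableaux \<mu> = {t \<in> extensional (diagram \<mu>). bij_betw t (diagram \<mu>) {1..sum_list \<mu>}}"

definition tabloid :: "nat list \<Rightarrow> tableau \<Rightarrow> tableau set" where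
  "tabloid \<mu> t = {s \<in> tableaux \<mu>. \<forall>i. s ` diagram_row \<mu> i = t ` diagram_row \<mu> i}"

definition tabloids :: "nat list \<Rightarrow> tableau set set" where
  "tabloids \<mu> = tabloid \<mu> ` tableaux \<mu>"

definition tableau_act :: "nat list \<Rightarrow> tableau \<Rightarrow> (nat \<Rightarrow> nat) \<Rightarrow> tableau" where
  "tableau_act \<mu> t g = restrict (g \<circ> t) (diagram \<mu>)"

definition tabloid_act :: "nat list \<Rightarrow> tableau set \<Rightarrow> (nat \<Rightarrow> nat) \<Rightarrow> tableau set" where
  "tabloid_act \<mu> T g = (\<lambda>t. tableau_act \<mu> t g) ` T"

text \<open>The function \<open>v\<close> stands for \<open>\<Sum>T. v T \<cdot> T\<close>.\<close>

definition perm_module ::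
    "nat list \<Rightarrow> ('k::field, tableau set \<Rightarrow> 'k, nat \<Rightarrow> nat) gmodule" where
  "perm_module \<mu> =
     \<lparr>scale = fun_scale,
      space = {v. \<forall>T. T \<notin> tabloids \<mu> \<longrightarrow> v T = 0},
      act = (\<lambda>v g T. \<Sum>S | S \<in> tabloids \<mu> \<and> tabloid_act \<mu> S g = T. v S)\<rparr>"

definition column_group :: "nat list \<Rightarrow> tableau \<Rightarrow> (nat \<Rightarrow> nat) set" where
  "column_group \<mu> t =
     {g \<in> carrier (sym_right (sum_list \<mu>)).
        \<forall>j. g ` t ` diagram_col \<mu> j = t ` diagram_col \<mu> j}"

definition polytabloid :: "nat list \<Rightarrow> tableau \<Rightarrow> tableau set \<Rightarrow> 'k::field" where
  "polytabloid \<mu> t =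
     (\<lambda>T. \<Sum>g\<in>column_group \<mu> t.
        of_int (sign g) * (if tabloid_act \<mu> (tabloid \<mu> t) g = T then 1 else 0))"

definition specht_module ::
    "nat list \<Rightarrow> ('k::field, tableau set \<Rightarrow> 'k, nat \<Rightarrow> nat) gmodule" where
  "specht_module \<mu> =
     (perm_module \<mu>)\<lparr>space := module.span fun_scale (polytabloid \<mu> ` tableaux \<mu>)\<rparr>"

end

theory Submission
  imports Defs "HOL-Algebra.Sylow"
begin

text \<open>
  Relative projectivity is used in Higman's form: \<open>M\<close> is relatively \<open>Q\<close>-projective if the identity of \<open>M\<close>
  is a transfer \<open>\<Sum>t. t\<^sup>-\<^sup>1 \<phi> t\<close>, over a right transversal of \<open>Q\<close>, of an \<open>FQ\<close>-endomorphism \<open>\<phi>\<close>. For an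
  indecomposable \<open>M\<close> this is the same as being a summand of a module induced from an indecomposable
  \<open>FQ\<close>-module (\<open>summand_of_induced_iff\<close>); by Fitting's lemma one indecomposable summand of the
  restriction to \<open>Q\<close> suffices for the induction. If \<open>M\<close> is relatively \<open>P\<close>-projective and every \<open>R\<close> for which \<open>M\<close> is relatively \<open>R\<close>-projective contains a conjugate
  of \<open>P\<close>, then the vertices of \<open>M\<close> are exactly the conjugates of \<open>P\<close> (\<open>vertex_iff_conjugate\<close>).

  Such a \<open>P\<close> also determines the defect groups of the block \<open>B\<close> of \<open>M\<close>, without any knowledge of the
  block. Suppose that \<open>a\<close> is an element of \<open>FG\<close> that commutes with \<open>H\<close> and that its transfer \<open>z\<close> from \<open>H\<close>
  to \<open>G\<close>, a central element, acts on \<open>M\<close> as a nonzero scalar. Then \<open>z\<close> is not nilpotent on \<open>B\<close>, hence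
  invertible there, because \<open>B\<close> is an indecomposable bimodule; so the identity of \<open>B\<close> is a transfer
  from \<open>H\<close>, and \<open>B\<close> is relatively projective for the diagonal \<open>\<Delta>H\<close> (\<open>block_projective_of_transfer\<close>).
  Conversely, if \<open>B\<close> is relatively \<open>\<Delta>R\<close>-projective then its identity is a transfer from \<open>R\<close>, so \<open>M\<close> is
  relatively \<open>R\<close>-projective (\<open>rel_projective_of_block\<close>) and \<open>R\<close> contains a conjugate of \<open>P\<close>. Together
  this gives \<open>vertices_are_defect_groups\<close>, which asks for an element \<open>a\<close> and a lower bound on \<open>R\<close> only.

  For the Specht module let \<open>\<langle>v, w\<rangle>\<close> be the form for which the tabloids are orthonormal, and let
  \<open>e\<^sub>t\<close> be the polytabloid of the tableau with first two columns \<open>1, 2\<close> and \<open>3, 4\<close>. Two cases occur.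

  If \<open>p\<close> does not divide \<open>(n - 1)(n - 2)\<close>, take for \<open>H\<close> the pointwise stabilizer of \<open>{1, 2, 3, 4}\<close>, for \<open>P\<close>
  a Sylow \<open>p\<close>-subgroup of \<open>H\<close>, and \<open>a = (1 - (1 2))(1 - (3 4))\<close>. As \<open>v a = \<langle>v, e\<^sub>t\<rangle> e\<^sub>t\<close>, the transfer of \<open>a\<close>
  is the frame operator \<open>v \<mapsto> \<Sum> \<langle>v, e\<rangle> e\<close>, where \<open>e\<close> runs over the polytabloids of all choices of the
  first two columns; it is the scalar \<open>8 (n - 1)(n - 2)\<close> because all row sums of \<open>v\<close> vanish
  (\<open>transfer_col_antisym\<close>). The lower bound holds since \<open>P\<close> fixes \<open>e\<^sub>t\<close> and \<open>\<langle>e\<^sub>t, e\<^sub>t\<rangle> = 4 \<noteq> 0\<close>: the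
  restriction to \<open>P\<close> has a trivial summand (\<open>point_stab_bound\<close>).

  If \<open>p\<close> divides \<open>(n - 1)(n - 2)\<close>, take \<open>H = G\<close>, \<open>a = 1\<close> and a Sylow \<open>p\<close>-subgroup \<open>P\<close> of \<open>G\<close>. The dimension
  \<open>(n - 1)(n - 2) / 2 - 1\<close> is \<open>-1\<close> modulo \<open>p\<close>, and taking the trace of the identity, written as a
  transfer from \<open>R\<close>, shows that the index of \<open>R\<close> is prime to \<open>p\<close>, so that \<open>R\<close> contains a conjugate of \<open>P\<close>
  (\<open>full_group_bound\<close>).

  The Specht module is indecomposable because for odd \<open>p\<close> the vectors that both column transpositions
  negate are the multiples of \<open>e\<^sub>t\<close> (\<open>antisymmetric_multiple\<close>); so \<open>e\<^sub>t\<close>, which generates the module, lies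
  in one of the two summands of any decomposition.
\<close>

section \<open>Finite-dimensional subspaces\<close>

context vector_space
begin

lemma subspace_has_finite_basis:
  assumes "finite S" "subspace U" "U \<subseteq> span S"
  obtains B where "finite B" "independent B" "span B = U" "B \<subseteq> U" "card B = dim U"
proof -
  obtain B where B: "B \<subseteq> U" "independent B" "U \<subseteq> span B" "card B = dim U"
    using basis_exists by blast
  have "span B = U" using B span_minimal[OF B(1) assms(2)] by auto
  moreover have "finite B" using independent_span_bound[OF assms(1) B(2)] B(1) assms(3) by blast
  ultimately show ?thesis using that B by blast
qed

lemma subspace_eq_of_dim_le:
  assumes "finite S" "subspace U" "subspace W" "U \<subseteq> W" "W \<subseteq> span S" "dim W \<le> dim U"
  shows "U = W"
proof -
  obtain B where B: "finite B" "independent B" "span B = U" "B \<subseteq> U" "card B = dim U"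
    using subspace_has_finite_basis[OF assms(1,2)] assms by blast
  obtain C where C: "B \<subseteq> C" "C \<subseteq> W" "independent C" "W \<subseteq> span C"
    using maximal_independent_subset_extend[of B W] B assms by blast
  have fC: "finite C" using independent_span_bound[OF assms(1) C(3)] C(2) assms(5) by blast
  have "card C = dim W" using basis_card_eq_dim C by blast
  then have "card C \<le> card B" using B assms by simp
  then have "C = B" using C(1) fC by (metis card_seteq)
  then show ?thesis using B C assms by blast
qed

lemma subspace_dim_mono:
  assumes "finite S" "subspace U" "subspace W" "U \<subseteq> W" "W \<subseteq> span S"
  shows "dim U \<le> dim W"
proof -
  obtain B where B: "finite B" "independent B" "span B = W" "B \<subseteq> W" "card B = dim W"
    using subspace_has_finite_basis[OF assms(1,3,5)] by blast
  show ?thesis using dim_le_card[of U B] B assms by simp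
qed

end

section \<open>Transversals and fixed points of p-groups on cosets\<close>

text \<open>
  Sums over cosets \<open>Q g\<close> are written as sums over a transversal \<open>T\<close>. For functions that are constant on
  these cosets the choice of \<open>T\<close> is immaterial (\<open>transversal_sum_cong\<close>), and translating the argument
  does not change the sum (\<open>transversal_sum_translate\<close>).
\<close>

definition right_transversal :: "('g, 'm) monoid_scheme \<Rightarrow> 'g set \<Rightarrow> 'g set \<Rightarrow> bool" where
  "right_transversal G Q T \<longleftrightarrow>
     T \<subseteq> carrier G \<and> (\<forall>g\<in>carrier G. \<exists>!t. t \<in> T \<and> g \<otimes>\<^bsub>G\<^esub> inv\<^bsub>G\<^esub> t \<in> Q)"

context group
begin

lemma transversal_factor:
  assumes "right_transversal G Q T" "subgroup Q G" "g \<in> carrier G"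
  obtains q t where "q \<in> Q" "t \<in> T" "g = q \<otimes> t"
proof -
  obtain t where t: "t \<in> T" "g \<otimes> inv t \<in> Q"
    using assms unfolding right_transversal_def by blast
  have "t \<in> carrier G" using t assms unfolding right_transversal_def by blast
  then have "g = (g \<otimes> inv t) \<otimes> t" using assms by (simp add: m_assoc)
  then show ?thesis using that t by blast
qed

lemma transversal_unique:
  assumes "right_transversal G Q T" "subgroup Q G" "t \<in> T" "s \<in> T" "q \<in> Q" "t = q \<otimes> s"
  shows "t = s"
proof -
  have c: "t \<in> carrier G" "s \<in> carrier G" "q \<in> carrier G"
    using assms unfolding right_transversal_def by (auto dest: subgroup.mem_carrier)
  have "t \<otimes> inv s \<in> Q" using assms(5) c unfolding assms(6) by (simp add: m_assoc)
  moreover have "t \<otimes> inv t \<in> Q" using c assms by (simp add: subgroup.one_closed)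
  ultimately show ?thesis using assms c unfolding right_transversal_def by blast
qed

lemma transversal_exists:
  assumes "subgroup Q G"
  obtains T where "right_transversal G Q T"
proof -
  define r where "r g = (SOME x. x \<in> Q #> g)" for g
  have r: "r g \<in> Q #> g" if "g \<in> carrier G" for g
    unfolding r_def using rcos_self[OF that assms] by (rule someI)
  have c: "r g \<in> carrier G" if "g \<in> carrier G" for g
    using r[OF that] that assms subgroup.subset r_coset_subset_G by blast
  have eq: "r g = r h" if "g \<in> carrier G" "h \<in> carrier G" "g \<otimes> inv h \<in> Q" for g h
  proof -
    have "g = (g \<otimes> inv h) \<otimes> h" using that by (simp add: m_assoc)
    then have "g \<in> Q #> h" using that unfolding r_coset_def by blast
    then have "Q #> h = Q #> g" using repr_independence[OF _ that(2) assms] by blast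
    then show ?thesis unfolding r_def by simp
  qed
  have mem: "g \<otimes> inv (r g) \<in> Q" if g: "g \<in> carrier G" for g
  proof -
    obtain q where q: "q \<in> Q" "r g = q \<otimes> g" using r[OF g] unfolding r_coset_def by blast
    have qc: "q \<in> carrier G" using q assms by (meson subgroup.mem_carrier)
    have "g \<otimes> inv (r g) = inv q" using q qc g by (simp add: inv_mult_group m_assoc[symmetric])
    then show ?thesis using q assms by (simp add: subgroup.m_inv_closed)
  qed
  have "right_transversal G Q (r ` carrier G)"
    unfolding right_transversal_def
  proof (intro conjI ballI)
    show "r ` carrier G \<subseteq> carrier G" using c by blast
  next
    fix g assume g: "g \<in> carrier G"
    show "\<exists>!t. t \<in> r ` carrier G \<and> g \<otimes> inv t \<in> Q"
    proof (rule ex1I)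
    show "r g \<in> r ` carrier G \<and> g \<otimes> inv (r g) \<in> Q" using g mem by blast
    fix t assume t: "t \<in> r ` carrier G \<and> g \<otimes> inv t \<in> Q"
    then obtain h where h: "h \<in> carrier G" "t = r h" by blast
    have "r g = r t" using eq g t c h by blast
    moreover have "r h = r t" using eq[OF h(1), of t] mem[OF h(1)] c h by simp
    ultimately show "t = r g" using h(2) by argo
    qed
  qed
  then show ?thesis using that by blast
qed

lemma transversal_sum_cong:
  assumes "subgroup Q G" "right_transversal G Q T" "right_transversal G Q T'"
    and F: "\<And>q g. q \<in> Q \<Longrightarrow> g \<in> carrier G \<Longrightarrow> F (q \<otimes> g) = F g"
  shows "sum F T = sum F T'"
proof -
  define r where "r A g = (THE t. t \<in> A \<and> g \<otimes> inv t \<in> Q)" for A g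
  have r: "r A g \<in> A \<and> g \<otimes> inv (r A g) \<in> Q" if "right_transversal G Q A" "g \<in> carrier G" for A g
    unfolding r_def by (rule theI') (use that right_transversal_def in metis)
  have sub: "T \<subseteq> carrier G" "T' \<subseteq> carrier G" using assms by (auto simp: right_transversal_def)
  have ret: "r A (r A' t) = t \<and> r A' t \<in> A' \<and> F (r A' t) = F t"
    if A: "right_transversal G Q A" "right_transversal G Q A'" "t \<in> A" for A A' t
  proof -
    have tc: "t \<in> carrier G" using A by (auto simp: right_transversal_def)
    let ?s = "r A' t"
    have s: "?s \<in> A'" "t \<otimes> inv ?s \<in> Q" using r[OF A(2) tc] by auto
    have sc: "?s \<in> carrier G" using s A by (auto simp: right_transversal_def)
    have "inv (t \<otimes> inv ?s) \<in> Q" using s assms(1) by (simp add: subgroup.m_inv_closed)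
    then have "?s \<otimes> inv t \<in> Q" using tc sc by (simp add: inv_mult_group)
    moreover have "\<exists>!x. x \<in> A \<and> ?s \<otimes> inv x \<in> Q" using A sc by (simp add: right_transversal_def)
    ultimately have "r A ?s = t" unfolding r_def using A(3) by (intro the1_equality) auto
    moreover have "F ((t \<otimes> inv ?s) \<otimes> ?s) = F ?s" using F s sc by blast
    then have "F ?s = F t" using tc sc by (simp add: m_assoc)
    ultimately show ?thesis using s by blast
  qed
  show ?thesis
  proof (rule sum.reindex_bij_witness[where i = "r T" and j = "r T'"])
    fix t assume t: "t \<in> T"
    show "r T (r T' t) = t" "r T' t \<in> T'" "F (r T' t) = F t"
      using ret[OF assms(2,3) t] by blast+
  next
    fix t assume t: "t \<in> T'"
    show "r T' (r T t) = t" "r T t \<in> T"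
      using ret[OF assms(3,2) t] by blast+
  qed
qed

lemma transversal_translate:
  assumes "subgroup Q G" "right_transversal G Q T" "h \<in> carrier G"
  shows "right_transversal G Q ((\<lambda>t. t \<otimes> h) ` T)"
  unfolding right_transversal_def
proof (intro conjI ballI)
  have sub: "T \<subseteq> carrier G" using assms by (auto simp: right_transversal_def)
  then show "(\<lambda>t. t \<otimes> h) ` T \<subseteq> carrier G" using assms by auto
  fix g assume g: "g \<in> carrier G"
  have eq: "g \<otimes> inv (t \<otimes> h) = (g \<otimes> inv h) \<otimes> inv t" if "t \<in> T" for t
    using that sub g assms by (auto simp: inv_mult_group m_assoc subset_iff)
  have "\<exists>!t. t \<in> T \<and> (g \<otimes> inv h) \<otimes> inv t \<in> Q"
    using assms g by (simp add: right_transversal_def)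
  then obtain t where t: "t \<in> T" "(g \<otimes> inv h) \<otimes> inv t \<in> Q"
    and u: "\<And>s. s \<in> T \<Longrightarrow> (g \<otimes> inv h) \<otimes> inv s \<in> Q \<Longrightarrow> s = t" by blast
  show "\<exists>!t. t \<in> (\<lambda>t. t \<otimes> h) ` T \<and> g \<otimes> inv t \<in> Q"
  proof (intro ex1I conjI)
    show "t \<otimes> h \<in> (\<lambda>t. t \<otimes> h) ` T" using t by blast
    show "g \<otimes> inv (t \<otimes> h) \<in> Q" using t eq by simp
    fix s assume "s \<in> (\<lambda>t. t \<otimes> h) ` T \<and> g \<otimes> inv s \<in> Q"
    then obtain s' where "s' \<in> T" "s = s' \<otimes> h" "g \<otimes> inv s \<in> Q" by blast
    then show "s = t \<otimes> h" using u eq by auto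
  qed
qed

lemma transversal_sum_translate:
  assumes "subgroup Q G" "right_transversal G Q T" "h \<in> carrier G"
    and F: "\<And>q g. q \<in> Q \<Longrightarrow> g \<in> carrier G \<Longrightarrow> F (q \<otimes> g) = F g"
  shows "(\<Sum>t\<in>T. F (t \<otimes> h)) = sum F T"
proof -
  have "T \<subseteq> carrier G" using assms by (auto simp: right_transversal_def)
  then have "inj_on (\<lambda>t. t \<otimes> h) T" using assms by (auto intro!: inj_onI simp: subset_iff)
  then have "(\<Sum>t\<in>T. F (t \<otimes> h)) = sum F ((\<lambda>t. t \<otimes> h) ` T)" by (simp add: sum.reindex)
  also have "\<dots> = sum F T"
    by (rule transversal_sum_cong[OF assms(1) transversal_translate[OF assms(1-3)] assms(2)]) (rule F)
  finally show ?thesis .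
qed

lemma bij_betw_transversal:
  assumes "subgroup Q G" "right_transversal G Q T"
  shows "bij_betw (\<lambda>(q, t). q \<otimes> t) (Q \<times> T) (carrier G)"
proof (rule bij_betw_imageI)
  have sub: "T \<subseteq> carrier G" "Q \<subseteq> carrier G"
    using assms by (auto simp: right_transversal_def dest: subgroup.subset)
  show "inj_on (\<lambda>(q, t). q \<otimes> t) (Q \<times> T)"
  proof (rule inj_onI, clarify)
    fix q t q' t' assume *: "q \<in> Q" "t \<in> T" "q' \<in> Q" "t' \<in> T" "q \<otimes> t = q' \<otimes> t'"
    then have c: "q \<in> carrier G" "q' \<in> carrier G" "t \<in> carrier G" "t' \<in> carrier G" using sub by auto
    have "t = (inv q \<otimes> q') \<otimes> t'" using * c by (metis inv_solve_left m_assoc inv_closed m_closed)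
    moreover have "inv q \<otimes> q' \<in> Q"
      using assms * by (simp add: subgroup.m_closed subgroup.m_inv_closed)
    ultimately have "t = t'" using transversal_unique[OF assms(2,1)] * by blast
    then show "q = q' \<and> t = t'" using * c by simp
  qed
  have "g \<in> (\<lambda>(q, t). q \<otimes> t) ` (Q \<times> T)" if gc: "g \<in> carrier G" for g
  proof -
    obtain q t where "q \<in> Q" "t \<in> T" "g = q \<otimes> t" by (rule transversal_factor[OF assms(2,1) gc])
    then show ?thesis by (auto intro!: rev_image_eqI[of "(q, t)"])
  qed
  then show "(\<lambda>(q, t). q \<otimes> t) ` (Q \<times> T) = carrier G" using sub by auto
qed

lemma card_transversal:
  assumes "subgroup Q G" "right_transversal G Q T"
  shows "card Q * card T = Coset.order G"
  using bij_betw_same_card[OF bij_betw_transversal[OF assms]] by (simp add: card_cartesian_product Coset.order_def)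

lemma group_subgroup: "subgroup Q G \<Longrightarrow> group (G\<lparr>carrier := Q\<rparr>)"
  using subgroup.subgroup_is_group is_group by blast

lemma transversal_product:
  assumes "subgroup Q G" "subgroup H G" "Q \<subseteq> H"
    and "right_transversal (G\<lparr>carrier := H\<rparr>) Q T1" "right_transversal G H T2"
  shows "inj_on (\<lambda>(x, y). x \<otimes> y) (T1 \<times> T2)"
    and "right_transversal G Q ((\<lambda>(x, y). x \<otimes> y) ` (T1 \<times> T2))"
proof -
  have T1: "T1 \<subseteq> H" "\<And>h. h \<in> H \<Longrightarrow> \<exists>!t. t \<in> T1 \<and> h \<otimes> inv t \<in> Q"
  proof -
    show sub: "T1 \<subseteq> H" using assms(4) by (simp add: right_transversal_def)
    fix h assume "h \<in> H"
    then have "\<exists>!t. t \<in> T1 \<and> h \<otimes> inv\<^bsub>G\<lparr>carrier := H\<rparr>\<^esub> t \<in> Q"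
      using assms(4) by (simp add: right_transversal_def)
    then show "\<exists>!t. t \<in> T1 \<and> h \<otimes> inv t \<in> Q"
      using sub m_inv_consistent[OF assms(2)] by (metis subsetD)
  qed
  have T2: "T2 \<subseteq> carrier G" using assms by (auto simp: right_transversal_def)
  have Hc: "H \<subseteq> carrier G" using assms by (simp add: subgroup.subset)
  have bij: "bij_betw (\<lambda>(q, t). q \<otimes> t) (H \<times> T2) (carrier G)"
    using bij_betw_transversal assms by blast
  show "inj_on (\<lambda>(x, y). x \<otimes> y) (T1 \<times> T2)"
    by (rule inj_on_subset[OF bij_betw_imp_inj_on[OF bij]]) (use T1 in auto)
  show "right_transversal G Q ((\<lambda>(x, y). x \<otimes> y) ` (T1 \<times> T2))"
    unfolding right_transversal_def
  proof (intro conjI ballI)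
    show "(\<lambda>(x, y). x \<otimes> y) ` (T1 \<times> T2) \<subseteq> carrier G"
      using subset_trans[OF T1(1) Hc] T2 by (auto simp: subset_iff)
    fix g assume g: "g \<in> carrier G"
    obtain h y where hy: "h \<in> H" "y \<in> T2" "g = h \<otimes> y" by (rule transversal_factor[OF assms(5,2) g])
    obtain x where x: "x \<in> T1" "h \<otimes> inv x \<in> Q" using T1 hy by blast
    have c: "h \<in> carrier G" "y \<in> carrier G" "x \<in> carrier G" using hy x T1 T2 Hc by auto
    show "\<exists>!t. t \<in> (\<lambda>(x, y). x \<otimes> y) ` (T1 \<times> T2) \<and> g \<otimes> inv t \<in> Q"
    proof (intro ex1I conjI)
      show "x \<otimes> y \<in> (\<lambda>(x, y). x \<otimes> y) ` (T1 \<times> T2)" using x hy by auto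
      have "g \<otimes> inv (x \<otimes> y) = h \<otimes> inv x" using c hy
        by (simp add: inv_mult_group m_assoc) (simp add: m_assoc[symmetric])
      then show "g \<otimes> inv (x \<otimes> y) \<in> Q" using x by simp
      fix t assume "t \<in> (\<lambda>(x, y). x \<otimes> y) ` (T1 \<times> T2) \<and> g \<otimes> inv t \<in> Q"
      then obtain x' y' where t: "x' \<in> T1" "y' \<in> T2" "t = x' \<otimes> y'" "g \<otimes> inv t \<in> Q" by auto
      have c': "x' \<in> carrier G" "y' \<in> carrier G" using t T1 T2 Hc by auto
      define q where "q = g \<otimes> inv t"
      have q: "q \<in> Q" "q \<in> H" "q \<in> carrier G" using t assms Hc q_def by auto
      have "g = q \<otimes> t" unfolding q_def using g c' t by (simp add: m_assoc)
      then have e: "h \<otimes> y = (q \<otimes> x') \<otimes> y'" using hy t q c' by (simp add: m_assoc)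
      have "q \<otimes> x' \<in> H" using q t T1 assms by (simp add: subgroup.m_closed subset_iff)
      then have "(h, y) = (q \<otimes> x', y')"
        using inj_onD[OF bij_betw_imp_inj_on[OF bij], of "(h,y)" "(q \<otimes> x', y')"] e hy t by auto
      then have "h \<otimes> inv x' \<in> Q" "y = y'" using q c' by (auto simp: m_assoc)
      then have "x' = x" using T1(2)[OF hy(1)] x t by blast
      then show "t = x \<otimes> y" using t \<open>y = y'\<close> by simp
    qed
  qed
qed

text \<open>
  Right multiplication makes \<open>P\<close> act on the cosets \<open>R g\<close>, and \<open>f\<close> is a function that is constant on
  \<open>P\<close>-orbits. If no coset is fixed, all orbit lengths are divisible by \<open>p\<close>, so the sum of \<open>f\<close> vanishes
  in characteristic \<open>p\<close>; and \<open>R g\<close> is fixed exactly when \<open>g P g\<^sup>-\<^sup>1 \<subseteq> R\<close>.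
\<close>

lemma p_group_fixes_coset:
  fixes f :: "'a \<Rightarrow> 'k::field"
  assumes fin: "finite (carrier G)" and R: "subgroup R G" and P: "subgroup P G"
    and p: "prime p" "CHAR('k) = p" "card P = p ^ k"
    and T: "right_transversal G R T"
    and left: "\<And>r g. r \<in> R \<Longrightarrow> g \<in> carrier G \<Longrightarrow> f (r \<otimes> g) = f g"
    and right: "\<And>g h. g \<in> carrier G \<Longrightarrow> h \<in> P \<Longrightarrow> f (g \<otimes> h) = f g"
    and nz: "sum f T \<noteq> 0"
  shows "\<exists>g\<in>carrier G. \<forall>h\<in>P. g \<otimes> h \<otimes> inv g \<in> R"
proof (rule ccontr)
  assume none: "\<not> ?thesis"
  have Pc: "P \<subseteq> carrier G" and Rc: "R \<subseteq> carrier G" using P R by (simp_all add: subgroup.subset)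
  have Tc: "T \<subseteq> carrier G" using T by (auto simp: right_transversal_def)
  define F where "F C = f (SOME g. g \<in> C)" for C
  have F: "F (R #> g) = f g" if g: "g \<in> carrier G" for g
  proof -
    have "(SOME x. x \<in> R #> g) \<in> R #> g" using rcos_self[OF g R] by (rule someI)
    then obtain r where "r \<in> R" "(SOME x. x \<in> R #> g) = r \<otimes> g" unfolding r_coset_def by blast
    then show ?thesis unfolding F_def using left g by simp
  qed
  have coset_eq: "R #> g = R #> g' \<longleftrightarrow> g \<otimes> inv g' \<in> R" if "g \<in> carrier G" "g' \<in> carrier G" for g g'
  proof
    assume "R #> g = R #> g'"
    then have "g \<in> R #> g'" using rcos_self[OF that(1) R] by simp
    then obtain r where "r \<in> R" "g = r \<otimes> g'" unfolding r_coset_def by blast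
    then show "g \<otimes> inv g' \<in> R" using that Rc by (auto simp: m_assoc subset_iff)
  next
    assume *: "g \<otimes> inv g' \<in> R"
    have "g = (g \<otimes> inv g') \<otimes> g'" using that by (simp add: m_assoc)
    then have "g \<in> R #> g'" using * unfolding r_coset_def by blast
    then show "R #> g = R #> g'" using repr_independence[OF _ that(2) R] by simp
  qed
  \<comment> \<open>Induction over \<open>P\<close>-stable sets of cosets, removing one orbit at a time.\<close>
  have zero: "sum F X = 0" if "finite X" "X \<subseteq> rcosets R" "\<And>C h. C \<in> X \<Longrightarrow> h \<in> P \<Longrightarrow> C #> h \<in> X" for X
    using that
  proof (induction X rule: finite_psubset_induct)
    case (psubset X)
    show ?case
    proof (cases "X = {}")
      case False
      then obtain C where C: "C \<in> X" by blast
      then obtain g where g: "g \<in> carrier G" "C = R #> g" using psubset.prems(1) unfolding RCOSETS_def by blast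
      \<comment> \<open>The stabilizer of \<open>C\<close> in \<open>P\<close>; its transversal \<open>U\<close> parametrizes the orbit of \<open>C\<close>.\<close>
      define A where "A = {h \<in> P. g \<otimes> h \<otimes> inv g \<in> R}"
      have As: "subgroup A G"
      proof (rule subgroupI)
        show "A \<subseteq> carrier G" using Pc A_def by auto
        show "A \<noteq> {}" using g P R by (auto simp: A_def intro!: exI[of _ \<one>] subgroup.one_closed)
        fix a assume a: "a \<in> A"
        have ac: "a \<in> carrier G" using a Pc A_def by auto
        have "inv (g \<otimes> a \<otimes> inv g) \<in> R" using a R by (simp add: A_def subgroup.m_inv_closed)
        then show "inv a \<in> A" using a P g ac by (simp add: A_def subgroup.m_inv_closed inv_mult_group m_assoc)
        fix b assume b: "b \<in> A"
        have bc: "b \<in> carrier G" using b Pc A_def by auto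
        have "(g \<otimes> a \<otimes> inv g) \<otimes> (g \<otimes> b \<otimes> inv g) \<in> R" using a b R by (simp add: A_def subgroup.m_closed)
        moreover have "(g \<otimes> a \<otimes> inv g) \<otimes> (g \<otimes> b \<otimes> inv g) = g \<otimes> (a \<otimes> b) \<otimes> inv g"
          using ac bc g by (simp add: m_assoc inv_solve_left')
        ultimately show "a \<otimes> b \<in> A" using a b P by (simp add: A_def subgroup.m_closed)
      qed
      interpret K: group "G\<lparr>carrier := P\<rparr>" using group_subgroup P by blast
      have AK: "subgroup A (G\<lparr>carrier := P\<rparr>)"
        using As P by (simp add: subgroup_incl A_def)
      obtain U where U: "right_transversal (G\<lparr>carrier := P\<rparr>) A U" using K.transversal_exists[OF AK] by blast
      have cardU: "card A * card U = p ^ k" using K.card_transversal[OF AK U] p by (simp add: Coset.order_def)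
      have UP: "U \<subseteq> P" using U by (auto simp: right_transversal_def)
      let ?O = "(\<lambda>h. C #> h) ` U"
      have Ch: "C #> h = R #> (g \<otimes> h)" if "h \<in> P" for h
        using that g Pc Rc coset_mult_assoc by blast
      have eqiff: "C #> h = C #> h' \<longleftrightarrow> h \<otimes> inv h' \<in> A" if "h \<in> P" "h' \<in> P" for h h'
      proof -
        have c: "h \<in> carrier G" "h' \<in> carrier G" using that Pc by auto
        have "h \<otimes> inv h' \<in> P" using that P by (simp add: subgroup.m_closed subgroup.m_inv_closed)
        moreover have "(g \<otimes> h) \<otimes> inv (g \<otimes> h') = g \<otimes> (h \<otimes> inv h') \<otimes> inv g"
          using c g by (simp add: inv_mult_group m_assoc)
        ultimately show ?thesis using Ch[OF that(1)] Ch[OF that(2)] coset_eq c g by (simp add: A_def)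
      qed
      have inj: "inj_on (\<lambda>h. C #> h) U"
      proof (rule inj_onI)
        fix h h' assume h: "h \<in> U" "h' \<in> U" "C #> h = C #> h'"
        then have a: "h \<otimes> inv h' \<in> A" using eqiff UP by blast
        have "h = (h \<otimes> inv h') \<otimes>\<^bsub>G\<lparr>carrier := P\<rparr>\<^esub> h'"
          using h UP Pc by (auto simp: m_assoc subset_iff)
        then show "h = h'" by (rule K.transversal_unique[OF U AK h(1,2) a])
      qed
      have Oall: "C #> h \<in> ?O" if h: "h \<in> P" for h
      proof -
        have "h \<in> carrier (G\<lparr>carrier := P\<rparr>)" using h by simp
        then obtain a u where "a \<in> A" "u \<in> U" "h = a \<otimes>\<^bsub>G\<lparr>carrier := P\<rparr>\<^esub> u"
          by (rule K.transversal_factor[OF U AK])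
        then have "h \<otimes> inv u \<in> A" using UP Pc As by (auto simp: m_assoc subset_iff A_def)
        then have "C #> h = C #> u" using eqiff[OF h] UP \<open>u \<in> U\<close> by blast
        then show ?thesis using \<open>u \<in> U\<close> by simp
      qed
      have OX: "?O \<subseteq> X" using psubset.prems(2) C UP by blast
      have C1: "C = C #> \<one>" using g Rc by (simp add: coset_mult_assoc)
      then have CO: "C \<in> ?O" using Oall[OF subgroup.one_closed[OF P]] by simp
      have pU: "p dvd card U"
      proof (rule ccontr)
        assume "\<not> p dvd card U"
        have "card U dvd p ^ k" unfolding cardU[symmetric] by simp
        then obtain i where i: "card U = p ^ i" using divides_primepow_nat[OF p(1)] by blast
        then have "card U = 1" using \<open>\<not> p dvd card U\<close> by (cases i) auto
        then have "card A = card P" using cardU p by simp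
        then have "A = P" using fin Pc by (metis (no_types, lifting) A_def card_subset_eq finite_subset mem_Collect_eq subsetI)
        then show False using none g unfolding A_def by blast
      qed
      have "F x = f g" if x: "x \<in> ?O" for x
      proof -
        obtain h where h: "h \<in> P" "x = C #> h" using x UP by blast
        have "F x = f (g \<otimes> h)" using h Ch F g Pc by auto
        then show ?thesis using right g h by simp
      qed
      then have "sum F ?O = of_nat (card ?O) * f g" by simp
      also have "card ?O = card U" using inj by (rule card_image)
      also have "of_nat (card U) = (0 :: 'k)" using pU p by (simp add: of_nat_eq_0_iff_char_dvd)
      finally have s0: "sum F ?O = 0" by simp
      have "sum F (X - ?O) = 0"
      proof (rule psubset.IH)
        show "X - ?O \<subset> X" using CO C by blast
        show "X - ?O \<subseteq> rcosets R" using psubset.prems by blast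
        fix D h assume D: "D \<in> X - ?O" and h: "h \<in> P"
        have "D #> h \<notin> ?O"
        proof
          assume "D #> h \<in> ?O"
          then obtain u where u: "u \<in> U" "D #> h = C #> u" by blast
          have Dc: "D \<subseteq> carrier G" using D psubset.prems rcosets_subset_PowG[OF R] by blast
          have Cc: "C \<subseteq> carrier G" using g Rc r_coset_subset_G by blast
          have cc: "h \<in> carrier G" "u \<in> carrier G" using h u UP Pc by auto
          have "D = D #> h #> inv h" using Dc cc by (simp add: coset_mult_assoc coset_mult_one)
          also have "\<dots> = C #> (u \<otimes> inv h)" using u Cc cc by (simp add: coset_mult_assoc)
          finally have De: "D = C #> (u \<otimes> inv h)" .
          have "u \<otimes> inv h \<in> P" using u h UP P by (simp add: subgroup.m_closed subgroup.m_inv_closed subsetD)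
          then show False using Oall De D by blast
        qed
        then show "D #> h \<in> X - ?O" using psubset.prems D h by blast
      qed
      then show ?thesis using s0 sum.subset_diff[OF OX psubset.hyps, of F] by simp
    qed simp
  qed
  have "sum F (rcosets R) = sum f T"
  proof (rule sum.reindex_bij_witness[symmetric, where j = "\<lambda>t. R #> t" and i = "\<lambda>C. THE t. t \<in> T \<and> C = R #> t"])
    fix t assume t: "t \<in> T"
    show "(THE s. s \<in> T \<and> R #> t = R #> s) = t"
    proof (rule the_equality)
      fix s assume s: "s \<in> T \<and> R #> t = R #> s"
      then have "t \<otimes> inv s \<in> R" using coset_eq t Tc by blast
      moreover have "t = (t \<otimes> inv s) \<otimes> s" using s t Tc by (auto simp: m_assoc subset_iff)
      ultimately show "s = t" using transversal_unique[OF T R t, of s "t \<otimes> inv s"] s by simp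
    qed (use t in simp)
    show "R #> t \<in> rcosets R" using t Tc Rc rcosetsI by blast
    show "F (R #> t) = f t" using F t Tc by blast
  next
    fix C assume "C \<in> rcosets R"
    then obtain g where g: "g \<in> carrier G" "C = R #> g" unfolding RCOSETS_def by blast
    obtain r t where rt: "r \<in> R" "t \<in> T" "g = r \<otimes> t" by (rule transversal_factor[OF T R g(1)])
    then have tc: "t \<in> carrier G" "r \<in> carrier G" using Tc Rc by auto
    have "C = R #> t" using coset_eq[OF g(1) tc(1)] g rt tc by (simp add: m_assoc)
    moreover have "s = t" if "s \<in> T" "C = R #> s" for s
    proof -
      have "t \<otimes> inv s \<in> R" using coset_eq[of t s] that \<open>C = R #> t\<close> tc Tc by auto
      moreover have "t = (t \<otimes> inv s) \<otimes> s" using that tc Tc by (auto simp: m_assoc subset_iff)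
      ultimately show "s = t" using transversal_unique[OF T R rt(2), of s "t \<otimes> inv s"] that by simp
    qed
    ultimately have "(THE s. s \<in> T \<and> C = R #> s) = t" using rt(2) by (intro the_equality) auto
    then show "(THE s. s \<in> T \<and> C = R #> s) \<in> T" "R #> (THE s. s \<in> T \<and> C = R #> s) = C"
      using rt \<open>C = R #> t\<close> by auto
  qed
  moreover have "sum F (rcosets R) = 0"
  proof (rule zero)
    show "finite (rcosets R)" using fin rcosets_subset_PowG[OF R] by (meson finite_Pow_iff finite_subset)
    fix C h assume C: "C \<in> rcosets R" and h: "h \<in> P"
    then obtain g where g: "g \<in> carrier G" "C = R #> g" unfolding RCOSETS_def by blast
    then have "C #> h = R #> (g \<otimes> h)" using h Pc Rc coset_mult_assoc by blast
    then show "C #> h \<in> rcosets R" using g h Pc Rc rcosetsI by auto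
  qed simp
  ultimately show False using nz by simp
qed

end

section \<open>Homomorphisms and relative projectivity\<close>

definition fg_hom ::
    "('g, 'm) monoid_scheme \<Rightarrow> ('k::field, 'v::ab_group_add, 'g) gmodule \<Rightarrow>
     ('k, 'w::ab_group_add, 'g) gmodule \<Rightarrow> ('v \<Rightarrow> 'w) \<Rightarrow> bool" where
  "fg_hom G M N f \<longleftrightarrow>
     (\<forall>v\<in>space M. f v \<in> space N) \<and>
     (\<forall>v\<in>space M. \<forall>w\<in>space M. f (v + w) = f v + f w) \<and>
     (\<forall>c. \<forall>v\<in>space M. f (scale M c v) = scale N c (f v)) \<and>
     (\<forall>v\<in>space M. \<forall>g\<in>carrier G. f (act M v g) = act N (f v) g)"

lemma fg_homI:
  assumes "\<And>v. v \<in> space M \<Longrightarrow> f v \<in> space N"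
    and "\<And>v w. v \<in> space M \<Longrightarrow> w \<in> space M \<Longrightarrow> f (v + w) = f v + f w"
    and "\<And>c v. v \<in> space M \<Longrightarrow> f (scale M c v) = scale N c (f v)"
    and "\<And>v g. v \<in> space M \<Longrightarrow> g \<in> carrier G \<Longrightarrow> f (act M v g) = act N (f v) g"
  shows "fg_hom G M N f"
  using assms by (auto simp: fg_hom_def)

lemma fg_homD:
  assumes "fg_hom G M N f"
  shows "v \<in> space M \<Longrightarrow> f v \<in> space N"
    and "v \<in> space M \<Longrightarrow> w \<in> space M \<Longrightarrow> f (v + w) = f v + f w"
    and "v \<in> space M \<Longrightarrow> f (scale M c v) = scale N c (f v)"
    and "v \<in> space M \<Longrightarrow> g \<in> carrier G \<Longrightarrow> f (act M v g) = act N (f v) g"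
  using assms by (auto simp: fg_hom_def)

lemma fg_hom_compose: "fg_hom G M N f \<Longrightarrow> fg_hom G N L h \<Longrightarrow> fg_hom G M L (\<lambda>v. h (f v))"
  unfolding fg_hom_def by simp

lemma fg_hom_submodule:
  "fg_hom G M (N\<lparr>space := U\<rparr>) f \<Longrightarrow> U \<subseteq> space N \<Longrightarrow> fg_hom G M N f"
  unfolding fg_hom_def by auto

lemma fg_hom_restrict_group:
  "fg_hom G M N f \<Longrightarrow> Q \<subseteq> carrier G \<Longrightarrow> fg_hom (G\<lparr>carrier := Q\<rparr>) M N f"
  unfolding fg_hom_def by auto

lemma fg_isomorphic_iff:
  "fg_isomorphic G M N \<longleftrightarrow> (\<exists>f. fg_hom G M N f \<and> bij_betw f (space M) (space N))"
  unfolding fg_isomorphic_def fg_hom_def by (auto dest: bij_betwE)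

text \<open>
  Stated without finite generation, so that it applies to induced modules directly.
\<close>

lemma direct_sum_projection:
  assumes vs: "vector_space (scale M)" and ds: "fg_direct_sum G M U W"
    and add: "\<And>v w g. v \<in> space M \<Longrightarrow> w \<in> space M \<Longrightarrow> g \<in> carrier G \<Longrightarrow>
                act M (v + w) g = act M v g + act M w g"
  obtains pr where "fg_hom G M (M\<lparr>space := U\<rparr>) pr" "\<And>u. u \<in> U \<Longrightarrow> pr u = u"
    "\<And>w. w \<in> W \<Longrightarrow> pr w = 0" "\<And>v. v \<in> space M \<Longrightarrow> v - pr v \<in> W"
proof -
  interpret vs: vector_space "scale M" by fact
  have U: "U \<subseteq> space M" "vs.subspace U" "\<And>u g. u \<in> U \<Longrightarrow> g \<in> carrier G \<Longrightarrow> act M u g \<in> U"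
    and W: "W \<subseteq> space M" "vs.subspace W" "\<And>u g. u \<in> W \<Longrightarrow> g \<in> carrier G \<Longrightarrow> act M u g \<in> W"
    and I: "U \<inter> W = {0}" and S: "space M = {u + w | u w. u \<in> U \<and> w \<in> W}"
    using ds by (auto simp: fg_direct_sum_def fg_submodule_def)
  define pr where "pr v = (THE u. u \<in> U \<and> v - u \<in> W)" for v
  have uniq: "u = u'" if "u \<in> U" "u' \<in> U" "v - u \<in> W" "v - u' \<in> W" for u u' v
  proof -
    have "u - u' \<in> U" using that U vs.subspace_diff by blast
    moreover have "(v - u') - (v - u) \<in> W" using that W vs.subspace_diff by blast
    ultimately have "u - u' \<in> U \<inter> W" by simp
    then show ?thesis using I by simp
  qed
  have ex: "\<exists>u. u \<in> U \<and> v - u \<in> W" if "v \<in> space M" for v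
    using that S by force
  have pr: "pr v = u" if "u \<in> U" "v - u \<in> W" for v u
    unfolding pr_def by (rule the_equality) (use that uniq in blast)+
  have prD: "pr v \<in> U \<and> v - pr v \<in> W" if "v \<in> space M" for v
    using ex[OF that] pr by blast
  show ?thesis
  proof (rule that)
    show "fg_hom G M (M\<lparr>space := U\<rparr>) pr"
    proof (rule fg_homI)
      fix v assume v: "v \<in> space M"
      show "pr v \<in> space (M\<lparr>space := U\<rparr>)" using prD v by simp
      fix w assume w: "w \<in> space M"
      have "(v + w) - (pr v + pr w) = (v - pr v) + (w - pr w)" by simp
      also have "\<dots> \<in> W" using prD v w W vs.subspace_add by blast
      finally show "pr (v + w) = pr v + pr w" using prD v w U vs.subspace_add by (intro pr) auto
    next
      fix c v assume v: "v \<in> space M"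
      have "scale M c v - scale M c (pr v) = scale M c (v - pr v)" by (simp add: vs.scale_right_diff_distrib)
      also have "\<dots> \<in> W" using prD v W vs.subspace_scale by blast
      finally show "pr (scale M c v) = scale (M\<lparr>space := U\<rparr>) c (pr v)"
        using prD v U vs.subspace_scale by (auto intro!: pr)
    next
      fix v g assume v: "v \<in> space M" and g: "g \<in> carrier G"
      have "act M (pr v + (v - pr v)) g = act M (pr v) g + act M (v - pr v) g"
        by (rule add) (use prD v g U W in auto)
      then have "act M v g - act M (pr v) g = act M (v - pr v) g" by simp
      also have "\<dots> \<in> W" using W prD v g by blast
      finally show "pr (act M v g) = act (M\<lparr>space := U\<rparr>) (pr v) g" using prD v g U by (auto intro!: pr)
    qed
    show "pr u = u" if "u \<in> U" for u using that pr vs.subspace_0[OF W(2)] by auto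
    show "pr w = 0" if "w \<in> W" for w using that pr vs.subspace_0[OF U(2)] by auto
    show "v - pr v \<in> W" if "v \<in> space M" for v using that prD by auto
  qed
qed

locale fg_mod =
  fixes G :: "('g, 'm) monoid_scheme" (structure)
    and M :: "('k::field, 'v::ab_group_add, 'g) gmodule"
  assumes fg: "fg_module G M"
begin

sublocale group G using fg by (simp add: fg_module_def)
sublocale vs: vector_space "scale M" using fg by (simp add: fg_module_def)

lemma subspace_space: "vs.subspace (space M)" using fg by (simp add: fg_module_def)

lemma finite_spanning: obtains S where "finite S" "vs.span S = space M"
  using fg by (auto simp: fg_module_def)

lemma space_zero [simp]: "0 \<in> space M" using subspace_space vs.subspace_0 by blast
lemma space_add [simp]: "v \<in> space M \<Longrightarrow> w \<in> space M \<Longrightarrow> v + w \<in> space M"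
  using subspace_space vs.subspace_add by blast
lemma space_diff [simp]: "v \<in> space M \<Longrightarrow> w \<in> space M \<Longrightarrow> v - w \<in> space M"
  using subspace_space vs.subspace_diff by blast
lemma space_scale [simp]: "v \<in> space M \<Longrightarrow> scale M c v \<in> space M"
  using subspace_space vs.subspace_scale by blast
lemma space_sum: "(\<And>i. i \<in> I \<Longrightarrow> f i \<in> space M) \<Longrightarrow> sum f I \<in> space M"
  using subspace_space vs.subspace_sum by blast

lemma act_closed [simp]: "v \<in> space M \<Longrightarrow> g \<in> carrier G \<Longrightarrow> act M v g \<in> space M"
  using fg by (simp add: fg_module_def)
lemma act_add: "v \<in> space M \<Longrightarrow> w \<in> space M \<Longrightarrow> g \<in> carrier G \<Longrightarrow> act M (v + w) g = act M v g + act M w g"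
  using fg by (simp add: fg_module_def)
lemma act_scale: "v \<in> space M \<Longrightarrow> g \<in> carrier G \<Longrightarrow> act M (scale M c v) g = scale M c (act M v g)"
  using fg by (simp add: fg_module_def)
lemma act_one [simp]: "v \<in> space M \<Longrightarrow> act M v \<one> = v"
  using fg by (simp add: fg_module_def)
lemma act_mult: "v \<in> space M \<Longrightarrow> g \<in> carrier G \<Longrightarrow> h \<in> carrier G \<Longrightarrow> act M (act M v g) h = act M v (g \<otimes> h)"
  using fg by (simp add: fg_module_def)
lemma act_zero [simp]: "g \<in> carrier G \<Longrightarrow> act M 0 g = 0"
  using act_add[of 0 0 g] by simp
lemma act_diff: "v \<in> space M \<Longrightarrow> w \<in> space M \<Longrightarrow> g \<in> carrier G \<Longrightarrow> act M (v - w) g = act M v g - act M w g"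
  using act_add[of "v - w" w g] by simp
lemma act_sum: "(\<And>i. i \<in> I \<Longrightarrow> f i \<in> space M) \<Longrightarrow> g \<in> carrier G \<Longrightarrow>
    act M (sum f I) g = (\<Sum>i\<in>I. act M (f i) g)"
  by (induction I rule: infinite_finite_induct) (auto simp: act_add space_sum)

lemma hom_zero: "fg_hom K M N f \<Longrightarrow> f 0 = 0"
  using fg_homD(2)[of K M N f 0 0] by simp
lemma hom_diff: "fg_hom K M N f \<Longrightarrow> v \<in> space M \<Longrightarrow> w \<in> space M \<Longrightarrow> f (v - w) = f v - f w"
  using fg_homD(2)[of K M N f "v - w" w] by (simp add: algebra_simps)
lemma hom_sum: "fg_hom K M N f \<Longrightarrow> (\<And>i. i \<in> I \<Longrightarrow> h i \<in> space M) \<Longrightarrow> f (sum h I) = (\<Sum>i\<in>I. f (h i))"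
  by (induction I rule: infinite_finite_induct) (auto simp: hom_zero fg_homD(2) space_sum)

lemma subgroup_module: "subgroup Q G \<Longrightarrow> fg_module (G\<lparr>carrier := Q\<rparr>) M"
  using fg group_subgroup by (auto simp: fg_module_def subgroup.mem_carrier)

lemma submodule_module:
  assumes "fg_submodule G M U"
  shows "fg_module G (M\<lparr>space := U\<rparr>)"
proof -
  obtain S where "finite S" "vs.span S = space M" by (rule finite_spanning)
  moreover have "vs.subspace U" "U \<subseteq> space M" using assms by (auto simp: fg_submodule_def)
  ultimately obtain B where "finite B" "vs.span B = U"
    using vs.subspace_has_finite_basis[of S U] by metis
  then show ?thesis
    using assms fg by (auto simp: fg_module_def fg_submodule_def subset_iff)
qed

text \<open>
  This makes the terms of a transfer constant on cosets \<open>Q g\<close>, so that \<open>transfer\<close> below does not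
  depend on the transversal and maps \<open>FQ\<close>-endomorphisms to \<open>FG\<close>-endomorphisms.
\<close>

lemma transfer_term_invariant:
  assumes "subgroup Q G" "fg_hom (G\<lparr>carrier := Q\<rparr>) M M \<phi>" "v \<in> space M" "q \<in> Q" "g \<in> carrier G"
  shows "act M (\<phi> (act M v (inv (q \<otimes> g)))) (q \<otimes> g) = act M (\<phi> (act M v (inv g))) g"
proof -
  have q: "q \<in> carrier G" "inv q \<in> Q"
    using assms by (simp_all add: subgroup.mem_carrier subgroup.m_inv_closed)
  have m: "\<phi> w \<in> space M" if "w \<in> space M" for w using that assms fg_homD(1) by blast
  have "act M v (inv (q \<otimes> g)) = act M (act M v (inv g)) (inv q)"
    using assms q by (simp add: inv_mult_group act_mult)
  then have "\<phi> (act M v (inv (q \<otimes> g))) = act M (\<phi> (act M v (inv g))) (inv q)"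
    using assms q fg_homD(4)[OF assms(2)] by simp
  then show ?thesis using assms q m by (simp add: act_mult m_assoc[symmetric])
qed

definition transfer :: "'g set \<Rightarrow> ('v \<Rightarrow> 'v) \<Rightarrow> 'v \<Rightarrow> 'v" where
  "transfer T \<phi> v = (\<Sum>t\<in>T. act M (\<phi> (act M v (inv t))) t)"

lemma transfer_hom:
  assumes Q: "subgroup Q G" and T: "right_transversal G Q T"
    and \<phi>: "fg_hom (G\<lparr>carrier := Q\<rparr>) M M \<phi>"
  shows "fg_hom G M M (transfer T \<phi>)"
proof (rule fg_homI)
  have Tc: "\<And>t. t \<in> T \<Longrightarrow> t \<in> carrier G" using T by (auto simp: right_transversal_def)
  note m = fg_homD(1)[OF \<phi>]
  fix v assume v: "v \<in> space M"
  show "transfer T \<phi> v \<in> space M" unfolding transfer_def using v Tc m by (auto intro!: space_sum)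
  { fix w assume w: "w \<in> space M"
    show "transfer T \<phi> (v + w) = transfer T \<phi> v + transfer T \<phi> w"
      unfolding transfer_def using v w Tc m fg_homD(2)[OF \<phi>] by (simp add: act_add sum.distrib) }
  { fix c show "transfer T \<phi> (scale M c v) = scale M c (transfer T \<phi> v)"
      unfolding transfer_def using v Tc m fg_homD(3)[OF \<phi>] by (simp add: act_scale vs.scale_sum_right) }
  fix h assume h: "h \<in> carrier G"
  let ?F = "\<lambda>g. act M (\<phi> (act M (act M v h) (inv g))) g"
  have "act M (transfer T \<phi> v) h = (\<Sum>t\<in>T. act M (\<phi> (act M v (inv t))) (t \<otimes> h))"
    unfolding transfer_def using v h m Tc by (simp add: act_sum act_mult)
  also have "\<dots> = (\<Sum>t\<in>T. ?F (t \<otimes> h))"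
    using v h Tc by (intro sum.cong) (auto simp: act_mult inv_mult_group m_assoc[symmetric])
  also have "\<dots> = sum ?F T"
    by (rule transversal_sum_translate[OF Q T h], rule transfer_term_invariant[OF Q \<phi>]) (use v h in auto)
  finally show "transfer T \<phi> (act M v h) = act M (transfer T \<phi> v) h" by (simp add: transfer_def)
qed

end

text \<open>
  Higman's criterion, taken as a definition: the identity is a transfer from \<open>Q\<close>.
\<close>

definition rel_projective ::
    "('g, 'm) monoid_scheme \<Rightarrow> 'g set \<Rightarrow> ('k::field, 'v::ab_group_add, 'g) gmodule \<Rightarrow> bool" where
  "rel_projective G Q M \<longleftrightarrow>
     subgroup Q G \<and>
     (\<exists>\<phi> T. fg_hom (G\<lparr>carrier := Q\<rparr>) M M \<phi> \<and> right_transversal G Q T \<and>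
        (\<forall>v\<in>space M. (\<Sum>t\<in>T. act M (\<phi> (act M v (inv\<^bsub>G\<^esub> t))) t) = v))"

lemma rel_projectiveI:
  assumes "subgroup Q G" "fg_hom (G\<lparr>carrier := Q\<rparr>) M M \<phi>" "right_transversal G Q T"
    and "\<And>v. v \<in> space M \<Longrightarrow> (\<Sum>t\<in>T. act M (\<phi> (act M v (inv\<^bsub>G\<^esub> t))) t) = v"
  shows "rel_projective G Q M"
  using assms unfolding rel_projective_def by blast

lemma sum_fun_apply: "sum f I x = (\<Sum>i\<in>I. f i x)" for f :: "'i \<Rightarrow> 'a \<Rightarrow> 'b::comm_monoid_add"
  by (induction I rule: infinite_finite_induct) auto

lemma sum_additive_on:
  fixes f :: "'a::comm_monoid_add \<Rightarrow> 'b::ab_group_add"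
  assumes "0 \<in> A" "\<And>a b. a \<in> A \<Longrightarrow> b \<in> A \<Longrightarrow> a + b \<in> A"
    and f: "\<And>a b. a \<in> A \<Longrightarrow> b \<in> A \<Longrightarrow> f (a + b) = f a + f b"
    and h: "\<And>i. i \<in> I \<Longrightarrow> h i \<in> A"
  shows "f (sum h I) = (\<Sum>i\<in>I. f (h i))"
proof -
  have "f 0 = 0" using f[of 0 0] assms(1) by simp
  moreover have "sum h I \<in> A \<and> f (sum h I) = (\<Sum>i\<in>I. f (h i))" if "f 0 = 0"
    using h by (induction I rule: infinite_finite_induct) (auto simp: assms that)
  ultimately show ?thesis by simp
qed

lemma vector_space_pointwise_scale:
  assumes "vector_space s"
  shows "vector_space (\<lambda>c f x. s c (f x))"
proof -
  interpret vector_space s by fact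
  show ?thesis by unfold_locales (auto simp: fun_eq_iff scale_right_distrib scale_left_distrib)
qed

context group
begin

text \<open>
  The projection of an induced module onto its part \<open>N \<otimes> 1\<close>, the functions supported on \<open>Q\<close>. Its
  transfer is the identity of the induced module, as the supports \<open>Q t\<close> partition the group.
\<close>

lemma fg_hom_induced_coset:
  assumes Q: "subgroup Q G" and N: "fg_module (G\<lparr>carrier := Q\<rparr>) N"
  defines "X \<equiv> induced G Q N"
  shows "fg_hom (G\<lparr>carrier := Q\<rparr>) X X (\<lambda>h x. if x \<in> Q then h x else 0)"
proof -
  interpret N: fg_mod "G\<lparr>carrier := Q\<rparr>" N using N by (simp add: fg_mod_def)
  have Qc: "Q \<subseteq> carrier G" using Q by (simp add: subgroup.subset)
  have iff: "q \<otimes> x \<in> Q \<longleftrightarrow> x \<in> Q" if "q \<in> Q" "x \<in> carrier G" for q x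
  proof
    assume "q \<otimes> x \<in> Q"
    then have "inv q \<otimes> (q \<otimes> x) \<in> Q" using that Q by (simp add: subgroup.m_closed subgroup.m_inv_closed)
    then show "x \<in> Q" using that Qc by (simp add: m_assoc[symmetric] subset_iff)
  qed (use that Q in \<open>simp add: subgroup.m_closed\<close>)
  have iff': "x \<otimes> inv q \<in> Q \<longleftrightarrow> x \<in> Q" if "q \<in> Q" "x \<in> carrier G" for q x
  proof
    assume "x \<otimes> inv q \<in> Q"
    then have "x \<otimes> inv q \<otimes> q \<in> Q" using that Q by (simp add: subgroup.m_closed)
    then show "x \<in> Q" using that Qc by (simp add: m_assoc subset_iff)
  qed (use that Q in \<open>simp add: subgroup.m_closed subgroup.m_inv_closed\<close>)
  show ?thesis
  proof (rule fg_homI)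
    fix h assume h: "h \<in> space X"
    show "(\<lambda>x. if x \<in> Q then h x else 0) \<in> space X"
      using h Q by (auto simp: X_def induced_def iff subgroup.mem_carrier subgroup.m_inv_closed)
  next
    fix h q assume "h \<in> space X" and "q \<in> carrier (G\<lparr>carrier := Q\<rparr>)"
    then show "(\<lambda>x. if x \<in> Q then act X h q x else 0) = act X (\<lambda>x. if x \<in> Q then h x else 0) q"
      using Qc by (auto simp: X_def induced_def fun_eq_iff iff' subset_iff)
  qed (auto simp: X_def induced_def fun_eq_iff)
qed

lemma induced_act_closed:
  assumes Q: "subgroup Q G" and x: "x \<in> space (induced G Q N)" and h: "h \<in> carrier G"
  shows "act (induced G Q N) x h \<in> space (induced G Q N)"
proof -
  have Qc: "Q \<subseteq> carrier G" using Q by (simp add: subgroup.subset)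
  have "x (q \<otimes> y \<otimes> inv h) = act N (x (y \<otimes> inv h)) (inv q)" if "q \<in> Q" "y \<in> carrier G" for q y
    using x h that Qc by (auto simp: induced_def m_assoc subset_iff)
  then show ?thesis using x h Qc by (auto simp: induced_def subset_iff)
qed

lemma induced_subspace:
  assumes Q: "subgroup Q G" and N: "fg_module (G\<lparr>carrier := Q\<rparr>) N"
  shows "module.subspace (scale (induced G Q N)) (space (induced G Q N))"
proof -
  interpret N: fg_mod "G\<lparr>carrier := Q\<rparr>" N using N by (simp add: fg_mod_def)
  define X where "X = induced G Q N"
  interpret X: vector_space "scale X"
    using vector_space_pointwise_scale[OF N.vs.vector_space_axioms] by (simp add: X_def induced_def)
  have act0: "act N 0 (inv q) = 0" if "q \<in> Q" for q
    using N.act_zero[of "inv q"] that Q by (simp add: subgroup.m_inv_closed)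
  have actN: "act N (a + b) (inv q) = act N a (inv q) + act N b (inv q)"
    "act N (scale N c a) (inv q) = scale N c (act N a (inv q))"
    if "a \<in> space N" "b \<in> space N" "q \<in> Q" for a b c q
    using N.act_add[of a b "inv q"] N.act_scale[of a "inv q" c] that Q by (simp_all add: subgroup.m_inv_closed)
  have "X.subspace (space X)"
    unfolding X.subspace_def
  proof (intro conjI ballI allI)
    show "0 \<in> space X" using act0 by (auto simp: X_def induced_def)
    fix x assume x: "x \<in> space X"
    show "scale X c x \<in> space X" for c using x actN(2)[OF _ N.space_zero] by (auto simp: X_def induced_def)
    fix y assume y: "y \<in> space X"
    show "x + y \<in> space X" using x y actN(1) by (auto simp: X_def induced_def)
  qed
  then show ?thesis by (simp add: X_def)
qed

end

context fg_mod
begin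

text \<open>
  The projection onto \<open>N \<otimes> 1\<close> has the identity as its transfer. Composing it with the inclusion of the
  summand and the projection onto the summand, which commute with the group, keeps this property.
\<close>

lemma rel_projective_of_summand_of_induced:
  assumes fin: "finite (carrier G)" and "summand_of_induced G M Q"
  shows "rel_projective G Q M"
proof -
  obtain N :: "('k, nat \<Rightarrow> 'k, 'g) gmodule" where Q: "subgroup Q G"
    and N: "fg_indecomposable (G\<lparr>carrier := Q\<rparr>) N" and sm: "fg_direct_summand G M (induced G Q N)"
    using assms by (auto simp: summand_of_induced_def)
  define X where "X = induced G Q N"
  have Nm: "fg_module (G\<lparr>carrier := Q\<rparr>) N" using N by (simp add: fg_indecomposable_def)
  have vN: "vector_space (scale N)" using Nm by (simp add: fg_module_def)
  have Qc: "Q \<subseteq> carrier G" using Q by (simp add: subgroup.subset)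
  obtain U W f where ds: "fg_direct_sum G X U W" and f: "fg_hom G M (X\<lparr>space := U\<rparr>) f"
    and bij: "bij_betw f (space M) U"
    using sm by (auto simp: X_def fg_direct_summand_def fg_isomorphic_iff)
  have U: "U \<subseteq> space X" using ds by (auto simp: fg_direct_sum_def fg_submodule_def)
  have vX: "vector_space (scale X)" using vector_space_pointwise_scale[OF vN] by (simp add: X_def induced_def)
  obtain pr where pr: "fg_hom G X (X\<lparr>space := U\<rparr>) pr" "\<And>u. u \<in> U \<Longrightarrow> pr u = u"
    by (rule direct_sum_projection[OF vX ds]) (auto simp: X_def induced_def fun_eq_iff)
  define g where "g = inv_into (space M) f"
  have gf: "g (f v) = v" if "v \<in> space M" for v using that bij by (simp add: g_def bij_betw_inv_into_left)
  have fgu: "f (g u) = u" "g u \<in> space M" if "u \<in> U" for u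
    using that bij by (auto simp: g_def bij_betw_inv_into_right bij_betw_def inv_into_into)
  have f': "f v \<in> U" if "v \<in> space M" for v using fg_homD(1)[OF f that] by simp
  have g: "fg_hom G (X\<lparr>space := U\<rparr>) M g"
  proof (rule fg_homI)
    show "g v \<in> space M" if "v \<in> space (X\<lparr>space := U\<rparr>)" for v using fgu that by simp
    fix v assume v: "v \<in> space (X\<lparr>space := U\<rparr>)"
    show "g (v + w) = g v + g w" if w: "w \<in> space (X\<lparr>space := U\<rparr>)" for w
      using gf[of "g v + g w"] fg_homD(2)[OF f, of "g v" "g w"] v w fgu by simp
    show "g (scale (X\<lparr>space := U\<rparr>) c v) = scale M c (g v)" for c
      using gf[of "scale M c (g v)"] fg_homD(3)[OF f, of "g v" c] v fgu by simp
    show "g (act (X\<lparr>space := U\<rparr>) v h) = act M (g v) h" if "h \<in> carrier G" for h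
      using gf[of "act M (g v) h"] fg_homD(4)[OF f, of "g v" h] v fgu that by simp
  qed
  define \<epsilon> where "\<epsilon> = (\<lambda>h x. if x \<in> Q then h x else 0 :: nat \<Rightarrow> 'k)"
  have \<epsilon>: "fg_hom (G\<lparr>carrier := Q\<rparr>) X X \<epsilon>"
    using fg_hom_induced_coset[OF Q Nm] by (simp add: \<epsilon>_def X_def)
  define \<phi> where "\<phi> v = g (pr (\<epsilon> (f v)))" for v
  have \<phi>: "fg_hom (G\<lparr>carrier := Q\<rparr>) M M \<phi>"
    unfolding \<phi>_def
    by (rule fg_hom_compose[OF fg_hom_compose[OF fg_hom_compose[OF fg_hom_submodule[OF fg_hom_restrict_group[OF f Qc] U] \<epsilon>]
            fg_hom_restrict_group[OF pr(1) Qc]] fg_hom_restrict_group[OF g Qc]])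
  obtain T where T: "right_transversal G Q T" using transversal_exists[OF Q] .
  have Tc: "\<And>t. t \<in> T \<Longrightarrow> t \<in> carrier G" using T by (auto simp: right_transversal_def)
  show ?thesis
  proof (rule rel_projectiveI[OF Q \<phi> T])
    fix v assume v: "v \<in> space M"
    have fv: "f v \<in> space X" using f' U v by auto
    have cl: "act X x t \<in> space X" if "x \<in> space X" "t \<in> carrier G" for x t
      using induced_act_closed[OF Q] that by (simp add: X_def)
    have ec: "\<epsilon> x \<in> space X" if "x \<in> space X" for x using fg_homD(1)[OF \<epsilon> that] .
    have prc: "pr x \<in> U" if "x \<in> space X" for x using fg_homD(1)[OF pr(1) that] by simp
    let ?x = "\<lambda>t. act X (\<epsilon> (act X (f v) (inv t))) t"
    have tm: "act M (\<phi> (act M v (inv t))) t = g (pr (?x t))" if t: "t \<in> T" for t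
    proof -
      have "f (act M v (inv t)) = act X (f v) (inv t)" using fg_homD(4)[OF f v, of "inv t"] Tc t by simp
      then have "act M (\<phi> (act M v (inv t))) t = act M (g (pr (\<epsilon> (act X (f v) (inv t))))) t" by (simp add: \<phi>_def)
      also have "\<dots> = g (act X (pr (\<epsilon> (act X (f v) (inv t)))) t)"
        using fg_homD(4)[OF g, of "pr (\<epsilon> (act X (f v) (inv t)))" t] Tc t fv cl ec prc by simp
      also have "\<dots> = g (pr (?x t))"
        using fg_homD(4)[OF pr(1), of "\<epsilon> (act X (f v) (inv t))" t] Tc t fv cl ec by simp
      finally show ?thesis .
    qed
    have "sum ?x T = f v"
    proof
      fix y
      show "sum ?x T y = f v y"
      proof (cases "y \<in> carrier G")
        case True
        then obtain s where s: "s \<in> T" "y \<otimes> inv s \<in> Q" and u: "\<And>t. t \<in> T \<Longrightarrow> y \<otimes> inv t \<in> Q \<Longrightarrow> t = s"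
          using T unfolding right_transversal_def by blast
        have "?x t y = (if t = s then f v y else 0)" if t: "t \<in> T" for t
        proof -
          have tc: "t \<in> carrier G" using Tc t by blast
          have "y \<otimes> inv t \<otimes> inv (inv t) = y" using True tc by (simp add: m_assoc)
          then have e: "act X (f v) (inv t) (y \<otimes> inv t) = f v y"
            using True tc by (simp add: X_def induced_def)
          have "?x t y = \<epsilon> (act X (f v) (inv t)) (y \<otimes> inv t)" using True by (simp add: X_def induced_def)
          then have "?x t y = (if y \<otimes> inv t \<in> Q then f v y else 0)" unfolding \<epsilon>_def e .
          then show ?thesis using u[OF t] s(2) by metis
        qed
        then have "(\<Sum>t\<in>T. ?x t y) = (\<Sum>t\<in>T. if t = s then f v y else 0)" by (rule sum.cong[OF refl])
        also have "\<dots> = f v y"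
          using s finite_subset[OF _ fin, of T] T by (simp add: right_transversal_def)
        finally show ?thesis unfolding sum_fun_apply .
      next
        case False
        have "?x t y = 0" for t using False by (simp add: X_def induced_def)
        then have "(\<Sum>t\<in>T. ?x t y) = 0" by (intro sum.neutral ballI)
        moreover have "f v y = 0" using fv False by (simp add: X_def induced_def)
        ultimately show ?thesis unfolding sum_fun_apply by (rule trans[OF _ sym])
      qed
    qed
    moreover have "g (pr (sum ?x T)) = (\<Sum>t\<in>T. g (pr (?x t)))"
    proof (rule sum_additive_on[where A = "space X" and f = "\<lambda>x. g (pr x)"])
      interpret X: vector_space "scale X" by (rule vX)
      have sX: "X.subspace (space X)" using induced_subspace[OF Q Nm] by (simp add: X_def)
      show "0 \<in> space X" by (rule X.subspace_0[OF sX])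
      show "a + b \<in> space X" if "a \<in> space X" "b \<in> space X" for a b
        by (rule X.subspace_add[OF sX that])
      show "g (pr (a + b)) = g (pr a) + g (pr b)" if "a \<in> space X" "b \<in> space X" for a b
        using fg_homD(2)[OF fg_hom_compose[OF pr(1) g] that] .
      show "?x t \<in> space X" if "t \<in> T" for t using that fv cl ec Tc by simp
    qed
    ultimately show "(\<Sum>t\<in>T. act M (\<phi> (act M v (inv t))) t) = v"
      using tm pr(2)[OF f'[OF v]] gf[OF v] by simp
  qed
qed

end

section \<open>Fitting's lemma and decompositions\<close>

context fg_mod
begin

lemma kernel_submodule:
  assumes "fg_hom G M M f"
  shows "fg_submodule G M {v \<in> space M. f v = 0}"
  unfolding fg_submodule_def vs.subspace_def
  using fg_homD[OF assms] hom_zero[OF assms] by auto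

lemma image_submodule:
  assumes "fg_hom G M M f"
  shows "fg_submodule G M (f ` space M)"
  unfolding fg_submodule_def
proof (intro conjI ballI)
  show "f ` space M \<subseteq> space M" using fg_homD(1)[OF assms] by blast
  show "vs.subspace (f ` space M)"
    unfolding vs.subspace_def
  proof (intro conjI ballI allI)
    show "0 \<in> f ` space M" using hom_zero[OF assms] space_zero by (metis imageI)
    fix x assume "x \<in> f ` space M"
    then obtain v where v: "v \<in> space M" "x = f v" by blast
    show "scale M c x \<in> f ` space M" for c
      using fg_homD(3)[OF assms v(1), of c] v by (metis imageI space_scale)
    fix y assume "y \<in> f ` space M"
    then obtain w where w: "w \<in> space M" "y = f w" by blast
    show "x + y \<in> f ` space M"
      using fg_homD(2)[OF assms v(1) w(1)] v w by (metis imageI space_add)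
  qed
  fix u g assume "u \<in> f ` space M" and g: "g \<in> carrier G"
  then obtain v where v: "v \<in> space M" "u = f v" by blast
  show "act M u g \<in> f ` space M" using fg_homD(4)[OF assms v(1) g] v g by (metis imageI act_closed)
qed

lemma hom_funpow:
  assumes "fg_hom G M M f"
  shows "fg_hom G M M (f ^^ k)"
proof (induction k)
  case 0 show ?case by (simp add: fg_hom_def)
next
  case (Suc k)
  show ?case using fg_hom_compose[OF Suc assms] by (simp add: o_def)
qed

lemma dim_submodule_mono:
  assumes "fg_submodule G M U" "fg_submodule G M W" "U \<subseteq> W"
  shows "vs.dim U \<le> vs.dim W"
proof -
  obtain S where S: "finite S" "vs.span S = space M" by (rule finite_spanning)
  show ?thesis
    by (rule vs.subspace_dim_mono[OF S(1)]) (use assms S in \<open>auto simp: fg_submodule_def\<close>)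
qed

lemma submodule_eq_of_dim_le:
  assumes "fg_submodule G M U" "fg_submodule G M W" "U \<subseteq> W" "vs.dim W \<le> vs.dim U"
  shows "U = W"
proof -
  obtain S where S: "finite S" "vs.span S = space M" by (rule finite_spanning)
  show ?thesis
    by (rule vs.subspace_eq_of_dim_le[OF S(1)]) (use assms S in \<open>auto simp: fg_submodule_def\<close>)
qed

lemma space_submodule: "fg_submodule G M (space M)"
  using subspace_space by (auto simp: fg_submodule_def)

text \<open>
  The images of the powers of \<open>f\<close> decrease and the kernels increase, so both are constant from some
  power \<open>m\<close> on, and then \<open>M\<close> is the direct sum of the image and the kernel of \<open>f\<^sup>m\<close>.
\<close>

lemma fitting:
  assumes ind: "fg_indecomposable G M" and f: "fg_hom G M M f"
  shows "bij_betw f (space M) (space M) \<or> (\<exists>k. \<forall>v\<in>space M. (f ^^ k) v = 0)"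
proof -
  define I where "I k = (f ^^ k) ` space M" for k
  define K where "K k = {v \<in> space M. (f ^^ k) v = 0}" for k
  have fc: "(f ^^ k) v \<in> space M" if "v \<in> space M" for v k
    using fg_homD(1)[OF hom_funpow[OF f]] that by blast
  have f0: "(f ^^ k) 0 = 0" for k using hom_zero[OF hom_funpow[OF f]] .
  have sI: "fg_submodule G M (I k)" for k unfolding I_def using image_submodule[OF hom_funpow[OF f]] .
  have sK: "fg_submodule G M (K k)" for k unfolding K_def using kernel_submodule[OF hom_funpow[OF f]] .
  have I_mono: "I (k + l) \<subseteq> I k" for k l using fc by (auto simp: I_def funpow_add)
  have K_mono: "K k \<subseteq> K (l + k)" for k l using f0 by (auto simp: K_def funpow_add)
  obtain k1 where k1: "\<And>k. vs.dim (I k1) \<le> vs.dim (I k)"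
    using ex_has_least_nat[of "\<lambda>_. True" 0 "\<lambda>k. vs.dim (I k)"] by auto
  have "vs.dim (K k) < Suc (vs.dim (space M))" for k
    using dim_submodule_mono[OF sK space_submodule, of k] by (simp add: K_def)
  then obtain k2 where k2: "\<And>k. vs.dim (K k) \<le> vs.dim (K k2)"
    using ex_has_greatest_nat[of "\<lambda>_. True" 0 "\<lambda>k. vs.dim (K k)" "Suc (vs.dim (space M))"]
    by (meson less_imp_le_nat)
  \<comment> \<open>The successor makes \<open>m\<close> positive, so that \<open>f\<close> itself is bijective when \<open>f\<^sup>m\<close> is.\<close>
  define m where "m = Suc (k1 + k2)"
  have Im: "I (m + m) = I m"
  proof (rule submodule_eq_of_dim_le[OF sI sI I_mono])
    have "I m \<subseteq> I k1" using I_mono[of k1 "Suc k2"] by (simp add: m_def)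
    then have "vs.dim (I m) \<le> vs.dim (I k1)" by (rule dim_submodule_mono[OF sI sI])
    then show "vs.dim (I m) \<le> vs.dim (I (m + m))" using k1[of "m + m"] by linarith
  qed
  have Km: "K m = K (m + m)"
  proof (rule submodule_eq_of_dim_le[OF sK sK K_mono])
    have "K k2 \<subseteq> K m" using K_mono[of k2 "Suc k1"] by (simp add: m_def add.commute)
    then have "vs.dim (K k2) \<le> vs.dim (K m)" by (rule dim_submodule_mono[OF sK sK])
    then show "vs.dim (K (m + m)) \<le> vs.dim (K m)" using k2[of "m + m"] by linarith
  qed
  have ds: "fg_direct_sum G M (I m) (K m)"
    unfolding fg_direct_sum_def
  proof (intro conjI sI sK)
    show "I m \<inter> K m = {0}"
    proof (intro equalityI subsetI)
      fix x assume "x \<in> I m \<inter> K m"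
      then obtain w where w: "w \<in> space M" "x = (f ^^ m) w" "(f ^^ m) x = 0" by (auto simp: I_def K_def)
      then have "w \<in> K (m + m)" by (simp add: K_def funpow_add)
      then show "x \<in> {0}" using Km w by (auto simp: K_def)
    next
      fix x :: 'v assume "x \<in> {0}"
      then show "x \<in> I m \<inter> K m" using sI[of m] sK[of m] by (auto simp: fg_submodule_def vs.subspace_def)
    qed
    show "space M = {u + w |u w. u \<in> I m \<and> w \<in> K m}"
    proof (intro equalityI subsetI)
      fix v assume v: "v \<in> space M"
      then have "(f ^^ m) v \<in> I (m + m)" using Im by (auto simp: I_def)
      then obtain w where w: "w \<in> space M" "(f ^^ m) v = (f ^^ m) ((f ^^ m) w)"
        by (auto simp: I_def funpow_add)
      have "(f ^^ m) (v - (f ^^ m) w) = 0"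
        using hom_diff[OF hom_funpow[OF f], of v "(f ^^ m) w" m] w v fc by simp
      then have "v - (f ^^ m) w \<in> K m" using v w fc by (simp add: K_def)
      moreover have "v = (f ^^ m) w + (v - (f ^^ m) w)" by simp
      ultimately show "v \<in> {u + w |u w. u \<in> I m \<and> w \<in> K m}" using w unfolding I_def by blast
    next
      fix v assume "v \<in> {u + w |u w. u \<in> I m \<and> w \<in> K m}"
      then show "v \<in> space M" using fc by (auto simp: I_def K_def)
    qed
  qed
  then have "I m = {0} \<or> K m = {0}" using ind unfolding fg_indecomposable_def by blast
  moreover have "space M = {u + w |u w. u \<in> I m \<and> w \<in> K m}" using ds unfolding fg_direct_sum_def by simp
  ultimately consider "I m = {0}" | "K m = {0}" "space M = {u + w |u w. u \<in> I m \<and> w \<in> K m}"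
    by blast
  then show ?thesis
  proof cases
    case 1
    then show ?thesis by (auto simp: I_def)
  next
    case 2
    have split: "(f ^^ m) v = (f ^^ (k1 + k2)) (f v)" "(f ^^ m) v = f ((f ^^ (k1 + k2)) v)" for v
      unfolding m_def by (simp_all add: funpow_swap1)
    have "inj_on f (space M)"
    proof (rule inj_onI)
      fix v w assume v: "v \<in> space M" and w: "w \<in> space M" and e: "f v = f w"
      have "(f ^^ m) (v - w) = 0" using hom_diff[OF hom_funpow[OF f] v w, of m] split e by simp
      then have "v - w \<in> K m" using v w by (simp add: K_def)
      then show "v = w" using 2(1) by simp
    qed
    moreover have "f ` space M = space M"
    proof
      show "f ` space M \<subseteq> space M" using fg_homD(1)[OF f] by blast
      show "space M \<subseteq> f ` space M"
      proof
        fix v assume "v \<in> space M"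
        then have "v \<in> I m" using 2 by auto
        then show "v \<in> f ` space M" using fc split(2) by (auto simp: I_def)
      qed
    qed
    ultimately show ?thesis by (simp add: bij_betw_def)
  qed
qed

lemma hom_inverse:
  assumes f: "fg_hom G M M f" and bij: "bij_betw f (space M) (space M)"
  shows "fg_hom G M M (inv_into (space M) f)"
proof (rule fg_homI)
  let ?g = "inv_into (space M) f"
  have gf: "?g (f v) = v" if "v \<in> space M" for v using that bij by (simp add: bij_betw_inv_into_left)
  have fgv: "f (?g u) = u" "?g u \<in> space M" if "u \<in> space M" for u
    using that bij by (auto simp: bij_betw_inv_into_right bij_betw_def inv_into_into)
  fix v assume v: "v \<in> space M"
  show "?g v \<in> space M" using fgv v by blast
  show "?g (v + w) = ?g v + ?g w" if w: "w \<in> space M" for w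
    using gf[of "?g v + ?g w"] fg_homD(2)[OF f, of "?g v" "?g w"] v w fgv by simp
  show "?g (scale M c v) = scale M c (?g v)" for c
    using gf[of "scale M c (?g v)"] fg_homD(3)[OF f, of "?g v" c] v fgv by simp
  show "?g (act M v h) = act M (?g v) h" if "h \<in> carrier G" for h
    using gf[of "act M (?g v) h"] fg_homD(4)[OF f, of "?g v" h] v fgv that by simp
qed

lemma id_minus_nilpotent_bij:
  assumes ind: "fg_indecomposable G M" and c: "fg_hom G M M c"
    and nil: "\<forall>v\<in>space M. (c ^^ k) v = 0" and g: "fg_hom G M M g"
    and g_eq: "\<And>v. v \<in> space M \<Longrightarrow> g v = v - c v"
  shows "bij_betw g (space M) (space M)"
proof -
  have inj0: "v = 0" if "v \<in> space M" "g v = 0" for v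
  proof -
    have "c v = v" using g_eq that by simp
    then have "(c ^^ j) v = v" for j by (induction j) auto
    then show ?thesis using nil that by metis
  qed
  obtain x where x: "x \<in> space M" "x \<noteq> 0" using ind space_zero unfolding fg_indecomposable_def by blast
  have "(g ^^ j) x \<noteq> 0" for j
  proof (induction j)
    case (Suc j)
    then show ?case using inj0[of "(g ^^ j) x"] fg_homD(1)[OF hom_funpow[OF g] x(1)] by auto
  qed (use x in simp)
  then show ?thesis using fitting[OF ind g] x by blast
qed

text \<open>
  The endomorphism ring is local: a sum of endomorphisms is bijective only if one of them is.
  If \<open>b\<^sup>-\<^sup>1 a\<close> is nilpotent for the first summand \<open>a\<close>, then the remaining sum \<open>b (1 - b\<^sup>-\<^sup>1 a)\<close> is
  still bijective.
\<close>

lemma bij_summand: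
  assumes ind: "fg_indecomposable G M"
  shows "(\<And>f. f \<in> set fs \<Longrightarrow> fg_hom G M M f) \<Longrightarrow> fg_hom G M M b \<Longrightarrow> bij_betw b (space M) (space M)
    \<Longrightarrow> (\<And>v. v \<in> space M \<Longrightarrow> (\<Sum>f\<leftarrow>fs. f v) = b v) \<Longrightarrow> \<exists>f\<in>set fs. bij_betw f (space M) (space M)"
proof (induction fs arbitrary: b)
  case Nil
  obtain x where x: "x \<in> space M" "x \<noteq> 0" using ind space_zero unfolding fg_indecomposable_def by blast
  have "b v = 0" if "v \<in> space M" for v using Nil(4) that by simp
  then have "b x = b 0" using x by simp
  then show ?case using inj_onD[OF bij_betw_imp_inj_on[OF Nil(3)], of x 0] x by simp
next
  case (Cons a fs)
  let ?i = "inv_into (space M) b"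
  note i = hom_inverse[OF Cons.prems(2,3)]
  have a: "fg_hom G M M a" using Cons.prems(1) by simp
  have bi: "b (?i v) = v" if "v \<in> space M" for v
    using that Cons.prems(3) by (simp add: bij_betw_inv_into_right)
  have ib: "?i (b v) = v" if "v \<in> space M" for v
    using that Cons.prems(3) by (simp add: bij_betw_inv_into_left)
  have c: "fg_hom G M M (\<lambda>v. ?i (a v))" using fg_hom_compose[OF a i] .
  consider "bij_betw (\<lambda>v. ?i (a v)) (space M) (space M)" | k where "\<forall>v\<in>space M. ((\<lambda>v. ?i (a v)) ^^ k) v = 0"
    using fitting[OF ind c] by blast
  then show ?case
  proof cases
    case 1
    have "bij_betw (b \<circ> (\<lambda>v. ?i (a v))) (space M) (space M)" using bij_betw_trans[OF 1 Cons.prems(3)] .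
    moreover have "(b \<circ> (\<lambda>v. ?i (a v))) v = a v" if "v \<in> space M" for v
      using that fg_homD(1)[OF a] bi by simp
    ultimately have "bij_betw a (space M) (space M)" using bij_betw_cong[of "space M" "b \<circ> (\<lambda>v. ?i (a v))" a] by blast
    then show ?thesis by simp
  next
    case 2
    define g where "g v = v - ?i (a v)" for v
    have g: "fg_hom G M M g"
    proof (rule fg_homI)
      fix v assume v: "v \<in> space M"
      show "g v \<in> space M" using v fg_homD(1)[OF c] by (simp add: g_def)
      show "g (v + w) = g v + g w" if "w \<in> space M" for w using v that fg_homD(2)[OF c] by (simp add: g_def)
      show "g (scale M x v) = scale M x (g v)" for x
        using v fg_homD(3)[OF c] by (simp add: g_def vs.scale_right_diff_distrib)
      show "g (act M v h) = act M (g v) h" if "h \<in> carrier G" for h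
        using v fg_homD(1)[OF c] fg_homD(4)[OF c] that by (simp add: g_def act_diff)
    qed
    have gb: "bij_betw g (space M) (space M)"
      by (rule id_minus_nilpotent_bij[OF ind c 2 g]) (simp add: g_def)
    define b' where "b' v = b (g v)" for v
    have b': "fg_hom G M M b'" unfolding b'_def by (rule fg_hom_compose[OF g Cons.prems(2)])
    have b'b: "bij_betw b' (space M) (space M)"
      using bij_betw_trans[OF gb Cons.prems(3)] by (simp add: b'_def[abs_def] o_def)
    have "(\<Sum>f\<leftarrow>fs. f v) = b' v" if v: "v \<in> space M" for v
    proof -
      have "b' v = b v - a v"
        using hom_diff[OF Cons.prems(2) v, of "?i (a v)"] bi fg_homD(1)[OF a v] fg_homD(1)[OF c v] by (simp add: b'_def g_def)
      then show ?thesis using Cons.prems(4)[OF v] by (metis add_diff_cancel_left' list.simps(9) sum_list.Cons)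
    qed
    then have "\<exists>f\<in>set fs. bij_betw f (space M) (space M)"
      using Cons.IH[of b'] Cons.prems(1) b' b'b by simp
    then show ?thesis by auto
  qed
qed

text \<open>
  The projections \<open>\<pi>\<close> are returned together with the summands, because they are what splits an
  endomorphism into a sum in the proof of \<open>summand_of_induced_of_rel_projective\<close>.
\<close>

lemma decomposition:
  assumes "fg_submodule G M V" "n = vs.dim V"
  shows "\<exists>ps. (\<forall>(U, \<pi>)\<in>set ps. U \<subseteq> V \<and> fg_indecomposable G (M\<lparr>space := U\<rparr>) \<and>
                 fg_hom G (M\<lparr>space := V\<rparr>) (M\<lparr>space := U\<rparr>) \<pi>) \<and>
              (\<forall>v\<in>V. (\<Sum>(U, \<pi>)\<leftarrow>ps. \<pi> v) = v)"
  using assms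
proof (induction n arbitrary: V rule: less_induct)
  case (less n)
  note V = less.prems(1)
  interpret V: fg_mod G "M\<lparr>space := V\<rparr>" using submodule_module[OF V] by (simp add: fg_mod_def)
  have "space (M\<lparr>space := V\<rparr>) = V" by simp
  then have "V = {0} \<or> fg_indecomposable G (M\<lparr>space := V\<rparr>)
    \<or> (\<exists>U W. fg_direct_sum G (M\<lparr>space := V\<rparr>) U W \<and> U \<noteq> {0} \<and> W \<noteq> {0})"
    using V.fg unfolding fg_indecomposable_def by metis
  then consider "V = {0}" | "fg_indecomposable G (M\<lparr>space := V\<rparr>)"
    | U W where "fg_direct_sum G (M\<lparr>space := V\<rparr>) U W" "U \<noteq> {0}" "W \<noteq> {0}"
    by blast
  then show ?case
  proof cases
    case 1
    then show ?thesis by (intro exI[of _ "[]"]) simp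
  next
    case 2
    then show ?thesis by (intro exI[of _ "[(V, \<lambda>v. v)]"]) (simp add: fg_hom_def)
  next
    case 3
    have U: "U \<subseteq> V" "fg_submodule G M U" and W: "W \<subseteq> V" "fg_submodule G M W"
      and I: "U \<inter> W = {0}" and S: "V = {u + w |u w. u \<in> U \<and> w \<in> W}"
      using 3(1) V by (auto simp: fg_direct_sum_def fg_submodule_def)
    have U0: "0 \<in> U" "0 \<in> W" using U(2) W(2) by (auto simp: fg_submodule_def vs.subspace_def)
    have "U \<noteq> V" using I 3(3) W(1) U0 by blast
    then have dU: "vs.dim U < n" using submodule_eq_of_dim_le[OF U(2) V U(1)] less.prems(2) by force
    have "W \<noteq> V" using I 3(2) U(1) U0 by blast
    then have dW: "vs.dim W < n" using submodule_eq_of_dim_le[OF W(2) V W(1)] less.prems(2) by force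
    have ds': "fg_direct_sum G (M\<lparr>space := V\<rparr>) W U"
      using 3(1) add.commute unfolding fg_direct_sum_def by (auto; metis)
    obtain p where p: "fg_hom G (M\<lparr>space := V\<rparr>) (M\<lparr>space := V\<rparr>\<lparr>space := U\<rparr>) p"
      "\<And>v. v \<in> space (M\<lparr>space := V\<rparr>) \<Longrightarrow> v - p v \<in> W"
      "\<And>u. u \<in> U \<Longrightarrow> p u = u" "\<And>w. w \<in> W \<Longrightarrow> p w = 0"
      by (rule direct_sum_projection[OF V.vs.vector_space_axioms 3(1)]) (blast intro: V.act_add)+
    obtain q where q: "fg_hom G (M\<lparr>space := V\<rparr>) (M\<lparr>space := V\<rparr>\<lparr>space := W\<rparr>) q"
      "\<And>u. u \<in> W \<Longrightarrow> q u = u" "\<And>w. w \<in> U \<Longrightarrow> q w = 0"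
      by (rule direct_sum_projection[OF V.vs.vector_space_axioms ds']) (blast intro: V.act_add)+
    have pU: "p v \<in> U" and qW: "q v \<in> W" if "v \<in> V" for v
      using fg_homD(1)[OF p(1), of v] fg_homD(1)[OF q(1), of v] that by auto
    have pq: "p v + q v = v" if v: "v \<in> V" for v
    proof -
      have "q v = q (p v) + q (v - p v)"
        using fg_homD(2)[OF q(1), of "p v" "v - p v"] pU[OF v] p(2)[of v] v U(1) W(1) by auto
      then show ?thesis using q(2,3) pU[OF v] p(2)[of v] v by simp
    qed
    obtain ps where ps: "\<forall>(A, \<pi>)\<in>set ps. A \<subseteq> U \<and> fg_indecomposable G (M\<lparr>space := A\<rparr>) \<and>
        fg_hom G (M\<lparr>space := U\<rparr>) (M\<lparr>space := A\<rparr>) \<pi>" "\<forall>v\<in>U. (\<Sum>(A, \<pi>)\<leftarrow>ps. \<pi> v) = v"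
      using less.IH[OF dU U(2) refl] by blast
    obtain qs where qs: "\<forall>(A, \<pi>)\<in>set qs. A \<subseteq> W \<and> fg_indecomposable G (M\<lparr>space := A\<rparr>) \<and>
        fg_hom G (M\<lparr>space := W\<rparr>) (M\<lparr>space := A\<rparr>) \<pi>" "\<forall>v\<in>W. (\<Sum>(A, \<pi>)\<leftarrow>qs. \<pi> v) = v"
      using less.IH[OF dW W(2) refl] by blast
    let ?rs = "map (\<lambda>(A, \<pi>). (A, \<lambda>v. \<pi> (p v))) ps @ map (\<lambda>(A, \<pi>). (A, \<lambda>v. \<pi> (q v))) qs"
    let ?P = "\<lambda>A \<pi>. A \<subseteq> V \<and> fg_indecomposable G (M\<lparr>space := A\<rparr>) \<and>
                 fg_hom G (M\<lparr>space := V\<rparr>) (M\<lparr>space := A\<rparr>) \<pi>"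
    have p': "fg_hom G (M\<lparr>space := V\<rparr>) (M\<lparr>space := U\<rparr>) p"
      and q': "fg_hom G (M\<lparr>space := V\<rparr>) (M\<lparr>space := W\<rparr>) q" using p(1) q(1) by simp_all
    have P1: "?P A (\<lambda>v. \<pi> (p v))" if "(A, \<pi>) \<in> set ps" for A \<pi>
      using ps(1) that U(1) fg_hom_compose[OF p', of "M\<lparr>space := A\<rparr>" \<pi>] by blast
    have P2: "?P A (\<lambda>v. \<pi> (q v))" if "(A, \<pi>) \<in> set qs" for A \<pi>
      using qs(1) that W(1) fg_hom_compose[OF q', of "M\<lparr>space := A\<rparr>" \<pi>] by blast
    have "case x of (A, \<pi>) \<Rightarrow> ?P A \<pi>" if "x \<in> set ?rs" for x
    proof -
      from that consider A \<pi> where "(A, \<pi>) \<in> set ps" "x = (A, \<lambda>v. \<pi> (p v))"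
        | A \<pi> where "(A, \<pi>) \<in> set qs" "x = (A, \<lambda>v. \<pi> (q v))" by auto
      then show ?thesis by cases (use P1 P2 in \<open>simp_all only: prod.case\<close>)
    qed
    then have "\<forall>(A, \<pi>)\<in>set ?rs. ?P A \<pi>" by blast
    moreover have "\<forall>v\<in>V. (\<Sum>(A, \<pi>)\<leftarrow>?rs. \<pi> v) = v"
      using ps(2) qs(2) pU qW pq by (simp add: o_def case_prod_unfold)
    ultimately show ?thesis by blast
  qed
qed

end

section \<open>Relatively projective modules are summands of induced modules\<close>

lemma vector_space_fun_scale: "vector_space fun_scale"
  by unfold_locales (auto simp: fun_scale_def fun_eq_iff algebra_simps)

context fg_mod
begin

lemma coordinate_embedding:
  obtains J :: "'v \<Rightarrow> nat \<Rightarrow> 'k" where "inj_on J (space M)"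
    "\<And>v w. v \<in> space M \<Longrightarrow> w \<in> space M \<Longrightarrow> J (v + w) = J v + J w"
    "\<And>c v. v \<in> space M \<Longrightarrow> J (scale M c v) = fun_scale c (J v)"
proof -
  obtain S where S: "finite S" "vs.span S = space M" by (rule finite_spanning)
  have "space M \<subseteq> vs.span S" using S(2) by simp
  then obtain B where B: "finite B" "vs.independent B" "vs.span B = space M"
    by (rule vs.subspace_has_finite_basis[OF S(1) subspace_space])
  obtain e where e: "bij_betw e {0..<card B} B" using ex_bij_betw_nat_finite[OF B(1)] by blast
  define J where "J v = (\<lambda>n. if n < card B then vs.representation B v (e n) else 0)" for v
  have mem: "v \<in> vs.span B" if "v \<in> space M" for v using B that by simp
  have add: "J (v + w) = J v + J w" if "v \<in> space M" "w \<in> space M" for v w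
    using vs.representation_add[OF B(2) mem[OF that(2)] mem[OF that(1)]] by (auto simp: J_def fun_eq_iff)
  have sc: "J (scale M c v) = fun_scale c (J v)" if "v \<in> space M" for c v
    using vs.representation_scale[OF B(2) mem[OF that]] by (auto simp: J_def fun_scale_def)
  have "inj_on J (space M)"
  proof (rule inj_onI)
    fix v w assume v: "v \<in> space M" and w: "w \<in> space M" and eq: "J v = J w"
    have "vs.representation B v b = vs.representation B w b" if b: "b \<in> B" for b
    proof -
      have "b \<in> e ` {0..<card B}" using e b by (simp add: bij_betw_def)
      then obtain n where "n < card B" "b = e n" by auto
      then show ?thesis using fun_cong[OF eq, of n] by (simp add: J_def)
    qed
    then have "(\<Sum>b\<in>B. scale M (vs.representation B v b) b) = (\<Sum>b\<in>B. scale M (vs.representation B w b) b)"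
      by simp
    then show "v = w"
      using vs.sum_representation_eq[OF B(2) mem[OF v] B(1) subset_refl]
        vs.sum_representation_eq[OF B(2) mem[OF w] B(1) subset_refl] by simp
  qed
  then show ?thesis using that add sc by blast
qed

text \<open>
  Vertices are defined through modules inside \<open>nat \<Rightarrow> 'k\<close>; the summands of the restriction to \<open>Q\<close> are
  found in a copy of \<open>M\<close> inside that space.
\<close>

lemma coordinate_copy:
  obtains M' :: "('k, nat \<Rightarrow> 'k, 'g) gmodule" and j i
  where "fg_module G M'" "fg_hom G M M' j" "fg_hom G M' M i" "\<And>v. v \<in> space M \<Longrightarrow> i (j v) = v"
proof -
  obtain J :: "'v \<Rightarrow> nat \<Rightarrow> 'k" where J: "inj_on J (space M)"
    "\<And>v w. v \<in> space M \<Longrightarrow> w \<in> space M \<Longrightarrow> J (v + w) = J v + J w"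
    "\<And>c v. v \<in> space M \<Longrightarrow> J (scale M c v) = fun_scale c (J v)" using coordinate_embedding by metis
  define i where "i = inv_into (space M) J"
  have iJ: "i (J v) = v" if "v \<in> space M" for v using J(1) that by (simp add: i_def)
  define M' :: "('k, nat \<Rightarrow> 'k, 'g) gmodule" where
    "M' = \<lparr>scale = fun_scale, space = J ` space M, act = (\<lambda>x g. J (act M (i x) g))\<rparr>"
  have M': "scale M' = fun_scale" "space M' = J ` space M" "\<And>x g. act M' x g = J (act M (i x) g)"
    by (simp_all add: M'_def)
  interpret w: vector_space fun_scale by (rule vector_space_fun_scale)
  have J0: "J 0 = 0" using J(2)[of 0 0] by simp
  obtain S where S: "finite S" "vs.span S = space M" by (rule finite_spanning)
  have sub: "w.subspace (J ` space M)"
    unfolding w.subspace_def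
  proof (intro conjI ballI allI)
    show "0 \<in> J ` space M" using J0 space_zero by (metis imageI)
    fix x assume "x \<in> J ` space M"
    then obtain v where v: "v \<in> space M" "x = J v" by blast
    show "fun_scale c x \<in> J ` space M" for c using J(3)[OF v(1), of c] v by (metis imageI space_scale)
    fix y assume "y \<in> J ` space M"
    then obtain u where u: "u \<in> space M" "y = J u" by blast
    show "x + y \<in> J ` space M" using J(2)[OF v(1) u(1)] v u by (metis imageI space_add)
  qed
  have SM: "S \<subseteq> space M" using S(2) vs.span_superset by blast
  have "v \<in> space M \<and> J v \<in> w.span (J ` S)" if "v \<in> vs.span S" for v
    using that
  proof (induction rule: vs.span_induct_alt)
    case base show ?case unfolding J0 using w.span_zero space_zero by blast
  next
    case (step c x y)
    have m: "x \<in> space M" "y \<in> space M" using step SM by auto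
    then have "J (scale M c x + y) = fun_scale c (J x) + J y" using J by simp
    moreover have "fun_scale c (J x) \<in> w.span (J ` S)"
      using step(1) w.span_scale w.span_base by blast
    ultimately show ?case using step(2) w.span_add m by (simp del: plus_fun_apply)
  qed
  then have span: "w.span (J ` S) = J ` space M"
    using S(2) w.span_minimal[OF image_mono[OF SM] sub] by blast
  have "fg_module G M'"
    unfolding fg_module_def M'
  proof (intro conjI ballI allI is_group sub)
    show "vector_space fun_scale" by (rule vector_space_fun_scale)
    show "\<exists>T. finite T \<and> w.span T = J ` space M" using span S(1) by blast
  qed (auto simp: iJ J act_add act_scale act_mult simp flip: J(2,3))
  moreover have "fg_hom G M M' J" by (rule fg_homI) (auto simp: M' iJ J)
  moreover have "fg_hom G M' M i" by (rule fg_homI) (auto simp: M' iJ simp flip: J(2,3))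
  ultimately show ?thesis using that iJ by blast
qed

text \<open>
  The map \<open>v \<mapsto> (x \<mapsto> \<pi> (v x\<^sup>-\<^sup>1))\<close> into the induced module and the map \<open>x \<mapsto> \<Sum>t. \<phi> (\<iota> (x t)) t\<close> back to \<open>M\<close>
  compose to the transfer of \<open>\<phi> \<iota> \<pi>\<close>. As this is bijective, the first map splits.
\<close>

lemma direct_summand_of_factorization:
  assumes Q: "subgroup Q G" and T: "right_transversal G Q T"
    and \<phi>: "fg_hom (G\<lparr>carrier := Q\<rparr>) M M \<phi>" and N: "fg_module (G\<lparr>carrier := Q\<rparr>) N"
    and \<pi>: "fg_hom (G\<lparr>carrier := Q\<rparr>) M N \<pi>" and \<iota>: "fg_hom (G\<lparr>carrier := Q\<rparr>) N M \<iota>"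
    and bij: "bij_betw (transfer T (\<lambda>v. \<phi> (\<iota> (\<pi> v)))) (space M) (space M)"
  shows "fg_direct_summand G M (induced G Q N)"
proof -
  define X where "X = induced G Q N"
  interpret N: fg_mod "G\<lparr>carrier := Q\<rparr>" N using N by (simp add: fg_mod_def)
  have Qc: "Q \<subseteq> carrier G" using Q by (simp add: subgroup.subset)
  have Tc: "\<And>t. t \<in> T \<Longrightarrow> t \<in> carrier G" using T by (auto simp: right_transversal_def)
  define A where "A = transfer T (\<lambda>v. \<phi> (\<iota> (\<pi> v)))"
  define B where "B = inv_into (space M) A"
  have \<alpha>: "fg_hom (G\<lparr>carrier := Q\<rparr>) M M (\<lambda>v. \<phi> (\<iota> (\<pi> v)))"
    by (rule fg_hom_compose[OF fg_hom_compose[OF \<pi> \<iota>] \<phi>])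
  have A: "fg_hom G M M A" unfolding A_def by (rule transfer_hom[OF Q T \<alpha>])
  have Bh: "fg_hom G M M B" unfolding B_def using hom_inverse[OF A] bij by (simp add: A_def)
  have BA: "B (A v) = v" if "v \<in> space M" for v
    unfolding B_def using bij that by (simp add: A_def bij_betw_inv_into_left)
  define f where "f v = (\<lambda>x. if x \<in> carrier G then \<pi> (act M v (inv x)) else 0)" for v
  have f: "fg_hom G M X f"
  proof (rule fg_homI)
    fix v assume v: "v \<in> space M"
    have "\<pi> (act M v (inv (q \<otimes> x))) = act N (\<pi> (act M v (inv x))) (inv q)" if "q \<in> Q" "x \<in> carrier G" for q x
    proof -
      have qc: "q \<in> carrier G" "inv q \<in> Q" using that Q Qc by (auto simp: subgroup.m_inv_closed)
      then have "act M v (inv (q \<otimes> x)) = act M (act M v (inv x)) (inv q)"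
        using v that by (simp add: act_mult inv_mult_group)
      then show ?thesis using fg_homD(4)[OF \<pi>, of "act M v (inv x)" "inv q"] v that qc by simp
    qed
    then show "f v \<in> space X" using fg_homD(1)[OF \<pi>] v Qc by (auto simp: X_def induced_def f_def)
    show "f (v + w) = f v + f w" if "w \<in> space M" for w
      using that v fg_homD(2)[OF \<pi>] by (auto simp: f_def act_add)
    show "f (scale M c v) = scale X c (f v)" for c
      using v fg_homD(3)[OF \<pi>] by (auto simp: f_def act_scale X_def induced_def)
    show "f (act M v h) = act X (f v) h" if "h \<in> carrier G" for h
      using v that by (auto simp: f_def X_def induced_def act_mult inv_mult_group fun_eq_iff)
  qed
  have X: "X = \<lparr>scale = (\<lambda>c f x. scale N c (f x)), space = space X, act = act X\<rparr>" by (simp add: X_def induced_def)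
  have Xv: "x y \<in> space N" if "x \<in> space X" "y \<in> carrier G" for x y using that by (simp add: X_def induced_def)
  \<comment> \<open>The map back to \<open>M\<close>, corrected by the inverse of the bijective composite.\<close>
  define r where "r x = B (\<Sum>t\<in>T. act M (\<phi> (\<iota> (x t))) t)" for x
  have tm: "act M (\<phi> (\<iota> n)) t \<in> space M" if "n \<in> space N" "t \<in> carrier G" for n t
    using that fg_homD(1)[OF \<phi>] fg_homD(1)[OF \<iota>] by simp
  have sm: "(\<Sum>t\<in>T. act M (\<phi> (\<iota> (x t))) t) \<in> space M" if "x \<in> space X" for x
    using that by (intro space_sum tm Xv) (auto simp: Tc)
  have r: "fg_hom G X M r"
  proof (rule fg_homI)
    fix x assume x: "x \<in> space X"
    show "r x \<in> space M" unfolding r_def using fg_homD(1)[OF Bh sm[OF x]] .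
    show "r (x + y) = r x + r y" if y: "y \<in> space X" for y
    proof -
      have "(\<Sum>t\<in>T. act M (\<phi> (\<iota> ((x + y) t))) t) = (\<Sum>t\<in>T. act M (\<phi> (\<iota> (x t))) t) + (\<Sum>t\<in>T. act M (\<phi> (\<iota> (y t))) t)"
        unfolding sum.distrib[symmetric]
        by (intro sum.cong refl) (simp add: Xv x y Tc fg_homD[OF \<phi>] fg_homD[OF \<iota>] act_add)
      then show ?thesis unfolding r_def using fg_homD(2)[OF Bh sm[OF x] sm[OF y]] by simp
    qed
    show "r (scale X c x) = scale M c (r x)" for c
    proof -
      have "(\<Sum>t\<in>T. act M (\<phi> (\<iota> ((scale X c x) t))) t) = scale M c (\<Sum>t\<in>T. act M (\<phi> (\<iota> (x t))) t)"
        unfolding vs.scale_sum_right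
        by (intro sum.cong refl, subst X)
          (simp add: Xv x Tc fg_homD(3)[OF \<phi>] fg_homD(3)[OF \<iota>] fg_homD(1)[OF \<iota>] fg_homD(1)[OF \<phi>] act_scale)
      then show ?thesis unfolding r_def using fg_homD(3)[OF Bh sm[OF x]] by simp
    qed
    fix h assume h: "h \<in> carrier G"
    let ?F = "\<lambda>g. act M (\<phi> (\<iota> (x (g \<otimes> inv h)))) g"
    have "act M (\<Sum>t\<in>T. act M (\<phi> (\<iota> (x t))) t) h = (\<Sum>t\<in>T. ?F (t \<otimes> h))"
      using x h Tc Xv tm fg_homD(1)[OF \<phi>] fg_homD(1)[OF \<iota>]
      by (subst act_sum) (auto intro!: sum.cong simp: act_mult m_assoc)
    also have "\<dots> = sum ?F T"
    proof (rule transversal_sum_translate[OF Q T h])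
      fix q g assume q: "q \<in> Q" and g: "g \<in> carrier G"
      have qc: "q \<in> carrier G" "inv q \<in> Q" using q Q Qc by (auto simp: subgroup.m_inv_closed)
      have xn: "x (g \<otimes> inv h) \<in> space N" using x g h Xv by simp
      have "x (q \<otimes> (g \<otimes> inv h)) = act N (x (g \<otimes> inv h)) (inv q)"
        using x q g h by (simp add: X_def induced_def)
      then have "\<phi> (\<iota> (x (q \<otimes> g \<otimes> inv h))) = act M (\<phi> (\<iota> (x (g \<otimes> inv h)))) (inv q)"
        using fg_homD(4)[OF \<iota> xn, of "inv q"] fg_homD(4)[OF \<phi> fg_homD(1)[OF \<iota> xn], of "inv q"] qc g h
        by (simp add: m_assoc)
      moreover have "\<phi> (\<iota> (x (g \<otimes> inv h))) \<in> space M" using fg_homD(1)[OF \<phi>] fg_homD(1)[OF \<iota>] xn by blast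
      ultimately show "?F (q \<otimes> g) = ?F g" using qc g by (simp add: act_mult m_assoc[symmetric])
    qed
    also have "sum ?F T = (\<Sum>t\<in>T. act M (\<phi> (\<iota> (act X x h t))) t)"
      using Tc by (intro sum.cong) (auto simp: X_def induced_def)
    finally show "r (act X x h) = act M (r x) h"
      unfolding r_def using fg_homD(4)[OF Bh sm[OF x] h] by simp
  qed
  have rf: "r (f v) = v" if v: "v \<in> space M" for v
  proof -
    have "(\<Sum>t\<in>T. act M (\<phi> (\<iota> (f v t))) t) = A v"
      unfolding A_def transfer_def using Tc by (intro sum.cong) (auto simp: f_def)
    then show ?thesis using BA v by (simp add: r_def)
  qed
  interpret X: vector_space "scale X"
    using vector_space_pointwise_scale[OF N.vs.vector_space_axioms] by (simp add: X_def induced_def)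
  have sX: "X.subspace (space X)" using induced_subspace[OF Q N] by (simp add: X_def)
  have actX: "act X x h \<in> space X" if "x \<in> space X" "h \<in> carrier G" for x h
    using induced_act_closed[OF Q] that by (simp add: X_def)
  let ?U = "f ` space M" and ?W = "{x \<in> space X. r x = 0}"
  have r0: "r 0 = 0" using fg_homD(2)[OF r, of 0 0] X.subspace_0[OF sX] by simp
  have f0: "f 0 = 0" using hom_zero[OF f] .
  have rdiff: "r (x - y) = r x - r y" if "x \<in> space X" "y \<in> space X" for x y
    using fg_homD(2)[OF r, of "x - y" y] X.subspace_diff[OF sX] that by simp
  have "fg_direct_sum G X ?U ?W"
    unfolding fg_direct_sum_def
  proof (intro conjI)
    show "fg_submodule G X ?U"
      unfolding fg_submodule_def X.subspace_def
    proof (intro conjI ballI allI)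
      show "?U \<subseteq> space X" using fg_homD(1)[OF f] by blast
      show "0 \<in> ?U" using f0 space_zero by (metis imageI)
      fix x assume "x \<in> ?U"
      then obtain v where v: "v \<in> space M" "x = f v" by blast
      show "scale X c x \<in> ?U" for c using fg_homD(3)[OF f v(1), of c] v by (metis imageI space_scale)
      show "act X x g \<in> ?U" if "g \<in> carrier G" for g using fg_homD(4)[OF f v(1) that] v that by (metis imageI act_closed)
      fix y assume "y \<in> ?U"
      then obtain w where w: "w \<in> space M" "y = f w" by blast
      show "x + y \<in> ?U" using fg_homD(2)[OF f v(1) w(1)] v w by (metis imageI space_add)
    qed
    show "fg_submodule G X ?W"
      unfolding fg_submodule_def using fg_homD[OF r] r0 sX actX by (auto simp: X.subspace_def)
    show "?U \<inter> ?W = {0}" using rf f0 r0 X.subspace_0[OF sX] space_zero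
      by (auto simp: image_iff)
    show "space X = {u + w |u w. u \<in> ?U \<and> w \<in> ?W}"
    proof (intro equalityI subsetI)
      fix x assume x: "x \<in> space X"
      have fr: "f (r x) \<in> space X" "r x \<in> space M" using x fg_homD(1)[OF r] fg_homD(1)[OF f] by auto
      then have "r (x - f (r x)) = 0" using rdiff[OF x fr(1)] rf by simp
      then have "x - f (r x) \<in> ?W" using X.subspace_diff[OF sX x fr(1)] by simp
      moreover have "x = f (r x) + (x - f (r x))" by simp
      ultimately show "x \<in> {u + w |u w. u \<in> ?U \<and> w \<in> ?W}" using fr(2) by blast
    next
      fix x assume "x \<in> {u + w |u w. u \<in> ?U \<and> w \<in> ?W}"
      then show "x \<in> space X" using fg_homD(1)[OF f] X.subspace_add[OF sX] by auto
    qed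
  qed
  moreover have "inj_on f (space M)" by (rule inj_on_inverseI[where g = r]) (rule rf)
  then have "bij_betw f (space M) (space (X\<lparr>space := ?U\<rparr>))" by (simp add: bij_betw_def)
  moreover have "fg_hom G M (X\<lparr>space := ?U\<rparr>) f" using f by (auto simp: fg_hom_def)
  ultimately show ?thesis unfolding fg_direct_summand_def fg_isomorphic_iff X_def by blast
qed

text \<open>
  Decompose the restriction to \<open>Q\<close> into indecomposables with projections \<open>\<pi>\<close>. The identity of \<open>M\<close> is the
  transfer of \<open>\<phi>\<close>, hence the sum of the transfers of the \<open>\<phi> \<pi>\<close>, and by \<open>bij_summand\<close> one of these is
  bijective.
\<close>

lemma summand_of_induced_of_rel_projective:
  assumes ind: "fg_indecomposable G M" and rp: "rel_projective G Q M"
  shows "summand_of_induced G M Q"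
proof -
  obtain \<phi> T where Q: "subgroup Q G" and \<phi>: "fg_hom (G\<lparr>carrier := Q\<rparr>) M M \<phi>"
    and T: "right_transversal G Q T" and id: "\<And>v. v \<in> space M \<Longrightarrow> transfer T \<phi> v = v"
    using rp by (auto simp: rel_projective_def transfer_def)
  let ?Q = "G\<lparr>carrier := Q\<rparr>"
  have Qc: "Q \<subseteq> carrier G" using Q by (simp add: subgroup.subset)
  have Tc: "\<And>t. t \<in> T \<Longrightarrow> t \<in> carrier G" using T by (auto simp: right_transversal_def)
  obtain M' :: "('k, nat \<Rightarrow> 'k, 'g) gmodule" and j i where M': "fg_module G M'" and j: "fg_hom G M M' j"
    and i: "fg_hom G M' M i" and ij: "\<And>v. v \<in> space M \<Longrightarrow> i (j v) = v" using coordinate_copy by metis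
  interpret M': fg_mod G M' using M' by (simp add: fg_mod_def)
  interpret MQ: fg_mod ?Q M' using M'.subgroup_module[OF Q] by (simp add: fg_mod_def)
  obtain ps where ps: "\<forall>(U, \<pi>)\<in>set ps. U \<subseteq> space M' \<and> fg_indecomposable ?Q (M'\<lparr>space := U\<rparr>) \<and>
                 fg_hom ?Q (M'\<lparr>space := space M'\<rparr>) (M'\<lparr>space := U\<rparr>) \<pi>"
    "\<forall>v\<in>space M'. (\<Sum>(U, \<pi>)\<leftarrow>ps. \<pi> v) = v"
    using MQ.decomposition[OF MQ.space_submodule refl] by blast
  have jQ: "fg_hom ?Q M M' j" and iQ: "fg_hom ?Q M' M i"
    using j i Qc by (auto intro: fg_hom_restrict_group)
  define e where "e \<pi> v = \<phi> (i (\<pi> (j v)))" for \<pi> :: "(nat \<Rightarrow> 'k) \<Rightarrow> nat \<Rightarrow> 'k" and v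
  have \<pi>: "fg_hom ?Q M (M'\<lparr>space := U\<rparr>) (\<lambda>v. \<pi> (j v))" "fg_hom ?Q (M'\<lparr>space := U\<rparr>) M i"
    "fg_indecomposable ?Q (M'\<lparr>space := U\<rparr>)" if "(U, \<pi>) \<in> set ps" for U \<pi>
  proof -
    have *: "U \<subseteq> space M'" "fg_hom ?Q M' (M'\<lparr>space := U\<rparr>) \<pi>" "fg_indecomposable ?Q (M'\<lparr>space := U\<rparr>)"
      using ps(1) that by auto
    show "fg_hom ?Q M (M'\<lparr>space := U\<rparr>) (\<lambda>v. \<pi> (j v))" by (rule fg_hom_compose[OF jQ *(2)])
    show "fg_hom ?Q (M'\<lparr>space := U\<rparr>) M i" using iQ *(1) by (simp add: fg_hom_def subset_iff)
    show "fg_indecomposable ?Q (M'\<lparr>space := U\<rparr>)" by fact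
  qed
  have e: "fg_hom ?Q M M (e \<pi>)" if "(U, \<pi>) \<in> set ps" for U \<pi>
    unfolding e_def by (rule fg_hom_compose[OF fg_hom_compose[OF \<pi>(1,2)[OF that]] \<phi>])
  have sum_e: "(\<Sum>(U, \<pi>)\<leftarrow>ps. e \<pi> v) = \<phi> v" if v: "v \<in> space M" for v
  proof -
    have "(\<Sum>(U, \<pi>)\<leftarrow>qs. e \<pi> v) = \<phi> (i (\<Sum>(U, \<pi>)\<leftarrow>qs. \<pi> (j v))) \<and> (\<Sum>(U, \<pi>)\<leftarrow>qs. \<pi> (j v)) \<in> space M'"
      if "set qs \<subseteq> set ps" for qs
      using that
    proof (induction qs)
      case Nil
      have "0 = \<phi> (i 0) \<and> 0 \<in> space M'" using MQ.hom_zero[OF iQ] hom_zero[OF \<phi>] MQ.space_zero by metis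
      then show ?case by (simp only: list.map sum_list.Nil)
    next
      case (Cons a qs)
      obtain U \<pi> where a: "a = (U, \<pi>)" "(U, \<pi>) \<in> set ps" using Cons.prems by (cases a) auto
      have m: "\<pi> (j v) \<in> space M'" using ps(1) a(2) fg_homD(1)[OF \<pi>(1)[OF a(2)] v] by auto
      show ?case using Cons m fg_homD(2)[OF iQ m] fg_homD(2)[OF \<phi>] fg_homD(1)[OF iQ] a MQ.space_add[OF m] by (simp add: e_def del: plus_fun_apply)
    qed
    from this[of ps] show ?thesis using ps(2) ij fg_homD(1)[OF j] v by simp
  qed
  let ?fs = "map (\<lambda>(U, \<pi>). transfer T (e \<pi>)) ps"
  have "\<exists>f\<in>set ?fs. bij_betw f (space M) (space M)"
  proof (rule bij_summand[OF ind, where b = "\<lambda>v. v"])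
    fix f assume "f \<in> set ?fs"
    then show "fg_hom G M M f" using transfer_hom[OF Q T e] by auto
  next
    fix v assume v: "v \<in> space M"
    have "(\<Sum>f\<leftarrow>map (\<lambda>(U, \<pi>). transfer T (e \<pi>)) qs. f v) = (\<Sum>t\<in>T. act M (\<Sum>(U, \<pi>)\<leftarrow>qs. e \<pi> (act M v (inv t))) t)
      \<and> (\<forall>w\<in>space M. (\<Sum>(U, \<pi>)\<leftarrow>qs. e \<pi> w) \<in> space M)" if "set qs \<subseteq> set ps" for qs
      using that
    proof (induction qs)
      case Nil
      then show ?case using Tc by simp
    next
      case (Cons a qs)
      obtain U \<pi> where a: "a = (U, \<pi>)" "(U, \<pi>) \<in> set ps" using Cons.prems by (cases a) auto
      have m: "e \<pi> w \<in> space M" if "w \<in> space M" for w using fg_homD(1)[OF e[OF a(2)] that] .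
      show ?case using Cons m a Tc v by (simp add: transfer_def act_add sum.distrib)
    qed
    from this[of ps] show "(\<Sum>f\<leftarrow>?fs. f v) = v"
      using id[OF v] sum_e v Tc by (simp add: transfer_def)
  qed (auto simp: fg_hom_def bij_betw_def)
  then obtain U \<pi>' where U: "(U, \<pi>') \<in> set ps" "bij_betw (transfer T (e \<pi>')) (space M) (space M)" by auto
  have "fg_direct_summand G M (induced G Q (M'\<lparr>space := U\<rparr>))"
    using \<pi>(3)[OF U(1)] U(2)
    by (intro direct_summand_of_factorization[OF Q T \<phi> _ \<pi>(1,2)[OF U(1)]]) (auto simp: fg_indecomposable_def e_def[abs_def])
  then show ?thesis unfolding summand_of_induced_def using Q \<pi>(3)[OF U(1)] by blast
qed

end

section \<open>Vertices\<close>

context fg_mod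
begin

lemma summand_of_induced_iff:
  assumes "finite (carrier G)" "fg_indecomposable G M"
  shows "summand_of_induced G M Q \<longleftrightarrow> rel_projective G Q M"
  using rel_projective_of_summand_of_induced summand_of_induced_of_rel_projective assms by blast

lemma conjugation_cancel:
  assumes "g \<in> carrier G" "h \<in> carrier G" "x \<in> carrier G"
  shows "(g \<otimes> h \<otimes> inv g) \<otimes> (g \<otimes> x) = g \<otimes> (h \<otimes> x)"
  using assms by (simp add: m_assoc) (simp add: m_assoc[symmetric])

lemma subgroup_conjugate:
  assumes P: "subgroup P G" and g: "g \<in> carrier G"
  shows "subgroup ((\<lambda>h. g \<otimes> h \<otimes> inv g) ` P) G"
proof (rule subgroupI)
  have Pc: "P \<subseteq> carrier G" using P by (rule subgroup.subset)
  show "(\<lambda>h. g \<otimes> h \<otimes> inv g) ` P \<subseteq> carrier G" using Pc g by auto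
  show "(\<lambda>h. g \<otimes> h \<otimes> inv g) ` P \<noteq> {}" using subgroup.one_closed[OF P] by blast
  fix a assume "a \<in> (\<lambda>h. g \<otimes> h \<otimes> inv g) ` P"
  then obtain x where x: "x \<in> P" "a = g \<otimes> x \<otimes> inv g" by blast
  then have xc: "x \<in> carrier G" using Pc by blast
  have "inv a = g \<otimes> inv x \<otimes> inv g" using x xc g by (simp add: inv_mult_group m_assoc)
  then show "inv a \<in> (\<lambda>h. g \<otimes> h \<otimes> inv g) ` P" using subgroup.m_inv_closed[OF P x(1)] by blast
  fix b assume "b \<in> (\<lambda>h. g \<otimes> h \<otimes> inv g) ` P"
  then obtain y where y: "y \<in> P" "b = g \<otimes> y \<otimes> inv g" by blast
  then have yc: "y \<in> carrier G" using Pc by blast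
  have "a \<otimes> b = g \<otimes> (x \<otimes> y) \<otimes> inv g"
    using x(2) y(2) xc yc g conjugation_cancel[of g x "y \<otimes> inv g"] by (simp add: m_assoc)
  then show "a \<otimes> b \<in> (\<lambda>h. g \<otimes> h \<otimes> inv g) ` P" using subgroup.m_closed[OF P x(1) y(1)] by blast
qed

lemma rel_projective_conjugate:
  assumes rp: "rel_projective G P M" and g: "g \<in> carrier G"
  shows "rel_projective G ((\<lambda>h. g \<otimes> h \<otimes> inv g) ` P) M"
proof -
  obtain \<phi> T where P: "subgroup P G" and \<phi>: "fg_hom (G\<lparr>carrier := P\<rparr>) M M \<phi>"
    and T: "right_transversal G P T" and id: "\<And>v. v \<in> space M \<Longrightarrow> (\<Sum>t\<in>T. act M (\<phi> (act M v (inv t))) t) = v"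
    using rp by (auto simp: rel_projective_def)
  let ?P = "(\<lambda>h. g \<otimes> h \<otimes> inv g) ` P"
  have Pc: "P \<subseteq> carrier G" using P by (rule subgroup.subset)
  have Tc: "T \<subseteq> carrier G" using T by (simp add: right_transversal_def)
  have m: "\<phi> v \<in> space M" if "v \<in> space M" for v using fg_homD(1)[OF \<phi> that] .
  show ?thesis
  proof (rule rel_projectiveI)
    show "subgroup ?P G" by (rule subgroup_conjugate[OF P g])
    show "fg_hom (G\<lparr>carrier := ?P\<rparr>) M M (\<lambda>v. act M (\<phi> (act M v g)) (inv g))"
    proof (rule fg_homI)
      fix v assume v: "v \<in> space M"
      show "act M (\<phi> (act M v g)) (inv g) \<in> space M" using v g m by simp
      show "act M (\<phi> (act M (v + w) g)) (inv g) = act M (\<phi> (act M v g)) (inv g) + act M (\<phi> (act M w g)) (inv g)"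
        if "w \<in> space M" for w using v that g m fg_homD(2)[OF \<phi>] by (simp add: act_add)
      show "act M (\<phi> (act M (scale M c v) g)) (inv g) = scale M c (act M (\<phi> (act M v g)) (inv g))" for c
        using v g m fg_homD(3)[OF \<phi>] by (simp add: act_scale)
      fix x assume "x \<in> carrier (G\<lparr>carrier := ?P\<rparr>)"
      then obtain h where h: "h \<in> P" "x = g \<otimes> h \<otimes> inv g" by auto
      have hc: "h \<in> carrier G" using h Pc by blast
      have "act M (act M v x) g = act M (act M v g) h" using v g hc h(2) by (simp add: act_mult m_assoc)
      then have "act M (\<phi> (act M (act M v x) g)) (inv g) = act M (act M (\<phi> (act M v g)) h) (inv g)"
        using fg_homD(4)[OF \<phi>, of "act M v g" h] v g h by simp
      then show "act M (\<phi> (act M (act M v x) g)) (inv g) = act M (act M (\<phi> (act M v g)) (inv g)) x"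
        using v g hc h(2) m by (simp add: act_mult m_assoc[symmetric])
    qed
    have inj: "inj_on (\<lambda>t. g \<otimes> t) T" using g Tc by (auto intro!: inj_onI simp: subset_iff)
    show "right_transversal G ?P ((\<lambda>t. g \<otimes> t) ` T)"
      unfolding right_transversal_def
    proof (intro conjI ballI)
      show "(\<lambda>t. g \<otimes> t) ` T \<subseteq> carrier G" using g Tc by auto
      fix x assume x: "x \<in> carrier G"
      have iff: "x \<otimes> inv (g \<otimes> t) \<in> ?P \<longleftrightarrow> (inv g \<otimes> x) \<otimes> inv t \<in> P" if "t \<in> T" for t
      proof -
        have t: "t \<in> carrier G" using that Tc by blast
        have e: "x \<otimes> inv (g \<otimes> t) = g \<otimes> ((inv g \<otimes> x) \<otimes> inv t) \<otimes> inv g"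
          using t x g by (simp add: inv_mult_group m_assoc[symmetric])
        show ?thesis
        proof
          assume "x \<otimes> inv (g \<otimes> t) \<in> ?P"
          then obtain h where h: "h \<in> P" "g \<otimes> ((inv g \<otimes> x) \<otimes> inv t) \<otimes> inv g = g \<otimes> h \<otimes> inv g"
            using e by auto
          then have "(inv g \<otimes> x) \<otimes> inv t = h" using t x g Pc by (auto simp: subset_iff)
          then show "(inv g \<otimes> x) \<otimes> inv t \<in> P" using h by simp
        qed (use e in blast)
      qed
      have "\<exists>!t. t \<in> T \<and> (inv g \<otimes> x) \<otimes> inv t \<in> P" using T g x by (simp add: right_transversal_def)
      then obtain t where t: "t \<in> T" "(inv g \<otimes> x) \<otimes> inv t \<in> P"
        and u: "\<And>s. s \<in> T \<Longrightarrow> (inv g \<otimes> x) \<otimes> inv s \<in> P \<Longrightarrow> s = t" by blast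
      show "\<exists>!t. t \<in> (\<lambda>t. g \<otimes> t) ` T \<and> x \<otimes> inv t \<in> ?P"
      proof (intro ex1I conjI)
        show "g \<otimes> t \<in> (\<lambda>t. g \<otimes> t) ` T" using t by blast
        show "x \<otimes> inv (g \<otimes> t) \<in> ?P" using t iff by blast
        fix s assume "s \<in> (\<lambda>t. g \<otimes> t) ` T \<and> x \<otimes> inv s \<in> ?P"
        then obtain s' where s': "s' \<in> T" "s = g \<otimes> s'" "x \<otimes> inv (g \<otimes> s') \<in> ?P" by blast
        then show "s = g \<otimes> t" using u iff by blast
      qed
    qed
    fix v assume v: "v \<in> space M"
    have "act M (act M (\<phi> (act M (act M v (inv (g \<otimes> t))) g)) (inv g)) (g \<otimes> t) = act M (\<phi> (act M v (inv t))) t"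
      if "t \<in> T" for t
    proof -
      have t: "t \<in> carrier G" using that Tc by blast
      have "inv g \<otimes> (g \<otimes> t) = t" using t g by (simp add: m_assoc[symmetric])
      moreover have "inv (g \<otimes> t) \<otimes> g = inv t" using t g by (simp add: inv_mult_group m_assoc)
      ultimately show ?thesis using v g t m by (simp add: act_mult)
    qed
    then show "(\<Sum>t\<in>(\<lambda>t. g \<otimes> t) ` T. act M (act M (\<phi> (act M (act M v (inv t)) g)) (inv g)) t) = v"
      using id[OF v] by (simp add: sum.reindex[OF inj])
  qed
qed

text \<open>
  By finiteness, conjugates of \<open>P\<close> do not contain each other properly; so the lower bound \<open>min\<close> makes
  each conjugate minimal, and it forces a minimal subgroup to be a conjugate.
\<close>

theorem vertex_iff_conjugate:
  assumes fin: "finite (carrier G)" and ind: "fg_indecomposable G M"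
    and P: "rel_projective G P M"
    and min: "\<And>R. rel_projective G R M \<Longrightarrow> \<exists>g\<in>carrier G. \<forall>h\<in>P. g \<otimes> h \<otimes> inv g \<in> R"
  shows "is_vertex G M Q \<longleftrightarrow> (\<exists>g\<in>carrier G. Q = (\<lambda>h. g \<otimes> h \<otimes> inv g) ` P)"
proof
  have Ps: "subgroup P G" using P by (simp add: rel_projective_def)
  have Pc: "P \<subseteq> carrier G" using Ps by (rule subgroup.subset)
  assume v: "is_vertex G M Q"
  then have "rel_projective G Q M" using summand_of_induced_iff[OF fin ind] by (simp add: is_vertex_def)
  then obtain g where g: "g \<in> carrier G" "\<forall>h\<in>P. g \<otimes> h \<otimes> inv g \<in> Q" using min by blast
  have "\<not> (\<lambda>h. g \<otimes> h \<otimes> inv g) ` P \<subset> Q"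
    using v rel_projective_conjugate[OF P g(1)] summand_of_induced_iff[OF fin ind] by (auto simp: is_vertex_def)
  then show "\<exists>g\<in>carrier G. Q = (\<lambda>h. g \<otimes> h \<otimes> inv g) ` P" using g by blast
next
  have Ps: "subgroup P G" using P by (simp add: rel_projective_def)
  have Pc: "P \<subseteq> carrier G" using Ps by (rule subgroup.subset)
  then have fP: "finite P" using fin finite_subset by blast
  assume "\<exists>g\<in>carrier G. Q = (\<lambda>h. g \<otimes> h \<otimes> inv g) ` P"
  then obtain g where g: "g \<in> carrier G" "Q = (\<lambda>h. g \<otimes> h \<otimes> inv g) ` P" by blast
  have card: "card ((\<lambda>h. a \<otimes> h \<otimes> inv a) ` P) = card P" if "a \<in> carrier G" for a
    by (rule card_image, rule inj_onI) (use that Pc in \<open>auto simp: subset_iff\<close>)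
  show "is_vertex G M Q"
    unfolding is_vertex_def
  proof (intro conjI allI impI notI)
    show "summand_of_induced G M Q"
      using rel_projective_conjugate[OF P g(1)] g(2) summand_of_induced_iff[OF fin ind] by simp
    fix R assume R: "R \<subset> Q" "summand_of_induced G M R"
    then obtain a where a: "a \<in> carrier G" "\<forall>h\<in>P. a \<otimes> h \<otimes> inv a \<in> R"
      using min summand_of_induced_iff[OF fin ind] by blast
    then have "(\<lambda>h. a \<otimes> h \<otimes> inv a) ` P \<subseteq> R" by blast
    moreover have fQ: "finite Q" using g fP by simp
    then have "finite R" using R finite_subset by blast
    ultimately have "card P \<le> card R" using card[OF a(1)] card_mono by metis
    moreover have "card R < card Q" using R(1) fQ psubset_card_mono by blast
    ultimately show False using card[OF g(1)] g(2) by simp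
  qed
qed

text \<open>
  The vector \<open>e\<close> and the functional \<open>l\<close> make the trivial module a summand of the restriction to \<open>P\<close>.
  Applying \<open>l\<close> to the identity at \<open>e\<close>, written as a transfer from \<open>R\<close>, gives a nonzero sum of a
  function on the cosets of \<open>R\<close> that right multiplication by \<open>P\<close> preserves.
\<close>

lemma fixed_functional_bound:
  assumes fin: "finite (carrier G)" and P: "subgroup P G"
    and p: "prime p" "CHAR('k) = p" "card P = p ^ k"
    and R: "rel_projective G R M"
    and e: "e \<in> space M" "\<And>h. h \<in> P \<Longrightarrow> act M e h = e"
    and l: "\<And>v w. v \<in> space M \<Longrightarrow> w \<in> space M \<Longrightarrow> l (v + w) = l v + (l w :: 'k)"
      "\<And>v h. v \<in> space M \<Longrightarrow> h \<in> P \<Longrightarrow> l (act M v h) = l v"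
    and nz: "l e \<noteq> 0"
  shows "\<exists>g\<in>carrier G. \<forall>h\<in>P. g \<otimes> h \<otimes> inv g \<in> R"
proof -
  obtain \<phi> T where Rs: "subgroup R G" and \<phi>: "fg_hom (G\<lparr>carrier := R\<rparr>) M M \<phi>"
    and T: "right_transversal G R T" and id: "\<And>v. v \<in> space M \<Longrightarrow> (\<Sum>t\<in>T. act M (\<phi> (act M v (inv t))) t) = v"
    using R by (auto simp: rel_projective_def)
  have Pc: "P \<subseteq> carrier G" using P by (rule subgroup.subset)
  have Tc: "T \<subseteq> carrier G" using T by (simp add: right_transversal_def)
  define f where "f g = l (act M (\<phi> (act M e (inv g))) g)" for g
  have m: "\<phi> v \<in> space M" if "v \<in> space M" for v using fg_homD(1)[OF \<phi> that] .
  show ?thesis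
  proof (rule p_group_fixes_coset[OF fin Rs P p T])
    show "f (r \<otimes> g) = f g" if "r \<in> R" "g \<in> carrier G" for r g
      unfolding f_def using transfer_term_invariant[OF Rs \<phi> e(1) that] by simp
    show "f (g \<otimes> h) = f g" if g: "g \<in> carrier G" and h: "h \<in> P" for g h
    proof -
      have hc: "h \<in> carrier G" using h Pc by blast
      have "act M e (inv (g \<otimes> h)) = act M (act M e (inv h)) (inv g)" using e g hc by (simp add: act_mult inv_mult_group)
      also have "act M e (inv h) = e" using e h P by (simp add: subgroup.m_inv_closed)
      finally have "f (g \<otimes> h) = l (act M (act M (\<phi> (act M e (inv g))) g) h)"
        using e g hc m by (simp add: f_def act_mult)
      then show ?thesis using l(2) h e g m by (simp add: f_def)
    qed
    have "sum f T = l (\<Sum>t\<in>T. act M (\<phi> (act M e (inv t))) t)"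
      unfolding f_def
      by (rule sum_additive_on[symmetric, where A = "space M" and f = l]) (use e Tc m l in \<open>auto simp: subset_iff\<close>)
    then show "sum f T \<noteq> 0" using id[OF e(1)] nz by simp
  qed
qed

text \<open>
  The families \<open>b\<close> and \<open>l\<close> are a basis with its coordinate functions, so \<open>\<Sum>i. l i (\<phi> (b i))\<close> is the trace
  of \<open>\<phi>\<close> and the last hypothesis says that the dimension is nonzero in the field. The trace of
  \<open>t\<^sup>-\<^sup>1 \<phi> t\<close> does not depend on \<open>t\<close>; hence the dimension is a multiple of the index of \<open>R\<close>, which is
  therefore prime to \<open>p\<close>.
\<close>

lemma dimension_bound:
  assumes fin: "finite (carrier G)" and P: "subgroup P G"
    and p: "prime p" "CHAR('k) = p" "card P = p ^ k"
    and R: "rel_projective G R M"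
    and I: "finite I" and b: "\<And>i. i \<in> I \<Longrightarrow> b i \<in> space M"
    and l: "\<And>i v w. i \<in> I \<Longrightarrow> v \<in> space M \<Longrightarrow> w \<in> space M \<Longrightarrow> l i (v + w) = l i v + (l i w :: 'k)"
      "\<And>i c v. i \<in> I \<Longrightarrow> v \<in> space M \<Longrightarrow> l i (scale M c v) = c * l i v"
    and rep: "\<And>v. v \<in> space M \<Longrightarrow> v = (\<Sum>i\<in>I. scale M (l i v) (b i))"
    and nz: "(\<Sum>i\<in>I. l i (b i)) \<noteq> 0"
  shows "\<exists>g\<in>carrier G. \<forall>h\<in>P. g \<otimes> h \<otimes> inv g \<in> R"
proof -
  obtain \<phi> T where Rs: "subgroup R G" and \<phi>: "fg_hom (G\<lparr>carrier := R\<rparr>) M M \<phi>"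
    and T: "right_transversal G R T" and id: "\<And>v. v \<in> space M \<Longrightarrow> (\<Sum>t\<in>T. act M (\<phi> (act M v (inv t))) t) = v"
    using R by (auto simp: rel_projective_def)
  have Tc: "T \<subseteq> carrier G" using T by (simp add: right_transversal_def)
  have m: "\<phi> v \<in> space M" if "v \<in> space M" for v using fg_homD(1)[OF \<phi> that] .
  have lsum: "l i (\<Sum>j\<in>J. h j) = (\<Sum>j\<in>J. l i (h j))" if "i \<in> I" "\<And>j. j \<in> J \<Longrightarrow> h j \<in> space M"
    for i and J :: "'j set" and h
    by (rule sum_additive_on[where A = "space M" and f = "l i"]) (use that l in auto)
  define \<tau> where "\<tau> = (\<Sum>i\<in>I. l i (\<phi> (b i)))"
  \<comment> \<open>The trace of a composite does not depend on the order of its factors; here both orders are expanded in the basis.\<close>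
  have const: "(\<Sum>i\<in>I. l i (act M (\<phi> (act M (b i) (inv g))) g)) = \<tau>" if g: "g \<in> carrier G" for g
  proof -
    have "l i (act M (\<phi> (act M (b i) (inv g))) g)
        = (\<Sum>j\<in>I. l j (\<phi> (act M (b i) (inv g))) * l i (act M (b j) g))" if i: "i \<in> I" for i
    proof -
      let ?w = "\<phi> (act M (b i) (inv g))"
      have w: "?w \<in> space M" using b i g m by simp
      have "act M ?w g = act M (\<Sum>j\<in>I. scale M (l j ?w) (b j)) g" using rep[OF w] by simp
      also have "\<dots> = (\<Sum>j\<in>I. scale M (l j ?w) (act M (b j) g))"
        using b g by (simp add: act_sum act_scale)
      finally show ?thesis using lsum[OF i, of I] b g l(2)[OF i] by simp
    qed
    then have "(\<Sum>i\<in>I. l i (act M (\<phi> (act M (b i) (inv g))) g))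
        = (\<Sum>j\<in>I. \<Sum>i\<in>I. l j (\<phi> (act M (b i) (inv g))) * l i (act M (b j) g))"
      by (simp, subst sum.swap) simp
    also have "\<dots> = \<tau>"
      unfolding \<tau>_def
    proof (rule sum.cong[OF refl])
      fix j assume j: "j \<in> I"
      let ?w = "act M (b j) g"
      have w: "?w \<in> space M" using b j g by simp
      have "b j = act M ?w (inv g)" using b j g by (simp add: act_mult)
      also have "\<dots> = act M (\<Sum>i\<in>I. scale M (l i ?w) (b i)) (inv g)" using rep[OF w] by simp
      also have "\<dots> = (\<Sum>i\<in>I. scale M (l i ?w) (act M (b i) (inv g)))"
        using b g by (simp add: act_sum act_scale)
      finally have bj: "b j = (\<Sum>i\<in>I. scale M (l i ?w) (act M (b i) (inv g)))" .
      have "\<phi> (b j) = (\<Sum>i\<in>I. scale M (l i ?w) (\<phi> (act M (b i) (inv g))))"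
        by (subst bj, subst hom_sum[OF \<phi>]) (use b g fg_homD(3)[OF \<phi>] in auto)
      then show "(\<Sum>i\<in>I. l j (\<phi> (act M (b i) (inv g))) * l i ?w) = l j (\<phi> (b j))"
        using lsum[OF j, of I] b g m l(2)[OF j] by (simp add: mult.commute)
    qed
    finally show ?thesis .
  qed
  have "(\<Sum>i\<in>I. l i (b i)) = (\<Sum>i\<in>I. \<Sum>t\<in>T. l i (act M (\<phi> (act M (b i) (inv t))) t))"
  proof (rule sum.cong[OF refl])
    fix i assume i: "i \<in> I"
    have "l i (\<Sum>t\<in>T. act M (\<phi> (act M (b i) (inv t))) t) = (\<Sum>t\<in>T. l i (act M (\<phi> (act M (b i) (inv t))) t))"
      by (rule lsum[OF i]) (use b i Tc m in auto)
    then show "l i (b i) = (\<Sum>t\<in>T. l i (act M (\<phi> (act M (b i) (inv t))) t))" using id[OF b[OF i]] by simp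
  qed
  also have "\<dots> = (\<Sum>t\<in>T. \<tau>)"
    by (subst sum.swap) (intro sum.cong refl const, use Tc in auto)
  finally have "(\<Sum>t\<in>T. \<tau>) \<noteq> 0" using nz by simp
  then have "(\<Sum>t\<in>T. 1 :: 'k) \<noteq> 0" by auto
  then show ?thesis by (intro p_group_fixes_coset[OF fin Rs P p T, of "\<lambda>_. 1"]) auto
qed

end

lemma (in group) sylow_subgroup:
  assumes fin: "finite (carrier G)" and H: "subgroup H G" and p: "prime p"
  obtains P k T where "subgroup P G" "P \<subseteq> H" "card P = p ^ k"
    "right_transversal (G\<lparr>carrier := H\<rparr>) P T" "\<not> p dvd card T"
proof -
  interpret H: group "G\<lparr>carrier := H\<rparr>" using group_subgroup[OF H] .
  have fH: "finite H" using fin H finite_subset subgroup.subset by blast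
  have pos: "card H > 0" using fH subgroup.one_closed[OF H] by (auto simp: card_gt_0_iff)
  define k where "k = multiplicity p (card H)"
  obtain m where m: "card H = p ^ k * m" "\<not> p dvd m"
    using multiplicity_decompose'[of "card H" p] pos p unfolding k_def by (metis gr_implies_not0 not_prime_unit)
  have "\<exists>P. subgroup P (G\<lparr>carrier := H\<rparr>) \<and> card P = p ^ k"
    by (rule sylow_thm[OF p H.is_group]) (use m fH in \<open>auto simp: Coset.order_def\<close>)
  then obtain P where P: "subgroup P (G\<lparr>carrier := H\<rparr>)" "card P = p ^ k" by blast
  obtain T where T: "right_transversal (G\<lparr>carrier := H\<rparr>) P T" by (rule H.transversal_exists[OF P(1)])
  have "p ^ k * card T = p ^ k * m" using H.card_transversal[OF P(1) T] P(2) m by (simp add: Coset.order_def)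
  then have "card T = m" using p by (simp add: prime_gt_0_nat)
  moreover have "P \<subseteq> H" using subgroup.subset[OF P(1)] by simp
  moreover have "subgroup P G" using incl_subgroup[OF H P(1)] .
  ultimately show ?thesis using that P(2) T m(2) by blast
qed

section \<open>The group algebra as a ring and as a bimodule\<close>

locale finite_group = group G for G :: "('g, 'm) monoid_scheme" (structure) +
  assumes fin: "finite (carrier G)"
begin

abbreviation conv :: "('g \<Rightarrow> 'k::field) \<Rightarrow> ('g \<Rightarrow> 'k) \<Rightarrow> 'g \<Rightarrow> 'k" (infixl \<open>\<star>\<close> 70) where
  "x \<star> y \<equiv> mult (group_algebra G) x y"

lemma conv_apply: "(x \<star> y) g = (if g \<in> carrier G then \<Sum>h\<in>carrier G. x h * y (inv h \<otimes> g) else 0)"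
  by (simp add: group_algebra_def)

lemma alg_carrier: "x \<in> carrier (group_algebra G) \<longleftrightarrow> (\<forall>g. g \<notin> carrier G \<longrightarrow> x g = 0)"
  by (simp add: group_algebra_def)

lemma alg_simps [simp]:
  "zero (group_algebra G) = 0" "add (group_algebra G) = (+)" "one (group_algebra G) = group_elem \<one>"
  by (simp_all add: group_algebra_def group_elem_def)

lemma conv_closed [simp]: "x \<star> y \<in> carrier (group_algebra G)"
  by (simp add: alg_carrier conv_apply)

lemma group_elem_closed [simp]: "g \<in> carrier G \<Longrightarrow> group_elem g \<in> carrier (group_algebra G)"
  by (auto simp: alg_carrier group_elem_def)

lemma alg_add_closed: "x \<in> carrier (group_algebra G) \<Longrightarrow> y \<in> carrier (group_algebra G) \<Longrightarrow>
    x + y \<in> carrier (group_algebra G)"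
  by (simp add: alg_carrier)

lemma alg_zero_closed: "0 \<in> carrier (group_algebra G)"
  by (simp add: alg_carrier)

lemma alg_scale_closed: "x \<in> carrier (group_algebra G) \<Longrightarrow> fun_scale c x \<in> carrier (group_algebra G)"
  by (simp add: alg_carrier fun_scale_def)

lemma conv_add_left: "(x + y) \<star> z = x \<star> z + y \<star> z"
  by (auto simp: fun_eq_iff conv_apply distrib_right sum.distrib)
lemma conv_add_right: "z \<star> (x + y) = z \<star> x + z \<star> y"
  by (auto simp: fun_eq_iff conv_apply distrib_left sum.distrib)
lemma conv_scale_left: "fun_scale c x \<star> y = fun_scale c (x \<star> y)"
  by (auto simp: fun_eq_iff conv_apply fun_scale_def sum_distrib_left mult.assoc)
lemma conv_scale_right: "x \<star> fun_scale c y = fun_scale c (x \<star> y)"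
  by (auto simp: fun_eq_iff conv_apply fun_scale_def sum_distrib_left mult.left_commute)
lemma conv_zero_left [simp]: "0 \<star> x = 0"
  by (auto simp: fun_eq_iff conv_apply)
lemma conv_zero_right [simp]: "x \<star> 0 = 0"
  by (auto simp: fun_eq_iff conv_apply)
lemma conv_sum_left: "sum f I \<star> y = (\<Sum>i\<in>I. f i \<star> y)"
  by (induction I rule: infinite_finite_induct) (auto simp: conv_add_left simp del: plus_fun_apply zero_fun_apply)
lemma conv_sum_right: "y \<star> sum f I = (\<Sum>i\<in>I. y \<star> f i)"
  by (induction I rule: infinite_finite_induct) (auto simp: conv_add_right simp del: plus_fun_apply zero_fun_apply)

lemma sum_translate:
  assumes "k \<in> carrier G"
  shows "(\<Sum>h\<in>carrier G. f (k \<otimes> h)) = sum f (carrier G)"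
  by (rule sum.reindex_bij_witness[where i = "\<lambda>h. inv k \<otimes> h" and j = "\<lambda>h. k \<otimes> h"])
    (use assms in \<open>auto simp: m_assoc[symmetric]\<close>)

lemma conv_assoc: "(x \<star> y) \<star> z = x \<star> (y \<star> z)"
proof
  fix g
  show "((x \<star> y) \<star> z) g = (x \<star> (y \<star> z)) g"
  proof (cases "g \<in> carrier G")
    case True
    have "((x \<star> y) \<star> z) g = (\<Sum>h\<in>carrier G. \<Sum>k\<in>carrier G. x k * y (inv k \<otimes> h) * z (inv h \<otimes> g))"
      using True by (simp add: conv_apply sum_distrib_right)
    also have "\<dots> = (\<Sum>k\<in>carrier G. \<Sum>h\<in>carrier G. x k * y (inv k \<otimes> h) * z (inv h \<otimes> g))"
      by (rule sum.swap)
    also have "\<dots> = (\<Sum>k\<in>carrier G. \<Sum>h\<in>carrier G. x k * y h * z (inv h \<otimes> (inv k \<otimes> g)))"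
    proof (rule sum.cong[OF refl])
      fix k assume k: "k \<in> carrier G"
      have "(\<Sum>h\<in>carrier G. x k * y (inv k \<otimes> h) * z (inv h \<otimes> g))
          = (\<Sum>h\<in>carrier G. x k * y (inv k \<otimes> (k \<otimes> h)) * z (inv (k \<otimes> h) \<otimes> g))"
        using sum_translate[OF k, of "\<lambda>h. x k * y (inv k \<otimes> h) * z (inv h \<otimes> g)"] by simp
      also have "\<dots> = (\<Sum>h\<in>carrier G. x k * y h * z (inv h \<otimes> (inv k \<otimes> g)))"
      proof (rule sum.cong[OF refl])
        fix h assume h: "h \<in> carrier G"
        have "inv k \<otimes> (k \<otimes> h) = h" using h k by (simp add: m_assoc[symmetric])
        moreover have "inv (k \<otimes> h) \<otimes> g = inv h \<otimes> (inv k \<otimes> g)"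
          using h k True by (simp add: inv_mult_group m_assoc)
        ultimately show "x k * y (inv k \<otimes> (k \<otimes> h)) * z (inv (k \<otimes> h) \<otimes> g) = x k * y h * z (inv h \<otimes> (inv k \<otimes> g))"
          by simp
      qed
      finally show "(\<Sum>h\<in>carrier G. x k * y (inv k \<otimes> h) * z (inv h \<otimes> g))
          = (\<Sum>h\<in>carrier G. x k * y h * z (inv h \<otimes> (inv k \<otimes> g)))" .
    qed
    also have "\<dots> = (x \<star> (y \<star> z)) g"
      using True by (simp add: conv_apply sum_distrib_left mult.assoc)
    finally show ?thesis .
  qed (simp add: conv_apply)
qed

lemma group_elem_conv:
  assumes g: "g \<in> carrier G"
  shows "group_elem g \<star> x = (\<lambda>y. if y \<in> carrier G then x (inv g \<otimes> y) else 0)"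
proof
  fix y
  have "(\<Sum>h\<in>carrier G. group_elem g h * x (inv h \<otimes> y)) = (\<Sum>h\<in>carrier G. if h = g then x (inv g \<otimes> y) else 0)"
    by (intro sum.cong) (auto simp: group_elem_def)
  then show "(group_elem g \<star> x) y = (if y \<in> carrier G then x (inv g \<otimes> y) else 0)"
    using g fin by (simp add: conv_apply)
qed

lemma conv_group_elem:
  assumes g: "g \<in> carrier G"
  shows "x \<star> group_elem g = (\<lambda>y. if y \<in> carrier G then x (y \<otimes> inv g) else 0)"
proof
  fix y
  show "(x \<star> group_elem g) y = (if y \<in> carrier G then x (y \<otimes> inv g) else 0)"
  proof (cases "y \<in> carrier G")
    case y: True
    have "(\<Sum>h\<in>carrier G. x h * group_elem g (inv h \<otimes> y)) = (\<Sum>h\<in>carrier G. if h = y \<otimes> inv g then x (y \<otimes> inv g) else 0)"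
    proof (rule sum.cong[OF refl])
      fix h assume h: "h \<in> carrier G"
      have "inv h \<otimes> y = g \<longleftrightarrow> h = y \<otimes> inv g"
        using h y g by (metis inv_closed inv_solve_left' inv_solve_right m_closed)
      then show "x h * group_elem g (inv h \<otimes> y) = (if h = y \<otimes> inv g then x (y \<otimes> inv g) else 0)"
        by (auto simp: group_elem_def)
    qed
    then show ?thesis using y g fin by (simp add: conv_apply)
  qed (simp add: conv_apply)
qed

lemma group_elem_mult: "g \<in> carrier G \<Longrightarrow> h \<in> carrier G \<Longrightarrow> group_elem g \<star> group_elem h = group_elem (g \<otimes> h)"
  unfolding group_elem_conv by (auto simp: group_elem_def fun_eq_iff inv_solve_left')

lemma one_conv: "x \<in> carrier (group_algebra G) \<Longrightarrow> group_elem \<one> \<star> x = x"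
  by (auto simp: group_elem_conv alg_carrier)
lemma conv_one: "x \<in> carrier (group_algebra G) \<Longrightarrow> x \<star> group_elem \<one> = x"
  by (auto simp: conv_group_elem alg_carrier)

lemma group_elem_expand:
  assumes "x \<in> carrier (group_algebra G)"
  shows "x = (\<Sum>g\<in>carrier G. fun_scale (x g) (group_elem g))"
proof
  fix y
  have "(\<Sum>g\<in>carrier G. fun_scale (x g) (group_elem g)) y = (\<Sum>g\<in>carrier G. if g = y then x y else 0)"
    unfolding sum_fun_apply by (intro sum.cong) (auto simp: fun_scale_def group_elem_def)
  then show "x y = (\<Sum>g\<in>carrier G. fun_scale (x g) (group_elem g)) y"
    using assms fin by (auto simp: alg_carrier)
qed

lemma alg_ring: "ring (group_algebra G :: ('g \<Rightarrow> 'k::field) ring)"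
proof (rule ringI)
  show "abelian_group (group_algebra G :: ('g \<Rightarrow> 'k) ring)"
  proof (rule abelian_groupI)
    fix x :: "'g \<Rightarrow> 'k" assume x: "x \<in> carrier (group_algebra G)"
    show "\<exists>y\<in>carrier (group_algebra G). y \<oplus>\<^bsub>group_algebra G\<^esub> x = \<zero>\<^bsub>group_algebra G\<^esub>"
      by (rule bexI[of _ "- x"]) (use x in \<open>auto simp: alg_carrier\<close>)
  qed (auto simp: alg_carrier add.assoc add.commute)
  show "monoid (group_algebra G :: ('g \<Rightarrow> 'k) ring)"
    by (rule monoidI) (auto simp: conv_assoc one_conv conv_one)
qed (auto simp: conv_add_left conv_add_right simp del: plus_fun_apply)

lemma idealD:
  assumes "ideal I (group_algebra G :: ('g \<Rightarrow> 'k::field) ring)"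
  shows "I \<subseteq> carrier (group_algebra G)" "0 \<in> I"
    "x \<in> I \<Longrightarrow> y \<in> I \<Longrightarrow> x + y \<in> I" "x \<in> I \<Longrightarrow> y \<in> carrier (group_algebra G) \<Longrightarrow> y \<star> x \<in> I"
    "x \<in> I \<Longrightarrow> y \<in> carrier (group_algebra G) \<Longrightarrow> x \<star> y \<in> I"
    "x \<in> I \<Longrightarrow> fun_scale c x \<in> I" "x \<in> I \<Longrightarrow> y \<in> I \<Longrightarrow> x - y \<in> I"
proof -
  have oc: "group_elem \<one> \<in> carrier (group_algebra G :: ('g \<Rightarrow> 'k) ring)" by simp
  interpret ideal I "group_algebra G" by fact
  show sub: "I \<subseteq> carrier (group_algebra G)" by (rule a_subset)
  show "0 \<in> I" using additive_subgroup.zero_closed[OF is_additive_subgroup] by simp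
  show add: "x \<in> I \<Longrightarrow> y \<in> I \<Longrightarrow> x + y \<in> I" for x y
    using additive_subgroup.a_closed[OF is_additive_subgroup, of x y] by simp
  show l: "x \<in> I \<Longrightarrow> y \<in> carrier (group_algebra G) \<Longrightarrow> y \<star> x \<in> I" for x y by (rule I_l_closed)
  show "x \<in> I \<Longrightarrow> y \<in> carrier (group_algebra G) \<Longrightarrow> x \<star> y \<in> I" for x y by (rule I_r_closed)
  show sc: "x \<in> I \<Longrightarrow> fun_scale c x \<in> I" for x c
  proof -
    assume x: "x \<in> I"
    have "fun_scale c (group_elem \<one>) \<star> x = fun_scale c x"
      using x sub by (simp add: conv_scale_left one_conv subset_iff)
    then show ?thesis using l[OF x alg_scale_closed[OF oc], of c] by simp
  qed
  assume x: "x \<in> I" and y: "y \<in> I"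
  have "x - y = x + fun_scale (- 1) y" by (auto simp: fun_scale_def)
  then show "x - y \<in> I" using add[OF x sc[OF y, of "-1"]] by metis
qed

lemma idealI_conv:
  assumes "I \<subseteq> carrier (group_algebra G :: ('g \<Rightarrow> 'k::field) ring)" "0 \<in> I" "\<And>x y. x \<in> I \<Longrightarrow> y \<in> I \<Longrightarrow> x + y \<in> I"
    and sc: "\<And>c x. x \<in> I \<Longrightarrow> fun_scale c x \<in> I"
    and "\<And>x g. x \<in> I \<Longrightarrow> g \<in> carrier G \<Longrightarrow> group_elem g \<star> x \<in> I"
    and "\<And>x g. x \<in> I \<Longrightarrow> g \<in> carrier G \<Longrightarrow> x \<star> group_elem g \<in> I"
  shows "ideal I (group_algebra G)"
proof (rule idealI[OF alg_ring])
  have isum: "sum f J \<in> I" if "\<And>j. j \<in> J \<Longrightarrow> f j \<in> I" for f and J :: "'g set"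
    using that by (induction J rule: infinite_finite_induct) (auto simp: assms simp del: plus_fun_apply zero_fun_apply)
  show "subgroup I (add_monoid (group_algebra G))"
  proof (rule group.subgroupI)
    show "Group.group (add_monoid (group_algebra G :: ('g \<Rightarrow> 'k) ring))"
      using alg_ring ring_def abelian_group.a_group by blast
    show "I \<subseteq> carrier (add_monoid (group_algebra G))" using assms by simp
    show "I \<noteq> {}" using assms by blast
    fix a assume a: "a \<in> I"
    have "inv\<^bsub>add_monoid (group_algebra G)\<^esub> a = fun_scale (-1) a"
    proof (rule group.inv_equality)
      show "Group.group (add_monoid (group_algebra G :: ('g \<Rightarrow> 'k) ring))"
        using alg_ring ring_def abelian_group.a_group by blast
    qed (use a assms(1) in \<open>auto simp: fun_scale_def alg_carrier fun_eq_iff\<close>)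
    then show "inv\<^bsub>add_monoid (group_algebra G)\<^esub> a \<in> I" using sc[OF a] by simp
  next
    fix a b assume "a \<in> I" "b \<in> I"
    then show "a \<otimes>\<^bsub>add_monoid (group_algebra G)\<^esub> b \<in> I" using assms(3) by simp
  qed
  fix a x :: "'g \<Rightarrow> 'k" assume a: "a \<in> I" and x: "x \<in> carrier (group_algebra G)"
  have "x \<star> a = (\<Sum>g\<in>carrier G. fun_scale (x g) (group_elem g \<star> a))"
    by (subst group_elem_expand[OF x]) (simp add: conv_sum_left conv_scale_left)
  then show "x \<star> a \<in> I" using isum a assms(5) sc by simp
  have "a \<star> x = (\<Sum>g\<in>carrier G. fun_scale (x g) (a \<star> group_elem g))"
    by (subst group_elem_expand[OF x]) (simp add: conv_sum_right conv_scale_right)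
  then show "a \<star> x \<in> I" using isum a assms(6) sc by simp
qed

lemma set_add_alg: "I <+>\<^bsub>group_algebra G\<^esub> J = {x + y | x y. x \<in> I \<and> y \<in> J}"
  by (auto simp: set_add_def' simp del: plus_fun_apply)

lemma block_module_simps [simp]:
  "scale (block_module G B) = fun_scale" "space (block_module G B) = B"
  "act (block_module G B) x (g, g') = group_elem (inv g) \<star> x \<star> group_elem g'"
  by (simp_all add: block_module_def)

lemma prod_group: "Group.group (G \<times>\<times> G)"
  by (rule DirProd_group) (rule is_group)+

lemma prod_finite_group: "finite_group (G \<times>\<times> G)"
  using prod_group fin by (simp add: finite_group_def finite_group_axioms_def)

lemma two_sided_apply:
  assumes "g \<in> carrier G" "h \<in> carrier G" "y \<in> carrier G"
  shows "(group_elem g \<star> x \<star> group_elem h) y = x (inv g \<otimes> (y \<otimes> inv h))"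
  using assms by (simp add: conv_group_elem group_elem_conv)

lemma block_module_module:
  assumes I: "ideal I (group_algebra G :: ('g \<Rightarrow> 'k::field) ring)"
  shows "fg_module (G \<times>\<times> G) (block_module G I)"
proof -
  interpret w: vector_space "fun_scale :: 'k \<Rightarrow> ('g \<Rightarrow> 'k) \<Rightarrow> _" by (rule vector_space_fun_scale)
  note D = idealD[OF I]
  have sub: "w.subspace I" using D by (auto simp: w.subspace_def simp del: plus_fun_apply)
  have "I \<subseteq> w.span (group_elem ` carrier G)"
  proof
    fix x assume "x \<in> I"
    then have "x = (\<Sum>g\<in>carrier G. fun_scale (x g) (group_elem g))" using D(1) group_elem_expand by blast
    moreover have "(\<Sum>g\<in>carrier G. fun_scale (x g) (group_elem g)) \<in> w.span (group_elem ` carrier G)"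
      by (intro w.span_sum w.span_scale w.span_base) simp
    ultimately show "x \<in> w.span (group_elem ` carrier G)" by simp
  qed
  then obtain S where S: "finite S" "w.span S = I"
    using w.subspace_has_finite_basis[of "group_elem ` carrier G" I] fin sub by (metis finite_imageI)
  show ?thesis
    unfolding fg_module_def block_module_simps
  proof (intro conjI ballI allI prod_group sub)
    show "vector_space (fun_scale :: 'k \<Rightarrow> ('g \<Rightarrow> 'k) \<Rightarrow> _)" by (rule vector_space_fun_scale)
    show "\<exists>S. finite S \<and> w.span S = I" using S by blast
  next
    fix v gg assume v: "v \<in> I" and g: "gg \<in> carrier (G \<times>\<times> G)"
    obtain g h where gh: "gg = (g, h)" "g \<in> carrier G" "h \<in> carrier G" using g by auto
    show "act (block_module G I) v gg \<in> I" using D(4,5) v gh by simp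
    show "act (block_module G I) (v + w) gg = act (block_module G I) v gg + act (block_module G I) w gg" for w
      using gh by (simp add: conv_add_left conv_add_right del: plus_fun_apply)
    show "act (block_module G I) (fun_scale c v) gg = fun_scale c (act (block_module G I) v gg)" for c
      using gh by (simp add: conv_scale_left conv_scale_right)
    fix gg' assume "gg' \<in> carrier (G \<times>\<times> G)"
    then obtain g' h' where gh': "gg' = (g', h')" "g' \<in> carrier G" "h' \<in> carrier G" by auto
    have "group_elem (inv g') \<star> (group_elem (inv g) \<star> v \<star> group_elem h) \<star> group_elem h'
        = (group_elem (inv g') \<star> group_elem (inv g)) \<star> v \<star> (group_elem h \<star> group_elem h')"
      by (simp add: conv_assoc)
    then show "act (block_module G I) (act (block_module G I) v gg) gg' = act (block_module G I) v (gg \<otimes>\<^bsub>G \<times>\<times> G\<^esub> gg')"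
      using gh gh' by (simp add: group_elem_mult inv_mult_group)
  next
    fix v assume "v \<in> I"
    then show "act (block_module G I) v \<one>\<^bsub>G \<times>\<times> G\<^esub> = v" using D(1) by (auto simp: one_conv conv_one)
  qed
qed

text \<open>
  Submodules of \<open>FG\<close> as a bimodule are two-sided ideals. This turns the indecomposability of a block,
  which is stated for ideals, into the indecomposability of a module.
\<close>

lemma fg_submodule_block_module:
  assumes I: "ideal I (group_algebra G :: ('g \<Rightarrow> 'k::field) ring)"
  shows "fg_submodule (G \<times>\<times> G) (block_module G I) U \<longleftrightarrow> ideal U (group_algebra G) \<and> U \<subseteq> I"
proof -
  interpret w: vector_space "fun_scale :: 'k \<Rightarrow> ('g \<Rightarrow> 'k) \<Rightarrow> _" by (rule vector_space_fun_scale)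
  show ?thesis
  proof
    assume "fg_submodule (G \<times>\<times> G) (block_module G I) U"
    then have U: "U \<subseteq> I" "w.subspace U"
      and act: "\<And>u g h. u \<in> U \<Longrightarrow> g \<in> carrier G \<Longrightarrow> h \<in> carrier G \<Longrightarrow> group_elem (inv g) \<star> u \<star> group_elem h \<in> U"
      by (auto simp: fg_submodule_def)
    have Ic: "U \<subseteq> carrier (group_algebra G)" using U(1) idealD(1)[OF I] by blast
    have "ideal U (group_algebra G)"
    proof (rule idealI_conv[OF Ic])
      fix x g assume x: "x \<in> U" and g: "g \<in> carrier G"
      have xc: "x \<in> carrier (group_algebra G)" using x Ic by blast
      show "group_elem g \<star> x \<in> U" using act[OF x inv_closed[OF g] one_closed] g by (simp add: conv_one)
      show "x \<star> group_elem g \<in> U" using act[OF x one_closed g] xc by (simp add: one_conv)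
    qed (use U(2) in \<open>auto simp: w.subspace_def simp del: plus_fun_apply\<close>)
    then show "ideal U (group_algebra G) \<and> U \<subseteq> I" using U by blast
  next
    assume U: "ideal U (group_algebra G) \<and> U \<subseteq> I"
    then have "ideal U (group_algebra G)" by blast
    note D = idealD[OF this]
    show "fg_submodule (G \<times>\<times> G) (block_module G I) U"
      using U D by (auto simp: fg_submodule_def w.subspace_def simp del: plus_fun_apply)
  qed
qed

lemma block_module_indecomposable:
  assumes B: "is_block G (B :: ('g \<Rightarrow> 'k::field) set)"
  shows "fg_indecomposable (G \<times>\<times> G) (block_module G B)"
proof -
  have I: "ideal B (group_algebra G)" using B by (simp add: is_block_def)
  show ?thesis
    unfolding fg_indecomposable_def
  proof (intro conjI allI impI)
    show "fg_module (G \<times>\<times> G) (block_module G B)" by (rule block_module_module[OF I])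
    show "space (block_module G B) \<noteq> {0}" using B by (simp add: is_block_def)
    fix U W assume "fg_direct_sum (G \<times>\<times> G) (block_module G B) U W"
    then have UW: "ideal U (group_algebra G)" "ideal W (group_algebra G)" "U \<inter> W = {0}"
      "U <+>\<^bsub>group_algebra G\<^esub> W = B"
      unfolding fg_direct_sum_def set_add_alg fg_submodule_block_module[OF I] by auto
    then show "U = {0} \<or> W = {0}" using B unfolding is_block_def by blast
  qed
qed

end

section \<open>Conjugation in the group algebra and its action on modules\<close>

context finite_group
begin

lemma diagonal_subgroup_iff:
  "subgroup {(h, h) | h. h \<in> H} (G \<times>\<times> G) \<longleftrightarrow> subgroup H G"
proof
  assume D: "subgroup {(h, h) | h. h \<in> H} (G \<times>\<times> G)"
  note D' = subgroup.subset[OF D] subgroup.m_closed[OF D] subgroup.one_closed[OF D]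
  show "subgroup H G"
  proof (rule subgroupI)
    show "H \<subseteq> carrier G" using D'(1) by auto
    show "H \<noteq> {}" using D'(3) by auto
    fix a assume a: "a \<in> H"
    then have ac: "a \<in> carrier G" using D'(1) by auto
    have "inv\<^bsub>G \<times>\<times> G\<^esub> (a, a) \<in> {(h, h) | h. h \<in> H}" by (rule subgroup.m_inv_closed[OF D]) (use a in blast)
    then show "inv a \<in> H" using ac by (simp add: inv_DirProd[OF is_group is_group])
    fix b assume "b \<in> H"
    then show "a \<otimes> b \<in> H" using a D'(2)[of "(a, a)" "(b, b)"] by simp
  qed
next
  assume H: "subgroup H G"
  have Hc: "H \<subseteq> carrier G" using H by (rule subgroup.subset)
  interpret GG: group "G \<times>\<times> G" by (rule prod_group)
  show "subgroup {(h, h) | h. h \<in> H} (G \<times>\<times> G)"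
  proof (rule GG.subgroupI)
    show "{(h, h) | h. h \<in> H} \<noteq> {}" using subgroup.one_closed[OF H] by blast
  qed (use Hc H in \<open>auto simp: inv_DirProd[OF is_group is_group] subset_iff subgroup.m_closed subgroup.m_inv_closed\<close>)
qed

text \<open>
  A transversal of \<open>\<Delta>H\<close> in \<open>G \<times> G\<close> consists of the pairs \<open>(t, t g)\<close>. With these representatives a transfer
  from \<open>\<Delta>H\<close> splits into a sum over \<open>g\<close>, from \<open>\<Delta>G\<close> to \<open>G \<times> G\<close>, and a transfer from \<open>H\<close> to \<open>G\<close>.
\<close>

lemma diagonal_transversal:
  assumes H: "subgroup H G" and T: "right_transversal G H T"
  shows "inj_on (\<lambda>(t, g). (t, t \<otimes> g)) (T \<times> carrier G)"
    and "right_transversal (G \<times>\<times> G) {(h, h) | h. h \<in> H} ((\<lambda>(t, g). (t, t \<otimes> g)) ` (T \<times> carrier G))"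
proof -
  have Tc: "T \<subseteq> carrier G" using T by (simp add: right_transversal_def)
  show "inj_on (\<lambda>(t, g). (t, t \<otimes> g)) (T \<times> carrier G)"
    using Tc by (auto intro!: inj_onI simp: subset_iff)
  show "right_transversal (G \<times>\<times> G) {(h, h) | h. h \<in> H} ((\<lambda>(t, g). (t, t \<otimes> g)) ` (T \<times> carrier G))"
    unfolding right_transversal_def
  proof (intro conjI ballI)
    show "(\<lambda>(t, g). (t, t \<otimes> g)) ` (T \<times> carrier G) \<subseteq> carrier (G \<times>\<times> G)" using Tc by auto
    fix xy assume "xy \<in> carrier (G \<times>\<times> G)"
    then obtain x y where xy: "xy = (x, y)" "x \<in> carrier G" "y \<in> carrier G" by auto
    have iff: "xy \<otimes>\<^bsub>G \<times>\<times> G\<^esub> inv\<^bsub>G \<times>\<times> G\<^esub> (t, t \<otimes> g) \<in> {(h, h) | h. h \<in> H} \<longleftrightarrow> x \<otimes> inv t \<in> H \<and> g = inv x \<otimes> y"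
      if "t \<in> T" "g \<in> carrier G" for t g
    proof -
      have t: "t \<in> carrier G" using that Tc by blast
      have "x \<otimes> inv t = y \<otimes> inv (t \<otimes> g) \<longleftrightarrow> g = inv x \<otimes> y"
      proof
        assume e: "x \<otimes> inv t = y \<otimes> inv (t \<otimes> g)"
        have "x \<otimes> inv t \<otimes> (t \<otimes> g) = x \<otimes> g" using xy t that by (simp add: m_assoc) (simp add: m_assoc[symmetric] t)
        moreover have "y \<otimes> inv (t \<otimes> g) \<otimes> (t \<otimes> g) = y" using xy t that by (simp add: m_assoc)
        ultimately have "x \<otimes> g = y" using e by simp
        then show "g = inv x \<otimes> y" using xy that by (simp add: inv_solve_left)
      next
        assume "g = inv x \<otimes> y"
        then have "inv (t \<otimes> g) = inv y \<otimes> (x \<otimes> inv t)" using xy t by (simp add: inv_mult_group m_assoc)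
        then show "x \<otimes> inv t = y \<otimes> inv (t \<otimes> g)" using xy t by (simp add: m_assoc[symmetric])
      qed
      then show ?thesis using xy t that by (auto simp: inv_DirProd[OF is_group is_group])
    qed
    have "\<exists>!t. t \<in> T \<and> x \<otimes> inv t \<in> H" using T xy by (simp add: right_transversal_def)
    then obtain t where t: "t \<in> T" "x \<otimes> inv t \<in> H" and u: "\<And>s. s \<in> T \<Longrightarrow> x \<otimes> inv s \<in> H \<Longrightarrow> s = t" by blast
    have g: "inv x \<otimes> y \<in> carrier G" using xy by simp
    show "\<exists>!s. s \<in> (\<lambda>(t, g). (t, t \<otimes> g)) ` (T \<times> carrier G) \<and> xy \<otimes>\<^bsub>G \<times>\<times> G\<^esub> inv\<^bsub>G \<times>\<times> G\<^esub> s \<in> {(h, h) | h. h \<in> H}"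
    proof (intro ex1I conjI)
      show "(t, t \<otimes> (inv x \<otimes> y)) \<in> (\<lambda>(t, g). (t, t \<otimes> g)) ` (T \<times> carrier G)" using t g by auto
      show "xy \<otimes>\<^bsub>G \<times>\<times> G\<^esub> inv\<^bsub>G \<times>\<times> G\<^esub> (t, t \<otimes> (inv x \<otimes> y)) \<in> {(h, h) | h. h \<in> H}"
        using iff[OF t(1) g] t by blast
      fix s assume s: "s \<in> (\<lambda>(t, g). (t, t \<otimes> g)) ` (T \<times> carrier G) \<and> xy \<otimes>\<^bsub>G \<times>\<times> G\<^esub> inv\<^bsub>G \<times>\<times> G\<^esub> s \<in> {(h, h) | h. h \<in> H}"
      then obtain t' g' where tg: "t' \<in> T" "g' \<in> carrier G" "s = (t', t' \<otimes> g')" by auto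
      then have "x \<otimes> inv t' \<in> H \<and> g' = inv x \<otimes> y" using iff[OF tg(1,2)] s by blast
      then show "s = (t, t \<otimes> (inv x \<otimes> y))" using u tg by blast
    qed
  qed
qed

definition conj_elem :: "'g \<Rightarrow> ('g \<Rightarrow> 'k::field) \<Rightarrow> 'g \<Rightarrow> 'k" where
  "conj_elem g x = group_elem (inv g) \<star> x \<star> group_elem g"

lemma conj_elem_conv: "g \<in> carrier G \<Longrightarrow> conj_elem g (x \<star> y) = conj_elem g x \<star> conj_elem g y"
  for x y :: "'g \<Rightarrow> 'k::field"
proof -
  assume g: "g \<in> carrier G"
  have "conj_elem g x \<star> conj_elem g y = group_elem (inv g) \<star> x \<star> (group_elem g \<star> group_elem (inv g)) \<star> (y \<star> group_elem g)"
    by (simp add: conj_elem_def conv_assoc)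
  also have "\<dots> = conj_elem g (x \<star> y)"
    using g by (simp add: group_elem_mult conj_elem_def conv_assoc one_conv)
  finally show ?thesis by simp
qed

lemma conj_elem_mult: "g \<in> carrier G \<Longrightarrow> h \<in> carrier G \<Longrightarrow> conj_elem h (conj_elem g x) = conj_elem (g \<otimes> h) x"
  for x :: "'g \<Rightarrow> 'k::field"
proof -
  assume g: "g \<in> carrier G" "h \<in> carrier G"
  have "conj_elem h (conj_elem g x) = (group_elem (inv h) \<star> group_elem (inv g)) \<star> x \<star> (group_elem g \<star> group_elem h)"
    by (simp add: conj_elem_def conv_assoc)
  then show ?thesis using g by (simp add: group_elem_mult conj_elem_def inv_mult_group)
qed

lemma conj_elem_closed: "conj_elem g x \<in> carrier (group_algebra G)"
  by (simp add: conj_elem_def)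

lemma conj_elem_commute: "g \<in> carrier G \<Longrightarrow> conj_elem g x = x \<Longrightarrow> x \<star> group_elem g = group_elem g \<star> x"
  for x :: "'g \<Rightarrow> 'k::field"
proof -
  assume g: "g \<in> carrier G" and c: "conj_elem g x = x"
  have xc: "x \<in> carrier (group_algebra G)" using c conj_elem_closed by metis
  have "group_elem g \<star> conj_elem g x = (group_elem g \<star> group_elem (inv g)) \<star> x \<star> group_elem g"
    by (simp add: conj_elem_def conv_assoc)
  then show ?thesis using g c xc by (simp add: group_elem_mult one_conv)
qed

lemma conj_elem_sum: "conj_elem g (sum f I) = (\<Sum>i\<in>I. conj_elem g (f i))"
  by (simp add: conj_elem_def conv_sum_left conv_sum_right)

end

locale finite_fg_mod = fg_mod G M + finite_group G for G :: "('g, 'm) monoid_scheme" (structure)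
  and M :: "('k::field, 'v::ab_group_add, 'g) gmodule"
begin

abbreviation aact :: "'v \<Rightarrow> ('g \<Rightarrow> 'k) \<Rightarrow> 'v" where "aact v x \<equiv> algebra_act G M v x"

lemma aact_closed [simp]: "v \<in> space M \<Longrightarrow> aact v x \<in> space M"
  unfolding algebra_act_def by (intro space_sum space_scale act_closed)

lemma aact_add_left: "v \<in> space M \<Longrightarrow> w \<in> space M \<Longrightarrow> aact (v + w) x = aact v x + aact w x"
  by (simp add: algebra_act_def act_add vs.scale_right_distrib sum.distrib)
lemma aact_add_right: "aact v (x + y) = aact v x + aact v y"
  by (simp add: algebra_act_def vs.scale_left_distrib sum.distrib)
lemma aact_scale_left: "v \<in> space M \<Longrightarrow> aact (scale M c v) x = scale M c (aact v x)"
  by (simp add: algebra_act_def act_scale vs.scale_sum_right mult.commute)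
lemma aact_scale_right: "aact v (fun_scale c x) = scale M c (aact v x)"
  by (simp add: algebra_act_def fun_scale_def vs.scale_sum_right)
lemma aact_zero_right [simp]: "aact v 0 = 0"
  by (simp add: algebra_act_def)
lemma aact_zero_left [simp]: "aact 0 x = 0"
  by (simp add: algebra_act_def)
lemma aact_sum_right: "aact v (sum f I) = (\<Sum>i\<in>I. aact v (f i))"
  by (induction I rule: infinite_finite_induct) (auto simp: aact_add_right simp del: plus_fun_apply zero_fun_apply)

lemma aact_group_elem: "g \<in> carrier G \<Longrightarrow> aact v (group_elem g) = act M v g"
proof -
  assume g: "g \<in> carrier G"
  have "aact v (group_elem g) = (\<Sum>h\<in>carrier G. if h = g then act M v g else 0)"
    unfolding algebra_act_def by (intro sum.cong) (auto simp: group_elem_def)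
  then show ?thesis using g fin by simp
qed

lemma aact_conv: "v \<in> space M \<Longrightarrow> aact v (x \<star> y) = aact (aact v x) y"
proof -
  assume v: "v \<in> space M"
  have "aact (aact v x) y = (\<Sum>g\<in>carrier G. \<Sum>h\<in>carrier G. scale M (x h * y g) (act M v (h \<otimes> g)))"
    unfolding algebra_act_def
    using v by (intro sum.cong refl)
      (simp add: act_sum act_scale act_mult vs.scale_sum_right mult.commute)
  also have "\<dots> = (\<Sum>h\<in>carrier G. \<Sum>g\<in>carrier G. scale M (x h * y g) (act M v (h \<otimes> g)))"
    by (rule sum.swap)
  also have "\<dots> = (\<Sum>h\<in>carrier G. \<Sum>g\<in>carrier G. scale M (x h * y (inv h \<otimes> g)) (act M v g))"
  proof (rule sum.cong[OF refl])
    fix h assume h: "h \<in> carrier G"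
    have "(\<Sum>g\<in>carrier G. scale M (x h * y (inv h \<otimes> g)) (act M v g))
      = (\<Sum>g\<in>carrier G. scale M (x h * y (inv h \<otimes> (h \<otimes> g))) (act M v (h \<otimes> g)))"
      using sum_translate[OF h, of "\<lambda>g. scale M (x h * y (inv h \<otimes> g)) (act M v g)"] by simp
    also have "\<dots> = (\<Sum>g\<in>carrier G. scale M (x h * y g) (act M v (h \<otimes> g)))"
      using h by (intro sum.cong refl) (simp add: m_assoc[symmetric])
    finally show "(\<Sum>g\<in>carrier G. scale M (x h * y g) (act M v (h \<otimes> g)))
      = (\<Sum>g\<in>carrier G. scale M (x h * y (inv h \<otimes> g)) (act M v g))" by simp
  qed
  also have "\<dots> = (\<Sum>g\<in>carrier G. \<Sum>h\<in>carrier G. scale M (x h * y (inv h \<otimes> g)) (act M v g))"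
    by (rule sum.swap)
  also have "\<dots> = aact v (x \<star> y)"
    unfolding algebra_act_def by (intro sum.cong refl) (simp add: conv_apply vs.scale_sum_left)
  finally show ?thesis by simp
qed

lemma aact_one [simp]: "v \<in> space M \<Longrightarrow> aact v (group_elem \<one>) = v"
  by (simp add: aact_group_elem)

end

section \<open>Blocks\<close>

context finite_group
begin

lemma carrier_ideal: "ideal (carrier (group_algebra G)) (group_algebra G :: ('g \<Rightarrow> 'k::field) ring)"
  by (rule idealI_conv) (auto simp: alg_add_closed alg_zero_closed alg_scale_closed simp del: plus_fun_apply)

lemma zero_ideal: "ideal {0} (group_algebra G :: ('g \<Rightarrow> 'k::field) ring)"
proof -
  have "fun_scale c 0 = (0 :: 'g \<Rightarrow> 'k)" for c by (simp add: fun_scale_def fun_eq_iff)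
  then show ?thesis
    by (intro idealI_conv) (auto simp: alg_zero_closed simp del: plus_fun_apply zero_fun_apply)
qed

lemma inter_ideal:
  assumes "ideal I (group_algebra G :: ('g \<Rightarrow> 'k::field) ring)" "ideal J (group_algebra G)"
  shows "ideal (I \<inter> J) (group_algebra G)"
  using idealD[OF assms(1)] idealD[OF assms(2)]
  by (intro idealI_conv) (auto simp del: plus_fun_apply)

lemma sum_ideal:
  assumes I: "ideal I (group_algebra G :: ('g \<Rightarrow> 'k::field) ring)" and J: "ideal J (group_algebra G)"
  shows "ideal (I <+>\<^bsub>group_algebra G\<^esub> J) (group_algebra G)"
proof -
  interpret ring "group_algebra G :: ('g \<Rightarrow> 'k) ring" by (rule alg_ring)
  show ?thesis by (rule add_ideals[OF I J])
qed

lemma set_add_alg_commute: "I <+>\<^bsub>group_algebra G\<^esub> J = J <+>\<^bsub>group_algebra G\<^esub> I"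
  for I J :: "('g \<Rightarrow> 'k::field) set"
proof -
  have "(\<exists>x y. z = x + y \<and> x \<in> I \<and> y \<in> J) \<longleftrightarrow> (\<exists>x y. z = x + y \<and> x \<in> J \<and> y \<in> I)" for z
    using add.commute by blast
  then show ?thesis unfolding set_add_alg by blast
qed

lemma summand_subset:
  assumes "ideal I (group_algebra G :: ('g \<Rightarrow> 'k::field) ring)" "ideal J (group_algebra G)"
  shows "I \<subseteq> I <+>\<^bsub>group_algebra G\<^esub> J" "J \<subseteq> I <+>\<^bsub>group_algebra G\<^esub> J"
  unfolding set_add_alg using idealD(2)[OF assms(1)] idealD(2)[OF assms(2)]
  by (metis (mono_tags, lifting) add.right_neutral mem_Collect_eq subsetI, metis (mono_tags, lifting) add.left_neutral mem_Collect_eq subsetI)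

definition complementary_ideals :: "('g \<Rightarrow> 'k::field) set \<Rightarrow> ('g \<Rightarrow> 'k) set \<Rightarrow> bool" where
  "complementary_ideals B C \<longleftrightarrow>
     ideal B (group_algebra G) \<and> ideal C (group_algebra G) \<and> B \<inter> C = {0} \<and>
     B <+>\<^bsub>group_algebra G\<^esub> C = carrier (group_algebra G)"

text \<open>
  The component in \<open>B\<close> of the identity of \<open>FG\<close> is an identity of \<open>B\<close>, since products of \<open>B\<close> and \<open>C\<close> lie
  in \<open>B \<inter> C\<close>.
\<close>

lemma ideal_identity:
  fixes B C :: "('g \<Rightarrow> 'k::field) set"
  assumes "complementary_ideals B C"
  obtains e c where "e \<in> B" "c \<in> C" "group_elem \<one> = e + c" "\<And>b. b \<in> B \<Longrightarrow> b \<star> e = b" "\<And>b. b \<in> B \<Longrightarrow> e \<star> b = b"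
    "\<And>b. b \<in> C \<Longrightarrow> b \<star> c = b"
proof -
  have B: "ideal B (group_algebra G)" and C: "ideal C (group_algebra G)" and I: "B \<inter> C = {0}"
    and S: "B <+>\<^bsub>group_algebra G\<^esub> C = carrier (group_algebra G)"
    using assms by (auto simp: complementary_ideals_def)
  have "group_elem \<one> \<in> B <+>\<^bsub>group_algebra G\<^esub> C" unfolding S by simp
  then obtain e c where ec: "e \<in> B" "c \<in> C" "group_elem \<one> = e + c" unfolding set_add_alg by blast
  have ca: "x \<in> carrier (group_algebra G)" if "x \<in> B \<or> x \<in> C" for x using that idealD(1)[OF B] idealD(1)[OF C] by blast
  have z: "x \<star> y = 0" "y \<star> x = 0" if "x \<in> B" "y \<in> C" for x y
    using idealD(4,5)[OF B that(1) ca[of y]] idealD(4,5)[OF C that(2) ca[of x]] that I by blast+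
  have "b \<star> e = b" if b: "b \<in> B" for b
  proof -
    have "b = b \<star> (e + c)" using conv_one[OF ca[of b]] b ec(3) by metis
    then show ?thesis using z(1)[OF b ec(2)] by (simp add: conv_add_right del: plus_fun_apply)
  qed
  moreover have "e \<star> b = b" if b: "b \<in> B" for b
  proof -
    have "b = (e + c) \<star> b" using one_conv[OF ca[of b]] b ec(3) by metis
    then show ?thesis using z(2)[OF b ec(2)] by (simp add: conv_add_left del: plus_fun_apply)
  qed
  moreover have "b \<star> c = b" if b: "b \<in> C" for b
  proof -
    have "b = b \<star> (e + c)" using conv_one[OF ca[of b]] b ec(3) by metis
    then show ?thesis using z(2)[OF ec(1) b] by (simp add: conv_add_right del: plus_fun_apply)
  qed
  ultimately show ?thesis using that ec by blast
qed

lemma ideal_identity_central: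
  fixes B :: "('g \<Rightarrow> 'k::field) set"
  assumes B: "ideal B (group_algebra G)" and e: "e \<in> B" "\<And>b. b \<in> B \<Longrightarrow> b \<star> e = b" "\<And>b. b \<in> B \<Longrightarrow> e \<star> b = b"
    and g: "g \<in> carrier G"
  shows "conj_elem g e = e"
proof -
  have m: "conj_elem g e \<in> B" unfolding conj_elem_def using idealD(4,5)[OF B] e g by simp
  have "e \<star> (group_elem g \<star> e) = group_elem g \<star> e" using e idealD(4)[OF B] g by simp
  then have "conj_elem g e \<star> e = group_elem (inv g) \<star> (group_elem g \<star> e)"
    by (simp add: conj_elem_def conv_assoc)
  also have "\<dots> = (group_elem (inv g) \<star> group_elem g) \<star> e" by (simp add: conv_assoc)
  also have "\<dots> = e" using g e idealD(1)[OF B] by (simp add: group_elem_mult one_conv subset_iff)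
  finally show ?thesis using e(2)[OF m] by simp
qed

end

context finite_fg_mod
begin

text \<open>
  Among the two-sided direct summands of \<open>FG\<close> whose complement annihilates \<open>M\<close>, one of minimal
  dimension is a block: if it splits as \<open>I \<oplus> J\<close>, then \<open>M\<close> is the sum of the part killed by \<open>J\<close> and the part
  killed by \<open>I\<close>, one of which is zero, so that \<open>I\<close> or \<open>J\<close> alone would do. Any other block lies in the
  complement.
\<close>

lemma block_exists:
  assumes ind: "fg_indecomposable G M"
  obtains B e where "lies_in_block G M B" "e \<in> B" "\<And>b. b \<in> B \<Longrightarrow> b \<star> e = b" "\<And>b. b \<in> B \<Longrightarrow> e \<star> b = b"
    "\<And>v. v \<in> space M \<Longrightarrow> aact v e = v"
proof -
  let ?A = "carrier (group_algebra G) :: ('g \<Rightarrow> 'k) set"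
  interpret X: fg_mod "G \<times>\<times> G" "block_module G ?A"
    using block_module_module[OF carrier_ideal] by (simp add: fg_mod_def)
  define good where "good B \<longleftrightarrow> (\<exists>C. complementary_ideals B C \<and> (\<forall>v\<in>space M. \<forall>c\<in>C. aact v c = 0))" for B
  have "good ?A"
    unfolding good_def complementary_ideals_def set_add_alg
    using carrier_ideal zero_ideal alg_zero_closed by (intro exI[of _ "{0}"]) auto
  then obtain B where gB: "good B" and min: "\<And>B'. good B' \<Longrightarrow> X.vs.dim B \<le> X.vs.dim B'"
    using ex_has_least_nat[of good ?A X.vs.dim] by blast
  obtain C where BC: "complementary_ideals B C" and MC: "\<And>v c. v \<in> space M \<Longrightarrow> c \<in> C \<Longrightarrow> aact v c = 0"
    using gB by (auto simp: good_def)
  have B: "ideal B (group_algebra G)" and C: "ideal C (group_algebra G)" and I: "B \<inter> C = {0}"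
    and S: "B <+>\<^bsub>group_algebra G\<^esub> C = ?A"
    using BC by (auto simp: complementary_ideals_def)
  obtain e c where ec: "e \<in> B" "c \<in> C" "group_elem \<one> = e + c" "\<And>b. b \<in> B \<Longrightarrow> b \<star> e = b" "\<And>b. b \<in> B \<Longrightarrow> e \<star> b = b"
    "\<And>b. b \<in> C \<Longrightarrow> b \<star> c = b"
    using ideal_identity[OF BC] by metis
  have Me: "aact v e = v" if v: "v \<in> space M" for v
    using aact_one[OF v] MC[OF v ec(2)] by (simp add: ec(3) aact_add_right del: plus_fun_apply)
  obtain m where m: "m \<in> space M" "m \<noteq> 0" using ind space_zero unfolding fg_indecomposable_def by blast
  have "is_block G B"
    unfolding is_block_def
  proof (intro conjI allI impI)
    show "ideal B (group_algebra G)" by (rule B)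
    show "B \<noteq> {0}"
    proof
      assume "B = {0}"
      then have "e = 0" using ec(1) by blast
      then show False using Me[OF m(1)] m(2) by simp
    qed
    show "\<exists>C. ideal C (group_algebra G) \<and> B \<inter> C = {0} \<and> B <+>\<^bsub>group_algebra G\<^esub> C = ?A" using C I S by blast
    fix I' J assume *: "ideal I' (group_algebra G) \<and> ideal J (group_algebra G) \<and> I' \<inter> J = {0} \<and> I' <+>\<^bsub>group_algebra G\<^esub> J = B"
    have step: "J' = {0}" if I'': "ideal I'' (group_algebra G)" and J': "ideal J' (group_algebra G)"
      and IJ: "I'' \<inter> J' = {0}" and B': "I'' <+>\<^bsub>group_algebra G\<^esub> J' = B"
      and MJ: "\<And>v x. v \<in> space M \<Longrightarrow> x \<in> J' \<Longrightarrow> aact v x = 0" for I'' J'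
    proof -
      have sub: "I'' \<subseteq> B" "J' \<subseteq> B"
      proof -
        show "I'' \<subseteq> B" "J' \<subseteq> B" using summand_subset[OF I'' J'] B' by blast+
      qed
      have "complementary_ideals I'' (J' <+>\<^bsub>group_algebra G\<^esub> C)"
        unfolding complementary_ideals_def
      proof (intro conjI I'' sum_ideal[OF J' C])
        show "I'' \<inter> (J' <+>\<^bsub>group_algebra G\<^esub> C) = {0}"
        proof (intro equalityI subsetI)
          fix x assume x: "x \<in> I'' \<inter> (J' <+>\<^bsub>group_algebra G\<^esub> C)"
          then obtain j d where jd: "j \<in> J'" "d \<in> C" "x = j + d" unfolding set_add_alg by blast
          have "x - j \<in> B" using x jd sub idealD(7)[OF B] by blast
          moreover have "x - j = d" unfolding jd(3) by (rule add_diff_cancel_left')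
          ultimately have "d = 0" using jd I by blast
          then have "x = j" using jd by (simp del: plus_fun_apply)
          then show "x \<in> {0}" using x jd IJ by blast
        next
          fix x :: "'g \<Rightarrow> 'k" assume "x \<in> {0}"
          then show "x \<in> I'' \<inter> (J' <+>\<^bsub>group_algebra G\<^esub> C)"
            using idealD(2)[OF I''] idealD(2)[OF sum_ideal[OF J' C]] by blast
        qed
        show "I'' <+>\<^bsub>group_algebra G\<^esub> (J' <+>\<^bsub>group_algebra G\<^esub> C) = ?A"
          unfolding S[symmetric] B'[symmetric] set_add_alg
        proof (intro equalityI subsetI)
          fix x assume "x \<in> {x + y |x y. x \<in> I'' \<and> y \<in> {x + y |x y. x \<in> J' \<and> y \<in> C}}"
          then obtain i j d where "i \<in> I''" "j \<in> J'" "d \<in> C" "x = i + (j + d)" by blast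
          moreover from this have "x = (i + j) + d" by (simp only: add.assoc)
          ultimately show "x \<in> {x + y |x y. x \<in> {x + y |x y. x \<in> I'' \<and> y \<in> J'} \<and> y \<in> C}"
            by blast
        next
          fix x assume "x \<in> {x + y |x y. x \<in> {x + y |x y. x \<in> I'' \<and> y \<in> J'} \<and> y \<in> C}"
          then obtain i j d where "i \<in> I''" "j \<in> J'" "d \<in> C" "x = (i + j) + d" by blast
          moreover from this have "x = i + (j + d)" by (simp only: add.assoc)
          ultimately show "x \<in> {x + y |x y. x \<in> I'' \<and> y \<in> {x + y |x y. x \<in> J' \<and> y \<in> C}}"
            by blast
        qed
      qed
      moreover have "aact v x = 0" if v: "v \<in> space M" and x: "x \<in> J' <+>\<^bsub>group_algebra G\<^esub> C" for v x
      proof -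
        obtain j d where "j \<in> J'" "d \<in> C" "x = j + d" using x unfolding set_add_alg by blast
        then show ?thesis using MJ[OF v] MC[OF v] by (simp add: aact_add_right del: plus_fun_apply)
      qed
      ultimately have "good I''" unfolding good_def by blast
      then have le: "X.vs.dim B \<le> X.vs.dim I''" by (rule min)
      have "fg_submodule (G \<times>\<times> G) (block_module G ?A) I''" "fg_submodule (G \<times>\<times> G) (block_module G ?A) B"
        unfolding fg_submodule_block_module[OF carrier_ideal] using I'' B idealD(1)[OF I''] idealD(1)[OF B] by blast+
      then have "I'' = B" using X.submodule_eq_of_dim_le sub(1) le by blast
      then show "J' = {0}" using sub(2) IJ idealD(2)[OF J'] by blast
    qed
    define N where "N J = {v \<in> space M. \<forall>x\<in>J. aact v x = 0}" for J
    have subm: "fg_submodule G M (N J')" if J': "ideal J' (group_algebra G)" for J'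
      unfolding fg_submodule_def vs.subspace_def
    proof (intro conjI ballI allI)
      fix u g assume u: "u \<in> N J'" and g: "g \<in> carrier G"
      have "aact (act M u g) x = 0" if x: "x \<in> J'" for x
      proof -
        have "aact (act M u g) x = aact u (group_elem g \<star> x)"
          using u g by (simp add: aact_conv aact_group_elem N_def)
        then show ?thesis using u x idealD(4)[OF J' x] g by (simp add: N_def)
      qed
      then show "act M u g \<in> N J'" using u g by (simp add: N_def)
    qed (auto simp: N_def aact_add_left aact_scale_left)
    have "fg_direct_sum G M (N J) (N I')"
      unfolding fg_direct_sum_def
    proof (intro conjI subm)
      show "ideal J (group_algebra G)" "ideal I' (group_algebra G)" using * by auto
      have "e \<in> I' <+>\<^bsub>group_algebra G\<^esub> J" using * ec(1) by blast
      then obtain i j where ij: "i \<in> I'" "j \<in> J" "e = i + j" unfolding set_add_alg by blast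
      have z: "x \<star> y = 0" "y \<star> x = 0" if "x \<in> I'" "y \<in> J" for x y
      proof -
        have c: "x \<in> ?A" "y \<in> ?A" using that * idealD(1) by blast+
        have "x \<star> y \<in> I'" "y \<star> x \<in> I'" using * that(1) c(2) idealD(4,5) by blast+
        moreover have "x \<star> y \<in> J" "y \<star> x \<in> J" using * that(2) c(1) idealD(4,5) by blast+
        ultimately show "x \<star> y = 0" "y \<star> x = 0" using * by blast+
      qed
      have ve: "aact v i + aact v j = v" if "v \<in> space M" for v
        using Me[OF that] unfolding ij(3) aact_add_right .
      show "N J \<inter> N I' = {0}"
        using ve ij(1,2) by (auto simp: N_def) (metis add.right_neutral)
      show "space M = {u + w |u w. u \<in> N J \<and> w \<in> N I'}"
      proof (intro equalityI subsetI)
        fix v assume v: "v \<in> space M"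
        have "aact v i \<in> N J" "aact v j \<in> N I'"
          using v z ij(1,2) by (auto simp: N_def aact_conv[symmetric])
        then show "v \<in> {u + w |u w. u \<in> N J \<and> w \<in> N I'}" using ve[OF v, symmetric] by blast
      qed (auto simp: N_def)
    qed
    then have ds: "N J = {0} \<or> N I' = {0}" "space M = {u + w |u w. u \<in> N J \<and> w \<in> N I'}"
      using ind unfolding fg_indecomposable_def by (blast, simp add: fg_direct_sum_def)
    have swap: "J <+>\<^bsub>group_algebra G\<^esub> I' = B"
      using * set_add_alg_commute by metis
    show "I' = {0} \<or> J = {0}"
      using ds(1)
    proof
      assume "N J = {0}"
      then have "space M \<subseteq> N I'" using ds(2) by auto
      then have "I' = {0}" using * swap by (intro step[of J I']) (auto simp: N_def)
      then show ?thesis ..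
    next
      assume "N I' = {0}"
      then have "space M \<subseteq> N J" using ds(2) by auto
      then have "J = {0}" using * by (intro step[of I' J]) (auto simp: N_def)
      then show ?thesis ..
    qed
  qed
  moreover have "module.span (scale M) {aact v b |v b. v \<in> space M \<and> b \<in> B} = space M"
  proof (intro equalityI)
    show "module.span (scale M) {aact v b |v b. v \<in> space M \<and> b \<in> B} \<subseteq> space M"
      by (rule vs.span_minimal[OF _ subspace_space]) auto
    have "v \<in> {aact v b |v b. v \<in> space M \<and> b \<in> B}" if "v \<in> space M" for v
      using Me[OF that, symmetric] that ec(1) by blast
    then show "space M \<subseteq> module.span (scale M) {aact v b |v b. v \<in> space M \<and> b \<in> B}"
      using vs.span_superset by blast
  qed
  moreover have "aact v b = 0" if B': "is_block G B'" "B' \<noteq> B" and v: "v \<in> space M" and b: "b \<in> B'" for B' v b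
  proof -
    obtain C' where BC': "complementary_ideals B' C'"
      using B'(1) by (auto simp: is_block_def complementary_ideals_def)
    have I': "ideal B' (group_algebra G)" and IC': "ideal C' (group_algebra G)" and int': "B' \<inter> C' = {0}"
      using BC' by (auto simp: complementary_ideals_def)
    have split: "Y = (Y \<inter> I1) <+>\<^bsub>group_algebra G\<^esub> (Y \<inter> I2)"
      if Y: "ideal Y (group_algebra G)" and I12: "complementary_ideals I1 I2" for Y I1 I2 :: "('g \<Rightarrow> 'k) set"
    proof -
      have id: "ideal I1 (group_algebra G)" "ideal I2 (group_algebra G)" using I12 by (auto simp: complementary_ideals_def)
      obtain e1 e2 where e12: "e1 \<in> I1" "e2 \<in> I2" "group_elem \<one> = e1 + e2"
        using ideal_identity[OF I12] by metis
      have ca: "e1 \<in> ?A" "e2 \<in> ?A" using e12 id idealD(1) by blast+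
      show ?thesis
        unfolding set_add_alg
      proof (intro equalityI subsetI)
        fix y assume y: "y \<in> Y"
        then have yA: "y \<in> ?A" using idealD(1)[OF Y] by blast
        have "y = y \<star> e1 + y \<star> e2" using conv_one[OF yA] unfolding e12(3) conv_add_right by simp
        moreover have "y \<star> e1 \<in> Y \<inter> I1" "y \<star> e2 \<in> Y \<inter> I2"
          using idealD(5)[OF Y y] idealD(4)[OF id(1) e12(1) yA] idealD(4)[OF id(2) e12(2) yA] ca by blast+
        ultimately show "y \<in> {x + z |x z. x \<in> Y \<inter> I1 \<and> z \<in> Y \<inter> I2}" by blast
      next
        fix y assume "y \<in> {x + z |x z. x \<in> Y \<inter> I1 \<and> z \<in> Y \<inter> I2}"
        then show "y \<in> Y" using idealD(3)[OF Y] by blast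
      qed
    qed
    have blk: "\<And>I J. ideal I (group_algebra G) \<Longrightarrow> ideal J (group_algebra G) \<Longrightarrow> I \<inter> J = {0} \<Longrightarrow>
        Y = I <+>\<^bsub>group_algebra G\<^esub> J \<Longrightarrow> I = {0} \<or> J = {0}" if "is_block G Y" for Y :: "('g \<Rightarrow> 'k) set"
      using that unfolding is_block_def by blast
    have "0 \<in> B'" "0 \<in> B" "0 \<in> C" "0 \<in> C'" using idealD(2) I' B C IC' by blast+
    then have "B' \<inter> B = {0} \<or> B' \<inter> C = {0}"
      using blk[OF B'(1) inter_ideal[OF I' B] inter_ideal[OF I' C] _ split[OF I' BC]] I by blast
    then consider "B' \<inter> B = {0}" | "B' \<inter> C = {0}" by blast
    then have "B' \<subseteq> C"
    proof cases
      case 1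
      then have "B' = {0} <+>\<^bsub>group_algebra G\<^esub> (B' \<inter> C)" using split[OF I' BC] by simp
      then show ?thesis unfolding set_add_alg by auto
    next
      case 2
      then have "B' = (B' \<inter> B) <+>\<^bsub>group_algebra G\<^esub> {0}" using split[OF I' BC] by simp
      then have "B' \<subseteq> B" unfolding set_add_alg by auto
      moreover have "B \<inter> B' = {0} \<or> B \<inter> C' = {0}"
        using blk[OF \<open>is_block G B\<close> inter_ideal[OF B I'] inter_ideal[OF B IC'] _ split[OF B BC']] int'
          \<open>0 \<in> B'\<close> \<open>0 \<in> B\<close> \<open>0 \<in> C'\<close> by blast
      moreover have "B' \<noteq> {0}" using B'(1) by (simp add: is_block_def)
      ultimately have "B \<inter> C' = {0}" by blast
      then have "B = (B \<inter> B') <+>\<^bsub>group_algebra G\<^esub> {0}" using split[OF B BC'] by simp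
      then have "B \<subseteq> B'" unfolding set_add_alg by auto
      then show ?thesis using \<open>B' \<subseteq> B\<close> B'(2) by blast
    qed
    then show ?thesis using MC[OF v] b by blast
  qed
  ultimately have "lies_in_block G M B" unfolding lies_in_block_def by blast
  then show ?thesis using that ec Me by blast
qed

end

section \<open>Relative projectivity of a block and of its modules\<close>

context group
begin

lemma inv_cancel_left:
  "g \<in> carrier G \<Longrightarrow> x \<in> carrier G \<Longrightarrow> inv g \<otimes> (g \<otimes> x) = x"
  "g \<in> carrier G \<Longrightarrow> x \<in> carrier G \<Longrightarrow> g \<otimes> (inv g \<otimes> x) = x"
  by (simp_all add: m_assoc[symmetric])

end

context finite_fg_mod
begin

lemma act_aact_conj:
  assumes "v \<in> space M" "g \<in> carrier G"
  shows "act M (aact (act M v (inv g)) a) g = aact v (conj_elem g a)"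
  using assms by (simp add: conj_elem_def aact_conv aact_group_elem)

lemma aact_conj_invariant_hom:
  assumes H: "subgroup H G" and a: "\<And>h. h \<in> H \<Longrightarrow> conj_elem h a = a"
  shows "fg_hom (G\<lparr>carrier := H\<rparr>) M M (\<lambda>v. aact v a)"
proof (rule fg_homI)
  fix v h assume v: "v \<in> space M" and h: "h \<in> carrier (G\<lparr>carrier := H\<rparr>)"
  then have hc: "h \<in> carrier G" using subgroup.subset[OF H] by auto
  have "a \<star> group_elem h = group_elem h \<star> a" using h by (intro conj_elem_commute[OF hc a]) simp
  then have "aact v (a \<star> group_elem h) = aact v (group_elem h \<star> a)" by simp
  then show "aact (act M v h) a = act M (aact v a) h" using v hc by (simp add: aact_conv aact_group_elem)
qed (simp_all add: aact_add_left aact_scale_left)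

text \<open>
  The transfer of the endomorphism \<open>v \<mapsto> v a\<close> is \<open>v \<mapsto> v z\<close>, where \<open>z\<close> is the transfer of \<open>a\<close>.
\<close>

lemma rel_projective_of_transfer:
  assumes H: "subgroup H G" and a: "\<And>h. h \<in> H \<Longrightarrow> conj_elem h a = a"
    and T: "right_transversal G H T" and c: "c \<noteq> 0"
    and Tr: "\<And>v. v \<in> space M \<Longrightarrow> (\<Sum>t\<in>T. aact v (conj_elem t a)) = scale M c v"
  shows "rel_projective G H M"
proof (rule rel_projectiveI[OF H _ T])
  have Tc: "T \<subseteq> carrier G" using T by (simp add: right_transversal_def)
  note h = aact_conj_invariant_hom[OF H a]
  show "fg_hom (G\<lparr>carrier := H\<rparr>) M M (\<lambda>v. scale M (inverse c) (aact v a))"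
    using fg_homD[OF h] subgroup.subset[OF H]
    by (intro fg_homI) (auto simp: vs.scale_right_distrib act_scale aact_add_left aact_scale_left mult.commute subset_iff)
  fix v assume v: "v \<in> space M"
  have "act M (scale M (inverse c) (aact (act M v (inv t)) a)) t = scale M (inverse c) (aact v (conj_elem t a))"
    if "t \<in> T" for t
    using that v Tc act_aact_conj[OF v, of t a] by (simp add: act_scale subset_iff)
  then show "(\<Sum>t\<in>T. act M (scale M (inverse c) (aact (act M v (inv t)) a)) t) = v"
    using Tr[OF v] c by (simp add: vs.scale_sum_right[symmetric])
qed

lemma transfer_central:
  assumes H: "subgroup H G" and a: "\<And>h. h \<in> H \<Longrightarrow> conj_elem h a = a"
    and T: "right_transversal G H T" and g: "g \<in> carrier G"
  shows "conj_elem g (\<Sum>t\<in>T. conj_elem t a) = (\<Sum>t\<in>T. conj_elem t (a :: 'g \<Rightarrow> 'k))"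
proof -
  have Tc: "T \<subseteq> carrier G" using T by (simp add: right_transversal_def)
  have Hc: "H \<subseteq> carrier G" using H by (rule subgroup.subset)
  have "conj_elem g (\<Sum>t\<in>T. conj_elem t a) = (\<Sum>t\<in>T. conj_elem (t \<otimes> g) a)"
    unfolding conj_elem_sum using Tc g by (intro sum.cong) (auto simp: conj_elem_mult subset_iff)
  also have "\<dots> = (\<Sum>t\<in>T. conj_elem t a)"
  proof (rule transversal_sum_translate[OF H T g])
    fix q x assume "q \<in> H" "x \<in> carrier G"
    then show "conj_elem (q \<otimes> x) a = conj_elem x a"
      using a[of q] conj_elem_mult[of q x a] Hc by auto
  qed
  finally show ?thesis .
qed

text \<open>
  Multiplication by the transfer \<open>z\<close> of \<open>a\<close> is an endomorphism of the bimodule \<open>B\<close>. It is not nilpotent,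
  since \<open>z\<close> acts on \<open>M\<close> by the nonzero scalar \<open>c\<close>, so by Fitting's lemma there is \<open>u\<close> in \<open>B\<close> with \<open>z u = e\<close>.
  This \<open>u\<close> is central, and the transfer of \<open>a u\<close> is \<open>e\<close>. The endomorphism that shows the relative
  projectivity is \<open>x \<mapsto> x(1) a u\<close>: its transfer to \<open>G \<times> G\<close> is \<open>x \<mapsto> \<Sum>g. x(g) e g = e x = x\<close>.
\<close>

lemma block_projective_of_transfer:
  assumes ind: "fg_indecomposable G M" and B: "is_block G B"
    and e: "e \<in> B" "\<And>b. b \<in> B \<Longrightarrow> b \<star> e = b" "\<And>b. b \<in> B \<Longrightarrow> e \<star> b = b"
    and Me: "\<And>v. v \<in> space M \<Longrightarrow> aact v e = v"
    and H: "subgroup H G" and a: "\<And>h. h \<in> H \<Longrightarrow> conj_elem h a = a"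
    and T: "right_transversal G H T" and c: "c \<noteq> 0"
    and Tr: "\<And>v. v \<in> space M \<Longrightarrow> (\<Sum>t\<in>T. aact v (conj_elem t a)) = scale M c v"
  shows "rel_projective (G \<times>\<times> G) {(h, h) | h. h \<in> H} (block_module G B)"
proof -
  have I: "ideal B (group_algebra G)" using B by (simp add: is_block_def)
  note BD = idealD[OF I]
  interpret GG: finite_group "G \<times>\<times> G" by (rule prod_finite_group)
  interpret X: fg_mod "G \<times>\<times> G" "block_module G B"
    using block_module_module[OF I] by (simp add: fg_mod_def)
  have Tc: "T \<subseteq> carrier G" using T by (simp add: right_transversal_def)
  have Hc: "H \<subseteq> carrier G" using H by (rule subgroup.subset)
  have fT: "finite T" using Tc fin finite_subset by blast
  define z where "z = (\<Sum>t\<in>T. conj_elem t a)"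
  have zg: "z \<star> group_elem g = group_elem g \<star> z" if "g \<in> carrier G" for g
    using conj_elem_commute[OF that] transfer_central[OF H a T that] by (simp add: z_def)
  have zc: "z \<in> carrier (group_algebra G)"
    using transfer_central[OF H a T one_closed] conj_elem_closed unfolding z_def by metis
  have ec: "e \<in> carrier (group_algebra G)" using e(1) BD(1) by blast
  obtain m where m: "m \<in> space M" "m \<noteq> 0" using ind space_zero unfolding fg_indecomposable_def by blast
  define f where "f b = z \<star> b" for b
  have f: "fg_hom (G \<times>\<times> G) (block_module G B) (block_module G B) f"
  proof (rule fg_homI)
    fix b g assume b: "b \<in> space (block_module G B)" and "g \<in> carrier (G \<times>\<times> G)"
    then obtain x y where xy: "g = (x, y)" "x \<in> carrier G" "y \<in> carrier G" by auto
    have "f (act (block_module G B) b g) = (z \<star> group_elem (inv x)) \<star> b \<star> group_elem y"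
      using xy by (simp add: f_def conv_assoc)
    also have "\<dots> = act (block_module G B) (f b) g"
      using xy zg[of "inv x"] by (simp add: f_def conv_assoc)
    finally show "f (act (block_module G B) b g) = act (block_module G B) (f b) g" .
  qed (use BD(4)[OF _ zc] in \<open>simp_all add: f_def conv_add_right conv_scale_right del: plus_fun_apply\<close>)
  have zact: "aact v (z \<star> b) = scale M c (aact v b)" if v: "v \<in> space M" for v b
    using v Tr[OF v] by (simp add: aact_conv z_def aact_sum_right aact_scale_left)
  have "\<not> (\<forall>b\<in>B. (f ^^ k) b = 0)" for k
  proof -
    have "aact m ((f ^^ k) e) = scale M (c ^ k) m"
      by (induction k) (simp_all add: Me m f_def zact)
    then have "aact m ((f ^^ k) e) \<noteq> 0" using c m by simp
    then have "(f ^^ k) e \<noteq> 0" by (metis aact_zero_right)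
    then show ?thesis using e(1) by blast
  qed
  then have bij: "bij_betw f B B"
    using X.fitting[OF block_module_indecomposable[OF B] f] by auto
  then obtain u where u: "u \<in> B" "z \<star> u = e" using e(1) unfolding bij_betw_def f_def by (metis imageE)
  have uc: "conj_elem g u = u" if g: "g \<in> carrier G" for g
  proof -
    have "conj_elem g u \<in> B" using u g BD(4,5) by (simp add: conj_elem_def)
    moreover have "z \<star> conj_elem g u = conj_elem g (z \<star> u)"
      using g conj_elem_conv[OF g, of z u] transfer_central[OF H a T g] by (simp add: z_def)
    then have "z \<star> conj_elem g u = z \<star> u"
      using u ideal_identity_central[OF I e g] by simp
    ultimately show ?thesis using bij u(1) unfolding bij_betw_def f_def inj_on_def by blast
  qed
  have au: "a \<star> u \<in> B" using BD(4)[OF u(1)] a[OF subgroup.one_closed[OF H]] conj_elem_closed by metis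
  have ca: "conj_elem h (a \<star> u) = a \<star> u" if "h \<in> H" for h
    using that Hc a uc by (auto simp: conj_elem_conv)
  define \<phi> where "\<phi> x = fun_scale (x \<one>) (a \<star> u)" for x :: "'g \<Rightarrow> 'k"
  show ?thesis
  proof (rule rel_projectiveI[OF _ _ diagonal_transversal(2)[OF H T]])
    show "subgroup {(h, h) |h. h \<in> H} (G \<times>\<times> G)" using H by (simp only: diagonal_subgroup_iff)
    show "fg_hom ((G \<times>\<times> G)\<lparr>carrier := {(h, h) |h. h \<in> H}\<rparr>) (block_module G B) (block_module G B) \<phi>"
    proof (rule fg_homI)
      fix b g assume b: "b \<in> space (block_module G B)" and "g \<in> carrier ((G \<times>\<times> G)\<lparr>carrier := {(h, h) |h. h \<in> H}\<rparr>)"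
      then obtain h where h: "g = (h, h)" "h \<in> H" "h \<in> carrier G" using Hc by auto
      have "(group_elem (inv h) \<star> b \<star> group_elem h) \<one> = b \<one>"
        using h by (simp add: two_sided_apply)
      then have "\<phi> (act (block_module G B) b g) = fun_scale (b \<one>) (a \<star> u)" using h by (simp add: \<phi>_def)
      also have "\<dots> = fun_scale (b \<one>) (conj_elem h (a \<star> u))" using ca h by simp
      also have "\<dots> = act (block_module G B) (\<phi> b) g"
        using h by (simp add: \<phi>_def conj_elem_def conv_scale_left conv_scale_right)
      finally show "\<phi> (act (block_module G B) b g) = act (block_module G B) (\<phi> b) g" .
    qed (use BD(6)[OF au] in \<open>auto simp: \<phi>_def fun_scale_def fun_eq_iff algebra_simps\<close>)
    fix x assume x: "x \<in> space (block_module G B)"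
    then have xB: "x \<in> B" "x \<in> carrier (group_algebra G)" using BD(1) by auto
    let ?F = "\<lambda>s. act (block_module G B) (\<phi> (act (block_module G B) x (inv\<^bsub>G \<times>\<times> G\<^esub> s))) s"
    have F: "?F (t, t \<otimes> g) = fun_scale (x g) (conj_elem t (a \<star> u) \<star> group_elem g)" if t: "t \<in> T" and g: "g \<in> carrier G" for t g
    proof -
      have tc: "t \<in> carrier G" using t Tc by blast
      have "(group_elem t \<star> x \<star> group_elem (inv (t \<otimes> g))) \<one> = x g"
        using tc g by (simp add: two_sided_apply m_assoc[symmetric])
      then have "\<phi> (act (block_module G B) x (inv\<^bsub>G \<times>\<times> G\<^esub> (t, t \<otimes> g))) = fun_scale (x g) (a \<star> u)"
        using tc g by (simp add: \<phi>_def inv_DirProd[OF is_group is_group])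
      then show ?thesis using tc g
        by (simp add: conj_elem_def conv_scale_left conv_scale_right conv_assoc group_elem_mult)
    qed
    have "(\<Sum>s\<in>(\<lambda>(t, g). (t, t \<otimes> g)) ` (T \<times> carrier G). ?F s) = (\<Sum>t\<in>T. \<Sum>g\<in>carrier G. ?F (t, t \<otimes> g))"
      by (subst sum.reindex[OF diagonal_transversal(1)[OF H T]]) (simp add: o_def case_prod_unfold sum.cartesian_product)
    also have "\<dots> = (\<Sum>t\<in>T. \<Sum>g\<in>carrier G. fun_scale (x g) (conj_elem t (a \<star> u) \<star> group_elem g))"
      by (intro sum.cong refl F)
    also have "\<dots> = (\<Sum>t\<in>T. conj_elem t (a \<star> u) \<star> x)"
      by (rule sum.cong[OF refl], subst (2) group_elem_expand[OF xB(2)]) (simp add: conv_sum_right conv_scale_right)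
    also have "\<dots> = (\<Sum>t\<in>T. conj_elem t a) \<star> u \<star> x"
      unfolding conv_sum_left using uc Tc by (intro sum.cong) (auto simp: conj_elem_conv)
    also have "\<dots> = x" using u(2) e(3)[OF xB(1)] by (simp add: z_def)
    finally show "(\<Sum>s\<in>(\<lambda>(t, g). (t, t \<otimes> g)) ` (T \<times> carrier G). ?F s) = x" .
  qed
qed

text \<open>
  If the identity of \<open>B\<close> is the transfer of \<open>\<phi>\<close> from \<open>\<Delta>H\<close>, then evaluating at \<open>e\<close> along the transversal
  \<open>(t, t g)\<close> shows that \<open>e\<close> is the transfer from \<open>H\<close> of \<open>a = \<Sum>h. \<phi> (e h\<^sup>-\<^sup>1) h\<close>; and \<open>e\<close> acts on \<open>M\<close> as the
  identity.
\<close>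

lemma rel_projective_of_block:
  assumes I: "ideal B (group_algebra G)"
    and e: "e \<in> B" "\<And>b. b \<in> B \<Longrightarrow> b \<star> e = b" "\<And>b. b \<in> B \<Longrightarrow> e \<star> b = b"
    and Me: "\<And>v. v \<in> space M \<Longrightarrow> aact v e = v"
    and rp: "rel_projective (G \<times>\<times> G) {(h, h) | h. h \<in> H} (block_module G B)"
  shows "rel_projective G H M"
proof -
  note BD = idealD[OF I]
  interpret GG: finite_group "G \<times>\<times> G" by (rule prod_finite_group)
  interpret X: fg_mod "G \<times>\<times> G" "block_module G B"
    using block_module_module[OF I] by (simp add: fg_mod_def)
  let ?D = "{(h, h) | h. h \<in> H}"
  let ?X = "block_module G B"
  obtain \<phi> T0 where D: "subgroup ?D (G \<times>\<times> G)" and \<phi>: "fg_hom ((G \<times>\<times> G)\<lparr>carrier := ?D\<rparr>) ?X ?X \<phi>"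
    and T0: "right_transversal (G \<times>\<times> G) ?D T0"
    and id: "\<And>x. x \<in> B \<Longrightarrow> (\<Sum>s\<in>T0. act ?X (\<phi> (act ?X x (inv\<^bsub>G \<times>\<times> G\<^esub> s))) s) = x"
    using rp by (auto simp: rel_projective_def)
  have H: "subgroup H G" using D by (simp only: diagonal_subgroup_iff)
  have Hc: "H \<subseteq> carrier G" using H by (rule subgroup.subset)
  obtain T where T: "right_transversal G H T" by (rule transversal_exists[OF H])
  have Tc: "T \<subseteq> carrier G" using T by (simp add: right_transversal_def)
  have ec: "e \<in> carrier (group_algebra G)" using e(1) BD(1) by blast
  have eg: "e \<star> group_elem g = group_elem g \<star> e" if "g \<in> carrier G" for g
    using conj_elem_commute[OF that ideal_identity_central[OF I e that]] .
  define a where "a = (\<Sum>h\<in>carrier G. \<phi> (e \<star> group_elem (inv h)) \<star> group_elem h)"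
  have eB: "e \<star> group_elem g \<in> B" if "g \<in> carrier G" for g using BD(5)[OF e(1)] that by simp
  have \<phi>h: "\<phi> (conj_elem h x) = conj_elem h (\<phi> x)" if "x \<in> B" "h \<in> H" for x h
    using fg_homD(4)[OF \<phi>, of x "(h, h)"] that by (simp add: conj_elem_def)
  have a: "conj_elem h a = a" if h: "h \<in> H" for h
  proof -
    have hc: "h \<in> carrier G" using h Hc by blast
    have ce: "conj_elem h (group_elem g :: 'g \<Rightarrow> 'k) = group_elem (inv h \<otimes> g \<otimes> h)" if "g \<in> carrier G" for g
      using that hc by (simp add: conj_elem_def group_elem_mult)
    have "conj_elem h a = (\<Sum>g\<in>carrier G. \<phi> (e \<star> group_elem (inv (inv h \<otimes> g \<otimes> h))) \<star> group_elem (inv h \<otimes> g \<otimes> h))"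
      unfolding a_def conj_elem_sum
    proof (rule sum.cong[OF refl])
      fix g assume g: "g \<in> carrier G"
      have "conj_elem h (\<phi> (e \<star> group_elem (inv g)) \<star> group_elem g)
          = \<phi> (conj_elem h (e \<star> group_elem (inv g))) \<star> conj_elem h (group_elem g)"
        unfolding \<phi>h[OF eB[OF inv_closed[OF g]] h] by (rule conj_elem_conv[OF hc])
      also have "conj_elem h (e \<star> group_elem (inv g)) = e \<star> group_elem (inv (inv h \<otimes> g \<otimes> h))"
        using g hc ce ideal_identity_central[OF I e hc]
        by (simp add: conj_elem_conv inv_mult_group m_assoc)
      finally show "conj_elem h (\<phi> (e \<star> group_elem (inv g)) \<star> group_elem g)
          = \<phi> (e \<star> group_elem (inv (inv h \<otimes> g \<otimes> h))) \<star> group_elem (inv h \<otimes> g \<otimes> h)"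
        using ce[OF g] by simp
    qed
    also have "\<dots> = a"
      unfolding a_def
      by (rule sum.reindex_bij_witness[where i = "\<lambda>g. h \<otimes> g \<otimes> inv h" and j = "\<lambda>g. inv h \<otimes> g \<otimes> h"])
        (use hc in \<open>auto simp: m_assoc inv_cancel_left\<close>)
    finally show ?thesis .
  qed
  let ?F = "\<lambda>s. act ?X (\<phi> (act ?X e (inv\<^bsub>G \<times>\<times> G\<^esub> s))) s"
  have F: "?F (t, t \<otimes> g) = conj_elem t (\<phi> (e \<star> group_elem (inv (t \<otimes> g \<otimes> inv t))) \<star> group_elem (t \<otimes> g \<otimes> inv t))"
    if t: "t \<in> T" and g: "g \<in> carrier G" for t g
  proof -
    have tc: "t \<in> carrier G" using t Tc by blast
    have "act ?X e (inv\<^bsub>G \<times>\<times> G\<^esub> (t, t \<otimes> g)) = (group_elem t \<star> e) \<star> group_elem (inv (t \<otimes> g))"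
      using tc g by (simp add: inv_DirProd[OF is_group is_group])
    also have "\<dots> = e \<star> group_elem (inv (t \<otimes> g \<otimes> inv t))"
      using tc g by (simp add: eg[symmetric] conv_assoc group_elem_mult inv_mult_group m_assoc)
    finally have "?F (t, t \<otimes> g) = group_elem (inv t) \<star> \<phi> (e \<star> group_elem (inv (t \<otimes> g \<otimes> inv t))) \<star> group_elem (t \<otimes> g)"
      by simp
    also have "group_elem (t \<otimes> g) = group_elem (t \<otimes> g \<otimes> inv t) \<star> (group_elem t :: 'g \<Rightarrow> 'k)"
      using tc g by (simp add: group_elem_mult m_assoc)
    finally show ?thesis by (simp add: conj_elem_def conv_assoc)
  qed
  have "(\<Sum>s\<in>T0. ?F s) = (\<Sum>s\<in>(\<lambda>(t, g). (t, t \<otimes> g)) ` (T \<times> carrier G). ?F s)"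
    by (rule GG.transversal_sum_cong[OF D T0 diagonal_transversal(2)[OF H T]])
      (rule X.transfer_term_invariant[OF D \<phi>], use e(1) in auto)
  also have "\<dots> = (\<Sum>t\<in>T. \<Sum>g\<in>carrier G. ?F (t, t \<otimes> g))"
    by (subst sum.reindex[OF diagonal_transversal(1)[OF H T]]) (simp add: o_def case_prod_unfold sum.cartesian_product)
  also have "\<dots> = (\<Sum>t\<in>T. conj_elem t a)"
  proof (rule sum.cong[OF refl])
    fix t assume t: "t \<in> T"
    have tc: "t \<in> carrier G" using t Tc by blast
    have "(\<Sum>g\<in>carrier G. ?F (t, t \<otimes> g)) = (\<Sum>g\<in>carrier G. conj_elem t (\<phi> (e \<star> group_elem (inv (t \<otimes> g \<otimes> inv t))) \<star> group_elem (t \<otimes> g \<otimes> inv t)))"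
      by (intro sum.cong refl F[OF t])
    also have "\<dots> = (\<Sum>h\<in>carrier G. conj_elem t (\<phi> (e \<star> group_elem (inv h)) \<star> group_elem h))"
      by (rule sum.reindex_bij_witness[where i = "\<lambda>g. inv t \<otimes> g \<otimes> t" and j = "\<lambda>g. t \<otimes> g \<otimes> inv t"])
        (use tc in \<open>auto simp: m_assoc inv_cancel_left inv_mult_group\<close>)
    finally show "(\<Sum>g\<in>carrier G. ?F (t, t \<otimes> g)) = conj_elem t a" by (simp add: a_def conj_elem_sum)
  qed
  finally have tr: "(\<Sum>t\<in>T. conj_elem t a) = e" using id[OF e(1)] by simp
  show ?thesis
  proof (rule rel_projective_of_transfer[OF H a T, where c = 1])
    fix v assume "v \<in> space M"
    then show "(\<Sum>t\<in>T. aact v (conj_elem t a)) = scale M 1 v"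
      using Me tr by (simp add: aact_sum_right[symmetric])
  qed auto
qed

end

section \<open>A criterion for vertices to be defect groups\<close>

context finite_fg_mod
begin

text \<open>
  Passing from \<open>H\<close> to a subgroup \<open>P\<close> multiplies the transfer of \<open>a\<close> by the index of \<open>P\<close> in \<open>H\<close>, which will
  be prime to \<open>p\<close>.
\<close>

lemma transfer_restrict:
  assumes P: "subgroup P G" and H: "subgroup H G" and PH: "P \<subseteq> H"
    and T1: "right_transversal (G\<lparr>carrier := H\<rparr>) P T1"
    and a: "\<And>h. h \<in> H \<Longrightarrow> conj_elem h a = a"
    and T: "right_transversal G H T"
    and Tr: "\<And>v. v \<in> space M \<Longrightarrow> (\<Sum>t\<in>T. aact v (conj_elem t a)) = scale M c v"
  obtains T' where "right_transversal G P T'"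
    "\<And>v. v \<in> space M \<Longrightarrow> (\<Sum>t\<in>T'. aact v (conj_elem t a)) = scale M (of_nat (card T1) * c) v"
proof -
  let ?T = "(\<lambda>(x, y). x \<otimes> y) ` (T1 \<times> T)"
  note T' = transversal_product[OF P H PH T1 T]
  have T1H: "T1 \<subseteq> H" using T1 by (simp add: right_transversal_def)
  have Hc: "H \<subseteq> carrier G" using H by (rule subgroup.subset)
  have Tc: "T \<subseteq> carrier G" using T by (simp add: right_transversal_def)
  have "(\<Sum>t\<in>?T. aact v (conj_elem t a)) = scale M (of_nat (card T1) * c) v" if v: "v \<in> space M" for v
  proof -
    have "(\<Sum>t\<in>?T. aact v (conj_elem t a)) = (\<Sum>(x, y)\<in>T1 \<times> T. aact v (conj_elem (x \<otimes> y) a))"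
      by (subst sum.reindex[OF T'(1)]) (simp add: o_def case_prod_unfold)
    also have "\<dots> = (\<Sum>(x, y)\<in>T1 \<times> T. aact v (conj_elem y a))"
    proof (rule sum.cong[OF refl], clarify)
      fix x y assume "x \<in> T1" "y \<in> T"
      then show "aact v (conj_elem (x \<otimes> y) a) = aact v (conj_elem y a)"
        using conj_elem_mult[of x y a] a[of x] T1H Hc Tc by (simp add: subset_iff)
    qed
    also have "\<dots> = (\<Sum>x\<in>T1. scale M c v)"
      using Tr[OF v] by (simp add: sum.cartesian_product[symmetric])
    also have "\<dots> = scale M (of_nat (card T1) * c) v"
      by (simp add: vs.sum_constant_scale)
    finally show ?thesis .
  qed
  then show ?thesis using that T'(2) by blast
qed

text \<open>
  The subgroup \<open>P\<close> stands for a Sylow \<open>p\<close>-subgroup of \<open>H\<close>: as its index in \<open>H\<close> is nonzero in the field, the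
  transfer of \<open>a\<close> from \<open>P\<close> is still a nonzero scalar on \<open>M\<close>. The bound \<open>min\<close> transfers from \<open>M\<close> to the block by
  \<open>rel_projective_of_block\<close>, so the vertices of \<open>M\<close> and the defect groups of \<open>B\<close> are both the conjugates of \<open>P\<close>.
\<close>

theorem vertices_are_defect_groups:
  assumes ind: "fg_indecomposable G M"
    and P: "subgroup P G" and H: "subgroup H G" and PH: "P \<subseteq> H"
    and T1: "right_transversal (G\<lparr>carrier := H\<rparr>) P T1" and nz: "(of_nat (card T1) :: 'k) \<noteq> 0"
    and a: "\<And>h. h \<in> H \<Longrightarrow> conj_elem h a = a"
    and T: "right_transversal G H T" and c: "c \<noteq> 0"
    and Tr: "\<And>v. v \<in> space M \<Longrightarrow> (\<Sum>t\<in>T. aact v (conj_elem t a)) = scale M c v"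
    and min: "\<And>R. rel_projective G R M \<Longrightarrow> \<exists>g\<in>carrier G. \<forall>h\<in>P. g \<otimes> h \<otimes> inv g \<in> R"
  shows "\<exists>B. lies_in_block G M B \<and> (\<exists>Q. is_vertex G M Q) \<and> (\<exists>D. is_defect_group G B D) \<and>
    (\<forall>Q D. is_vertex G M Q \<and> is_defect_group G B D \<longrightarrow> conjugate_subgroups G Q D)"
proof -
  have "\<exists>B e. lies_in_block G M B \<and> e \<in> B \<and> (\<forall>b\<in>B. b \<star> e = b) \<and> (\<forall>b\<in>B. e \<star> b = b) \<and>
      (\<forall>v\<in>space M. aact v e = v)"
    by (rule block_exists[OF ind]) blast
  then obtain B e where lb: "lies_in_block G M B" and e: "e \<in> B" "\<And>b. b \<in> B \<Longrightarrow> b \<star> e = b" "\<And>b. b \<in> B \<Longrightarrow> e \<star> b = b"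
    and Me: "\<And>v. v \<in> space M \<Longrightarrow> aact v e = v"
    by blast
  have B: "is_block G B" using lb by (simp add: lies_in_block_def)
  have I: "ideal B (group_algebra G)" using B by (simp add: is_block_def)
  have "\<exists>T'. right_transversal G P T' \<and>
      (\<forall>v\<in>space M. (\<Sum>t\<in>T'. aact v (conj_elem t a)) = scale M (of_nat (card T1) * c) v)"
    by (rule transfer_restrict[OF P H PH T1 a T Tr]) blast+
  then obtain T' where T': "right_transversal G P T'"
    and Tr': "\<And>v. v \<in> space M \<Longrightarrow> (\<Sum>t\<in>T'. aact v (conj_elem t a)) = scale M (of_nat (card T1) * c) v"
    by blast
  have aP: "\<And>h. h \<in> P \<Longrightarrow> conj_elem h a = a" using a PH by blast
  have c': "of_nat (card T1) * c \<noteq> 0" using nz c by simp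
  let ?X = "block_module G B"
  let ?\<Delta> = "\<lambda>R. {(h, h) | h. h \<in> R}"
  have MP: "rel_projective G P M" by (rule rel_projective_of_transfer[OF P aP T' c' Tr'])
  have BP: "rel_projective (G \<times>\<times> G) (?\<Delta> P) ?X"
    by (rule block_projective_of_transfer[OF ind B e Me P aP T' c' Tr'])
  have BM: "rel_projective G R M" if "rel_projective (G \<times>\<times> G) (?\<Delta> R) ?X" for R
    using rel_projective_of_block[OF I e Me that] .
  interpret GG: finite_group "G \<times>\<times> G" by (rule prod_finite_group)
  interpret X: fg_mod "G \<times>\<times> G" ?X using block_module_module[OF I] by (simp add: fg_mod_def)
  note Xiff = X.summand_of_induced_iff[OF GG.fin block_module_indecomposable[OF B]]
  note vM = vertex_iff_conjugate[OF fin ind MP min]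
  have Pc: "P \<subseteq> carrier G" using P by (rule subgroup.subset)
  have fP: "finite P" using Pc fin finite_subset by blast
  have inj: "inj_on (\<lambda>h. g \<otimes> h \<otimes> inv g) P" if "g \<in> carrier G" for g
    by (rule inj_onI) (use that Pc in \<open>auto simp: subset_iff\<close>)
  have D1: "is_defect_group G B P"
    unfolding is_defect_group_def is_vertex_def
  proof (intro conjI allI impI notI P)
    show "summand_of_induced (G \<times>\<times> G) ?X (?\<Delta> P)" by (rule iffD2[OF Xiff BP])
    fix R assume R: "R \<subset> ?\<Delta> P" "summand_of_induced (G \<times>\<times> G) ?X R"
    define R' where "R' = {h. (h, h) \<in> R}"
    have RR: "R = ?\<Delta> R'" using R(1) by (auto simp: R'_def)
    have "rel_projective (G \<times>\<times> G) (?\<Delta> R') ?X" using iffD1[OF Xiff R(2)] unfolding RR .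
    then have "rel_projective G R' M" by (rule BM)
    then obtain g where g: "g \<in> carrier G" "\<forall>h\<in>P. g \<otimes> h \<otimes> inv g \<in> R'" using min by blast
    have "R' \<subset> P" using R(1) by (auto simp: R'_def)
    then have "card R' < card P" "finite R'" using fP psubset_card_mono finite_subset by blast+
    moreover have "card ((\<lambda>h. g \<otimes> h \<otimes> inv g) ` P) \<le> card R'" using g(2) \<open>finite R'\<close> by (intro card_mono) auto
    ultimately show False using card_image[OF inj[OF g(1)]] by simp
  qed
  have conj\<Delta>: "(\<lambda>x. (g, g) \<otimes>\<^bsub>G \<times>\<times> G\<^esub> x \<otimes>\<^bsub>G \<times>\<times> G\<^esub> inv\<^bsub>G \<times>\<times> G\<^esub> (g, g)) ` ?\<Delta> P = ?\<Delta> ((\<lambda>h. g \<otimes> h \<otimes> inv g) ` P)"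
    if "g \<in> carrier G" for g
    using that by (auto simp: inv_DirProd[OF is_group is_group] image_iff)
  have D2: "\<exists>g\<in>carrier G. D = (\<lambda>h. g \<otimes> h \<otimes> inv g) ` P" if D: "is_defect_group G B D" for D
  proof -
    have v: "is_vertex (G \<times>\<times> G) ?X (?\<Delta> D)" using D by (simp add: is_defect_group_def)
    then have "summand_of_induced (G \<times>\<times> G) ?X (?\<Delta> D)" unfolding is_vertex_def by (rule conjunct1)
    then have "rel_projective G D M" by (intro BM iffD1[OF Xiff])
    then obtain g where g: "g \<in> carrier G" "\<forall>h\<in>P. g \<otimes> h \<otimes> inv g \<in> D" using min by blast
    have "rel_projective (G \<times>\<times> G) (?\<Delta> ((\<lambda>h. g \<otimes> h \<otimes> inv g) ` P)) ?X"
      using X.rel_projective_conjugate[OF BP, of "(g, g)"] g(1) conj\<Delta>[OF g(1)] by simp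
    then have "summand_of_induced (G \<times>\<times> G) ?X (?\<Delta> ((\<lambda>h. g \<otimes> h \<otimes> inv g) ` P))" by (rule iffD2[OF Xiff])
    then have "\<not> ?\<Delta> ((\<lambda>h. g \<otimes> h \<otimes> inv g) ` P) \<subset> ?\<Delta> D"
      using v unfolding is_vertex_def by blast
    moreover have "?\<Delta> ((\<lambda>h. g \<otimes> h \<otimes> inv g) ` P) \<subseteq> ?\<Delta> D" using g(2) by blast
    ultimately have "?\<Delta> ((\<lambda>h. g \<otimes> h \<otimes> inv g) ` P) = ?\<Delta> D" by blast
    then have "D = (\<lambda>h. g \<otimes> h \<otimes> inv g) ` P" by blast
    then show ?thesis using g(1) by blast
  qed
  have V1: "is_vertex G M P"
    using vM Pc by (auto intro!: bexI[of _ \<one>] simp: image_iff subset_iff)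
  have "conjugate_subgroups G Q D" if Q: "is_vertex G M Q" and D: "is_defect_group G B D" for Q D
  proof -
    obtain x where x: "x \<in> carrier G" "Q = (\<lambda>h. x \<otimes> h \<otimes> inv x) ` P" using vM Q by blast
    obtain g where g: "g \<in> carrier G" "D = (\<lambda>h. g \<otimes> h \<otimes> inv g) ` P" using D2[OF D] by blast
    let ?k = "g \<otimes> inv x"
    have "inv ?k \<otimes> (g \<otimes> h \<otimes> inv g) \<otimes> ?k = x \<otimes> h \<otimes> inv x" if "h \<in> P" for h
      using that Pc x(1) g(1) by (auto simp: inv_mult_group m_assoc inv_cancel_left subset_iff)
    then have "Q = (\<lambda>d. inv ?k \<otimes> d \<otimes> ?k) ` D" unfolding x(2) g(2) image_image by (intro image_cong) auto
    moreover have "?k \<in> carrier G" using x g by simp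
    ultimately show ?thesis unfolding conjugate_subgroups_def by blast
  qed
  then show ?thesis using lb V1 D1 by blast
qed

end

section \<open>Tabloids of a two-row shape\<close>

lemma sym_right_simps [simp]:
  "carrier (sym_right n) = {p. p permutes {1..n}}" "g \<otimes>\<^bsub>sym_right n\<^esub> h = h \<circ> g" "\<one>\<^bsub>sym_right n\<^esub> = id"
  by (simp_all add: sym_right_def sym_group_def)

lemma sym_right_group: "Group.group (sym_right n)"
proof (rule groupI)
  fix x assume "x \<in> carrier (sym_right n)"
  then show "\<exists>y\<in>carrier (sym_right n). y \<otimes>\<^bsub>sym_right n\<^esub> x = \<one>\<^bsub>sym_right n\<^esub>"
    by (intro bexI[of _ "inv' x"]) (auto simp: permutes_inv permutes_inv_o)
qed (auto simp: permutes_compose permutes_id comp_assoc)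

lemma sym_right_inv: "g permutes {1..n} \<Longrightarrow> inv\<^bsub>sym_right n\<^esub> g = inv' g"
  by (rule group.inv_equality[OF sym_right_group]) (auto simp: permutes_inv permutes_inv_o)

lemma sym_right_finite_group: "finite_group (sym_right n)"
  using sym_right_group by (simp add: finite_group_def finite_group_axioms_def finite_permutations)

locale two_row =
  fixes n :: nat
  assumes n4: "4 \<le> n"
begin

abbreviation "N \<equiv> {1..n}"
abbreviation "\<mu> \<equiv> [n - 2, 2]"

lemma sum_\<mu>: "sum_list \<mu> = n" using n4 by simp

lemma diagram_eq: "diagram \<mu> = {(0, j) | j. j < n - 2} \<union> {(1, 0), (1, 1)}"
  by (auto simp: diagram_def less_Suc_eq nth_Cons split: nat.splits)

lemma finite_diagram: "finite (diagram \<mu>)"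
proof -
  have "{(0 :: nat, j) | j. j < n - 2} = Pair 0 ` {..<n - 2}" by auto
  then show ?thesis unfolding diagram_eq by simp
qed

lemma row0: "diagram_row \<mu> 0 = {(0, j) | j. j < n - 2}" by (auto simp: diagram_row_def diagram_eq)
lemma row1: "diagram_row \<mu> (Suc 0) = {(Suc 0, 0), (Suc 0, Suc 0)}" by (auto simp: diagram_row_def diagram_eq)
lemma row_other: "i \<noteq> 0 \<Longrightarrow> i \<noteq> 1 \<Longrightarrow> diagram_row \<mu> i = {}" by (auto simp: diagram_row_def diagram_eq)

lemma col0: "diagram_col \<mu> 0 = {(0, 0), (1, 0)}" using n4 by (auto simp: diagram_col_def diagram_eq)
lemma col1: "diagram_col \<mu> 1 = {(0, 1), (1, 1)}" using n4 by (auto simp: diagram_col_def diagram_eq)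
lemma col_other: "2 \<le> j \<Longrightarrow> diagram_col \<mu> j = (if j < n - 2 then {(0, j)} else {})"
  by (auto simp: diagram_col_def diagram_eq)

lemma tableauxD:
  assumes "t \<in> tableaux \<mu>"
  shows "bij_betw t (diagram \<mu>) N" "t \<in> extensional (diagram \<mu>)"
  using assms unfolding tableaux_def sum_\<mu> by blast+

lemma tableauxI: "bij_betw t (diagram \<mu>) N \<Longrightarrow> t \<in> extensional (diagram \<mu>) \<Longrightarrow> t \<in> tableaux \<mu>"
  unfolding tableaux_def sum_\<mu> by blast

lemma row0_image:
  assumes "t \<in> tableaux \<mu>"
  shows "t ` diagram_row \<mu> 0 = N - t ` diagram_row \<mu> (Suc 0)"
proof -
  note b = tableauxD(1)[OF assms]
  have d: "diagram_row \<mu> 0 = diagram \<mu> - diagram_row \<mu> (Suc 0)" "diagram_row \<mu> (Suc 0) \<subseteq> diagram \<mu>"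
    by (auto simp: row0 row1 diagram_eq)
  have "t ` (diagram \<mu> - diagram_row \<mu> (Suc 0)) = t ` diagram \<mu> - t ` diagram_row \<mu> (Suc 0)"
    by (rule inj_on_image_set_diff[OF bij_betw_imp_inj_on[OF b] _ d(2)]) blast
  then show ?thesis unfolding d(1) bij_betw_imp_surj_on[OF b] .
qed

text \<open>
  A tabloid of shape \<open>(n - 2, 2)\<close> is determined by the pair in its second row.
\<close>

definition pair_tabloid :: "nat set \<Rightarrow> tableau set" where
  "pair_tabloid A = {s \<in> tableaux \<mu>. s ` diagram_row \<mu> (Suc 0) = A}"

abbreviation "pairs \<equiv> {A. A \<subseteq> N \<and> card A = 2}"

lemma tabloid_eq_pair_tabloid:
  assumes t: "t \<in> tableaux \<mu>"
  shows "tabloid \<mu> t = pair_tabloid (t ` diagram_row \<mu> (Suc 0))"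
proof -
  have "(\<forall>i. s ` diagram_row \<mu> i = t ` diagram_row \<mu> i) \<longleftrightarrow> s ` diagram_row \<mu> (Suc 0) = t ` diagram_row \<mu> (Suc 0)"
    if s: "s \<in> tableaux \<mu>" for s
  proof (intro iffI allI)
    fix i assume "s ` diagram_row \<mu> (Suc 0) = t ` diagram_row \<mu> (Suc 0)"
    then show "s ` diagram_row \<mu> i = t ` diagram_row \<mu> i"
      using row0_image[OF s] row0_image[OF t] row_other[of i] by (cases "i = 0"; cases "i = 1") auto
  qed blast
  then show ?thesis unfolding tabloid_def pair_tabloid_def by blast
qed

lemma tableau_exists:
  assumes "distinct [a, b, c, d]" "{a, b, c, d} \<subseteq> N"
  obtains t where "t \<in> tableaux \<mu>" "t (0, 0) = a" "t (1, 0) = b" "t (0, 1) = c" "t (1, 1) = d"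
proof -
  let ?D = "{(0, 0), (1, 0), (0, 1), (1, 1)} :: (nat \<times> nat) set"
  have D: "?D \<subseteq> diagram \<mu>" using n4 by (auto simp: diagram_eq)
  have "card {(0 :: nat, j) | j. j < n - 2} = n - 2"
  proof -
    have "{(0 :: nat, j) | j. j < n - 2} = Pair 0 ` {..<n - 2}" by auto
    then show ?thesis by (simp add: card_image inj_on_def)
  qed
  then have "card (diagram \<mu>) = n"
    unfolding diagram_eq using n4 finite_diagram by (subst card_Un_disjoint) (auto simp: diagram_eq)
  then have "card (diagram \<mu> - ?D) = card (N - {a, b, c, d})"
    using card_Diff_subset[OF _ D] card_Diff_subset[OF _ assms(2)] assms(1) by simp
  then obtain h where h: "bij_betw h (diagram \<mu> - ?D) (N - {a, b, c, d})"
    using finite_same_card_bij finite_diagram by (metis finite_Diff finite_atLeastAtMost)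
  define k where "k x = (if x = (0, 0) then a else if x = (1, 0) then b else if x = (0, 1) then c else d)"
    for x :: "nat \<times> nat"
  have k: "bij_betw k ?D {a, b, c, d}" using assms(1) by (auto simp: bij_betw_def inj_on_def k_def)
  define t where "t = restrict (\<lambda>x. if x \<in> ?D then k x else h x) (diagram \<mu>)"
  have "bij_betw t (?D \<union> (diagram \<mu> - ?D)) ({a, b, c, d} \<union> (N - {a, b, c, d}))"
  proof (rule bij_betw_combine)
    show "bij_betw t ?D {a, b, c, d}"
      by (rule iffD1[OF bij_betw_cong k]) (use D in \<open>auto simp: t_def\<close>)
    show "bij_betw t (diagram \<mu> - ?D) (N - {a, b, c, d})"
      by (rule iffD1[OF bij_betw_cong h]) (auto simp: t_def)
  qed auto
  moreover have "?D \<union> (diagram \<mu> - ?D) = diagram \<mu>" "{a, b, c, d} \<union> (N - {a, b, c, d}) = N"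
    using D assms by auto
  ultimately have "t \<in> tableaux \<mu>" by (intro tableauxI) (auto simp: t_def)
  moreover have "t (0, 0) = a" "t (1, 0) = b" "t (0, 1) = c" "t (1, 1) = d"
    using D by (auto simp: t_def k_def)
  ultimately show ?thesis using that by blast
qed

lemma tableau_corners:
  assumes t: "t \<in> tableaux \<mu>"
  shows "distinct [t (0, 0), t (1, 0), t (0, 1), t (1, 1)]" "{t (0, 0), t (1, 0), t (0, 1), t (1, 1)} \<subseteq> N"
proof -
  have D: "(0, 0) \<in> diagram \<mu>" "(1, 0) \<in> diagram \<mu>" "(0, 1) \<in> diagram \<mu>" "(1, 1) \<in> diagram \<mu>"
    using n4 by (auto simp: diagram_eq)
  note b = tableauxD(1)[OF t]
  show "{t (0, 0), t (1, 0), t (0, 1), t (1, 1)} \<subseteq> N" using bij_betwE[OF b] D by blast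
  show "distinct [t (0, 0), t (1, 0), t (0, 1), t (1, 1)]"
    using inj_on_eq_iff[OF bij_betw_imp_inj_on[OF b]] D by simp
qed

text \<open>
  Two tableaux with prescribed first two columns differ by a permutation.
\<close>

lemma perm_exists:
  assumes "distinct [a, b, c, d]" "{a, b, c, d} \<subseteq> N"
  obtains g where "g permutes N" "g 1 = a" "g 2 = b" "g 3 = c" "g 4 = d"
proof -
  obtain t where t: "t \<in> tableaux \<mu>" "t (0, 0) = a" "t (1, 0) = b" "t (0, 1) = c" "t (1, 1) = d"
    by (rule tableau_exists[OF assms])
  obtain s where s: "s \<in> tableaux \<mu>" "s (0, 0) = 1" "s (1, 0) = 2" "s (0, 1) = 3" "s (1, 1) = 4"
    by (rule tableau_exists[of 1 2 3 4]) (use n4 in auto)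
  have D: "(0, 0) \<in> diagram \<mu>" "(1, 0) \<in> diagram \<mu>" "(0, 1) \<in> diagram \<mu>" "(1, 1) \<in> diagram \<mu>"
    using n4 by (auto simp: diagram_eq)
  note bt = tableauxD(1)[OF t(1)] and bs = tableauxD(1)[OF s(1)]
  define g where "g x = (if x \<in> N then t (inv_into (diagram \<mu>) s x) else x)" for x
  have gs: "g (s x) = t x" if "x \<in> diagram \<mu>" for x
    using that bij_betwE[OF bs] bij_betw_inv_into_left[OF bs that] by (simp add: g_def)
  have "bij_betw (t \<circ> inv_into (diagram \<mu>) s) N N"
    by (rule bij_betw_trans[OF bij_betw_inv_into[OF bs] bt])
  then have "bij_betw g N N" by (rule iffD1[OF bij_betw_cong, rotated]) (auto simp: g_def)
  then have "g permutes N" by (rule bij_imp_permutes) (auto simp: g_def)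
  then show ?thesis using that gs[OF D(1)] gs[OF D(2)] gs[OF D(3)] gs[OF D(4)] t s by simp
qed

lemma pair_two_more:
  assumes "A \<in> pairs"
  obtains a b c d where "distinct [a, b, c, d]" "{a, b, c, d} \<subseteq> N" "A = {b, d}"
proof -
  obtain b d where bd: "A = {b, d}" "b \<noteq> d" using assms by (auto simp: card_2_iff)
  have "2 \<le> card (N - A)" using assms n4 card_Diff_subset[of A N] finite_subset[of A N] by auto
  then obtain C where C: "C \<subseteq> N - A" "card C = 2" using obtain_subset_with_card_n by metis
  then obtain a c where "C = {a, c}" "a \<noteq> c" by (auto simp: card_2_iff)
  then show ?thesis using that[of a b c d] C bd assms by auto
qed

lemma pair_tabloid_nonempty: "A \<in> pairs \<Longrightarrow> \<exists>t. t \<in> pair_tabloid A"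
proof -
  assume "A \<in> pairs"
  then obtain a b c d where abcd: "distinct [a, b, c, d]" "{a, b, c, d} \<subseteq> N" "A = {b, d}" by (rule pair_two_more)
  obtain t where "t \<in> tableaux \<mu>" "t (0, 0) = a" "t (1, 0) = b" "t (0, 1) = c" "t (1, 1) = d"
    by (rule tableau_exists[OF abcd(1,2)])
  then show ?thesis using abcd(3) unfolding pair_tabloid_def row1 by auto
qed

lemma pair_tabloid_inj: "A \<in> pairs \<Longrightarrow> pair_tabloid A = pair_tabloid B \<longleftrightarrow> A = B"
  using pair_tabloid_nonempty[of A] unfolding pair_tabloid_def by blast

lemma tabloids_eq: "tabloids \<mu> = pair_tabloid ` pairs"
proof (intro equalityI subsetI)
  fix T assume "T \<in> tabloids \<mu>"
  then obtain t where t: "t \<in> tableaux \<mu>" "T = pair_tabloid (t ` diagram_row \<mu> (Suc 0))" by (auto simp: tabloids_def tabloid_eq_pair_tabloid)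
  have "t ` diagram_row \<mu> (Suc 0) \<in> pairs" using tableau_corners[OF t(1)] by (auto simp: row1)
  then show "T \<in> pair_tabloid ` pairs" using t by blast
next
  fix T assume "T \<in> pair_tabloid ` pairs"
  then obtain A where A: "A \<in> pairs" "T = pair_tabloid A" by blast
  obtain t where t: "t \<in> pair_tabloid A" using pair_tabloid_nonempty[OF A(1)] by blast
  then have "T = tabloid \<mu> t" "t \<in> tableaux \<mu>" using A tabloid_eq_pair_tabloid[of t] by (auto simp: pair_tabloid_def)
  then show "T \<in> tabloids \<mu>" unfolding tabloids_def by blast
qed

lemma finite_pairs: "finite pairs" by (rule finite_subset[of _ "Pow N"]) auto
lemma finite_tabloids: "finite (tabloids \<mu>)" unfolding tabloids_eq using finite_pairs by simp

lemma image_pairs: "g permutes N \<Longrightarrow> A \<in> pairs \<Longrightarrow> g ` A \<in> pairs"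
  using permutes_image[of g N] card_image[OF inj_on_subset[OF permutes_inj[of g N]], of A] by auto

lemma tableau_act_mem:
  assumes g: "g permutes N" and t: "t \<in> pair_tabloid A"
  shows "tableau_act \<mu> t g \<in> pair_tabloid (g ` A)"
proof -
  have "bij_betw (g \<circ> t) (diagram \<mu>) N"
    using bij_betw_trans[OF tableauxD(1) permutes_imp_bij[OF g]] t by (auto simp: pair_tabloid_def)
  then have "bij_betw (tableau_act \<mu> t g) (diagram \<mu>) N"
    by (rule iffD1[OF bij_betw_cong, rotated]) (auto simp: tableau_act_def)
  then have "tableau_act \<mu> t g \<in> tableaux \<mu>" by (rule tableauxI) (auto simp: tableau_act_def)
  moreover have "tableau_act \<mu> t g ` diagram_row \<mu> (Suc 0) = g ` t ` diagram_row \<mu> (Suc 0)"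
    by (auto simp: tableau_act_def row1 diagram_eq)
  ultimately show ?thesis using t by (auto simp: pair_tabloid_def)
qed

lemma tabloid_act_pair_tabloid:
  assumes g: "g permutes N"
  shows "tabloid_act \<mu> (pair_tabloid A) g = pair_tabloid (g ` A)"
proof (intro equalityI subsetI)
  fix s assume "s \<in> tabloid_act \<mu> (pair_tabloid A) g"
  then show "s \<in> pair_tabloid (g ` A)" using tableau_act_mem[OF g] by (auto simp: tabloid_act_def)
next
  fix s assume s: "s \<in> pair_tabloid (g ` A)"
  have "inv' g ` g ` A = A" using permutes_inv_o(2)[OF g] by (simp add: image_comp)
  then have "tableau_act \<mu> s (inv' g) \<in> pair_tabloid A" using tableau_act_mem[OF permutes_inv[OF g] s] by simp
  moreover have "s = tableau_act \<mu> (tableau_act \<mu> s (inv' g)) g"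
  proof
    fix x
    have "s \<in> tableaux \<mu>" using s by (simp add: pair_tabloid_def)
    then have "s x = undefined" if "x \<notin> diagram \<mu>"
      by (rule extensional_arb[OF tableauxD(2) that])
    then show "s x = tableau_act \<mu> (tableau_act \<mu> s (inv' g)) g x"
      using permutes_inverses(1)[OF g] by (simp add: tableau_act_def restrict_def)
  qed
  ultimately show "s \<in> tabloid_act \<mu> (pair_tabloid A) g" unfolding tabloid_act_def by blast
qed

abbreviation PM :: "('k::field, tableau set \<Rightarrow> 'k, nat \<Rightarrow> nat) gmodule" where
  "PM \<equiv> perm_module \<mu>"

lemma PM_simps [simp]: "scale PM = fun_scale"
  "v \<in> space PM \<longleftrightarrow> (\<forall>T. T \<notin> tabloids \<mu> \<longrightarrow> v T = 0)"
  by (simp_all add: perm_module_def)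

lemma act_pair_tabloid:
  assumes g: "g permutes N" and A: "A \<in> pairs"
  shows "act PM v g (pair_tabloid A) = v (pair_tabloid (inv' g ` A))"
proof -
  have "{S \<in> tabloids \<mu>. tabloid_act \<mu> S g = pair_tabloid A} = {pair_tabloid (inv' g ` A)}"
  proof (intro equalityI subsetI)
    fix S assume "S \<in> {S \<in> tabloids \<mu>. tabloid_act \<mu> S g = pair_tabloid A}"
    then obtain B where B: "B \<in> pairs" "S = pair_tabloid B" "pair_tabloid (g ` B) = pair_tabloid A"
      by (auto simp: tabloids_eq tabloid_act_pair_tabloid[OF g])
    then have "g ` B = A" using pair_tabloid_inj[OF image_pairs[OF g]] by blast
    moreover have "inv' g ` g ` B = B" using permutes_inv_o(2)[OF g] by (simp add: image_comp)
    ultimately have "inv' g ` A = B" by simp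
    then show "S \<in> {pair_tabloid (inv' g ` A)}" using B by simp
  next
    fix S assume "S \<in> {pair_tabloid (inv' g ` A)}"
    moreover have "g ` inv' g ` A = A" using permutes_inv_o(1)[OF g] by (simp add: image_comp)
    ultimately show "S \<in> {S \<in> tabloids \<mu>. tabloid_act \<mu> S g = pair_tabloid A}"
      using image_pairs[OF permutes_inv[OF g] A] by (auto simp: tabloids_eq tabloid_act_pair_tabloid[OF g])
  qed
  then show ?thesis by (simp add: perm_module_def)
qed

lemma act_outside:
  assumes g: "g permutes N" and T: "T \<notin> tabloids \<mu>"
  shows "act PM v g T = 0"
proof -
  have "tabloid_act \<mu> S g \<in> tabloids \<mu>" if S: "S \<in> tabloids \<mu>" for S
  proof -
    obtain B where B: "B \<in> pairs" "S = pair_tabloid B" using S[unfolded tabloids_eq] by blast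
    show ?thesis unfolding B(2) tabloid_act_pair_tabloid[OF g] tabloids_eq using image_pairs[OF g B(1)] by blast
  qed
  then have "{S \<in> tabloids \<mu>. tabloid_act \<mu> S g = T} = {}" using T by blast
  then have "(\<Sum>S | S \<in> tabloids \<mu> \<and> tabloid_act \<mu> S g = T. v S) = 0" by (simp only: sum.empty)
  then show ?thesis by (simp add: perm_module_def)
qed

lemma PM_ext:
  assumes "v \<in> space PM" "w \<in> space PM" "\<And>A. A \<in> pairs \<Longrightarrow> v (pair_tabloid A) = w (pair_tabloid A)"
  shows "v = w"
proof
  fix T
  show "v T = w T"
  proof (cases "T \<in> tabloids \<mu>")
    case True
    then obtain A where "A \<in> pairs" "T = pair_tabloid A" unfolding tabloids_eq by blast
    then show ?thesis using assms(3) by simp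
  next
    case False
    have "v T = 0" "w T = 0" using assms(1,2)[unfolded PM_simps, rule_format, OF False] by auto
    then show ?thesis by simp
  qed
qed

lemma PM_module: "fg_module (sym_right n) (PM :: ('k::field, _, _) gmodule)"
proof -
  interpret w: vector_space "fun_scale :: 'k \<Rightarrow> (tableau set \<Rightarrow> 'k) \<Rightarrow> _" by (rule vector_space_fun_scale)
  have sub: "w.subspace (space PM)" by (auto simp: w.subspace_def fun_scale_def)
  let ?d = "\<lambda>T S. if S = T then 1 else 0 :: 'k"
  have "w.span (?d ` tabloids \<mu>) = space PM"
  proof
    show "w.span (?d ` tabloids \<mu>) \<subseteq> space PM" by (rule w.span_minimal[OF _ sub]) auto
    show "space PM \<subseteq> w.span (?d ` tabloids \<mu>)"
    proof
      fix v :: "tableau set \<Rightarrow> 'k" assume v: "v \<in> space PM"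
      have "v = (\<Sum>T\<in>tabloids \<mu>. fun_scale (v T) (?d T))"
      proof
        fix S
        have "(\<Sum>T\<in>tabloids \<mu>. fun_scale (v T) (?d T)) S = (\<Sum>T\<in>tabloids \<mu>. if T = S then v S else 0)"
          unfolding sum_fun_apply by (intro sum.cong) (auto simp: fun_scale_def)
        also have "\<dots> = (if S \<in> tabloids \<mu> then v S else 0)" using finite_tabloids by (rule sum.delta)
        also have "\<dots> = v S" using v[unfolded PM_simps] by auto
        finally show "v S = (\<Sum>T\<in>tabloids \<mu>. fun_scale (v T) (?d T)) S" by (rule sym)
      qed
      moreover have "(\<Sum>T\<in>tabloids \<mu>. fun_scale (v T) (?d T)) \<in> w.span (?d ` tabloids \<mu>)"
        by (intro w.span_sum w.span_scale w.span_base) simp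
      ultimately show "v \<in> w.span (?d ` tabloids \<mu>)" by simp
    qed
  qed
  then have span: "\<exists>S. finite S \<and> w.span S = space PM" using finite_tabloids by blast
  show ?thesis
    unfolding fg_module_def
  proof (intro conjI ballI allI sym_right_group)
    show "vector_space (scale (PM :: ('k, _, _) gmodule))" using vector_space_fun_scale by simp
    show "module.subspace (scale PM) (space (PM :: ('k, _, _) gmodule))" using sub by simp
    show "\<exists>S. finite S \<and> module.span (scale PM) S = space (PM :: ('k, _, _) gmodule)" using span by simp
  next
    fix v :: "tableau set \<Rightarrow> 'k" and g assume v: "v \<in> space PM" and "g \<in> carrier (sym_right n)"
    then have g: "g permutes N" by simp
    show m: "act PM v g \<in> space PM" unfolding PM_simps using act_outside[OF g] by blast
    have ac: "act PM w h \<in> space PM" if "h permutes N" for w :: "tableau set \<Rightarrow> 'k" and h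
      unfolding PM_simps using act_outside[OF that] by blast
    show "act PM (v + w) g = act PM v g + act PM w g" if "w \<in> space PM" for w
      using ac[OF g] by (intro PM_ext) (auto simp: act_pair_tabloid[OF g])
    show "act PM (scale PM c v) g = scale PM c (act PM v g)" for c
      using ac[OF g] by (intro PM_ext) (auto simp: act_pair_tabloid[OF g] fun_scale_def)
    fix h assume "h \<in> carrier (sym_right n)"
    then have h: "h permutes N" by simp
    have hg: "h \<circ> g permutes N" using permutes_compose[OF g h] .
    show "act PM (act PM v g) h = act PM v (g \<otimes>\<^bsub>sym_right n\<^esub> h)"
    proof (rule PM_ext)
      fix A assume A: "A \<in> pairs"
      have "inv' (h \<circ> g) = inv' g \<circ> inv' h"
        using o_inv_distrib[OF permutes_bij[OF h] permutes_bij[OF g]] .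
      then show "act PM (act PM v g) h (pair_tabloid A) = act PM v (g \<otimes>\<^bsub>sym_right n\<^esub> h) (pair_tabloid A)"
        using A image_pairs[OF permutes_inv[OF h] A]
        by (simp add: act_pair_tabloid[OF h] act_pair_tabloid[OF g] act_pair_tabloid[OF hg] image_comp)
    qed (use ac[OF h] ac[OF hg] in simp_all)
  next
    fix v :: "tableau set \<Rightarrow> 'k" assume v: "v \<in> space PM"
    show "act PM v \<one>\<^bsub>sym_right n\<^esub> = v"
      using v act_outside[OF permutes_id] by (intro PM_ext) (auto simp: act_pair_tabloid[OF permutes_id])
  qed
qed

end

section \<open>Polytabloids of a two-row shape\<close>

context two_row
begin

definition pair_vec :: "nat set \<Rightarrow> tableau set \<Rightarrow> 'k::field" where
  "pair_vec A = (\<lambda>T. if T = pair_tabloid A then 1 else 0)"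

text \<open>
  The polytabloid of a tableau whose first two columns are \<open>a, b\<close> and \<open>c, d\<close> from top to bottom: all other
  columns have one box, so the column group is generated by the transpositions of \<open>a, b\<close> and of \<open>c, d\<close>.
\<close>

definition polytab :: "nat \<Rightarrow> nat \<Rightarrow> nat \<Rightarrow> nat \<Rightarrow> tableau set \<Rightarrow> 'k::field" where
  "polytab a b c d = pair_vec {b, d} - pair_vec {a, d} - pair_vec {b, c} + pair_vec {a, c}"

lemma pair_vec_pair_tabloid: "A \<in> pairs \<Longrightarrow> pair_vec B (pair_tabloid A) = (if A = B then 1 else 0)"
  using pair_tabloid_inj[of A B] by (auto simp: pair_vec_def)

lemma pair_vec_space: "A \<in> pairs \<Longrightarrow> pair_vec A \<in> space PM"
  by (auto simp: pair_vec_def tabloids_eq)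

lemma act_pair_vec:
  assumes g: "g permutes N" and A: "A \<in> pairs"
  shows "act PM (pair_vec A) g = pair_vec (g ` A)"
proof (rule PM_ext)
  show "act PM (pair_vec A) g \<in> space PM" unfolding PM_simps using act_outside[OF g] by blast
  show "pair_vec (g ` A) \<in> space PM" by (rule pair_vec_space[OF image_pairs[OF g A]])
  fix B assume B: "B \<in> pairs"
  have "inv' g ` B = A \<longleftrightarrow> B = g ` A"
  proof
    assume "inv' g ` B = A"
    then have "g ` A = g ` inv' g ` B" by simp
    then show "B = g ` A" using permutes_inv_o(1)[OF g] by (simp add: image_comp)
  next
    assume "B = g ` A"
    then show "inv' g ` B = A" using permutes_inv_o(2)[OF g] by (simp add: image_comp)
  qed
  then show "act PM (pair_vec A) g (pair_tabloid B) = pair_vec (g ` A) (pair_tabloid B)"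
    by (simp add: act_pair_tabloid[OF g B] pair_vec_pair_tabloid[OF image_pairs[OF permutes_inv[OF g] B]] pair_vec_pair_tabloid[OF B])
qed

definition corners :: "nat \<Rightarrow> nat \<Rightarrow> nat \<Rightarrow> nat \<Rightarrow> bool" where
  "corners a b c d \<longleftrightarrow> distinct [a, b, c, d] \<and> {a, b, c, d} \<subseteq> N"

lemma corners_pairs:
  assumes "corners a b c d"
  shows "{b, d} \<in> pairs" "{a, d} \<in> pairs" "{b, c} \<in> pairs" "{a, c} \<in> pairs" "{a, b} \<in> pairs" "{c, d} \<in> pairs"
  using assms by (auto simp: corners_def)

lemma corners_image: "corners a b c d \<Longrightarrow> g permutes N \<Longrightarrow> corners (g a) (g b) (g c) (g d)"
  using permutes_in_image[of g N] inj_eq[OF permutes_inj[of g N]] by (auto simp: corners_def)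

lemma polytab_pair_tabloid:
  assumes "A \<in> pairs"
  shows "polytab a b c d (pair_tabloid A) = of_bool (A = {b, d}) - of_bool (A = {a, d}) - of_bool (A = {b, c}) + of_bool (A = {a, c})"
  using assms by (simp add: polytab_def pair_vec_pair_tabloid)

lemma polytab_space:
  assumes "corners a b c d"
  shows "(polytab a b c d :: tableau set \<Rightarrow> 'k::field) \<in> space PM"
proof -
  interpret PM: fg_mod "sym_right n" "PM :: ('k, _, _) gmodule" using PM_module by (simp add: fg_mod_def)
  show ?thesis unfolding polytab_def
    by (intro PM.space_add PM.space_diff pair_vec_space corners_pairs[OF assms])
qed

lemma act_polytab:
  assumes "corners a b c d" and g: "g permutes N"
  shows "act PM (polytab a b c d) g = (polytab (g a) (g b) (g c) (g d) :: tableau set \<Rightarrow> 'k::field)"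
proof -
  interpret PM: fg_mod "sym_right n" "PM :: ('k, _, _) gmodule" using PM_module by (simp add: fg_mod_def)
  note p = corners_pairs[OF assms(1)]
  have gc: "g \<in> carrier (sym_right n)" using g by simp
  note s = pair_vec_space[OF p(1)] pair_vec_space[OF p(2)] pair_vec_space[OF p(3)] pair_vec_space[OF p(4)]
  have "act PM (polytab a b c d) g = act PM (pair_vec {b, d}) g - act PM (pair_vec {a, d}) g - act PM (pair_vec {b, c}) g + act PM (pair_vec {a, c} :: _ \<Rightarrow> 'k) g"
    unfolding polytab_def
    using PM.act_add[OF PM.space_diff[OF PM.space_diff[OF s(1,2)] s(3)] s(4) gc]
      PM.act_diff[OF PM.space_diff[OF s(1,2)] s(3) gc] PM.act_diff[OF s(1,2) gc] by metis
  then show ?thesis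
    unfolding act_pair_vec[OF g p(1)] act_pair_vec[OF g p(2)] act_pair_vec[OF g p(3)] act_pair_vec[OF g p(4)]
    by (simp add: polytab_def)
qed

lemma column_group_eq:
  assumes t: "t \<in> tableaux \<mu>" and c: "a = t (0, 0)" "b = t (1, 0)" "c = t (0, 1)" "d = t (1, 1)"
  shows "column_group \<mu> t = {id, transpose a b, transpose c d, transpose a b \<circ> transpose c d}"
proof -
  have cor: "distinct [a, b, c, d]" "{a, b, c, d} \<subseteq> N" using tableau_corners[OF t] c by simp_all
  have sets: "t ` diagram_col \<mu> 0 = {a, b}" "t ` diagram_col \<mu> 1 = {c, d}"
    unfolding col0 col1 using c by auto
  show ?thesis
  proof (intro equalityI subsetI)
    fix g assume "g \<in> column_group \<mu> t"
    then have g: "g permutes N" and col: "\<And>j. g ` t ` diagram_col \<mu> j = t ` diagram_col \<mu> j"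
      unfolding column_group_def sum_\<mu> by auto
    have ab: "g ` {a, b} = {a, b}" and cd: "g ` {c, d} = {c, d}" using col[of 0] col[of 1] sets by simp_all
    have fix_other: "g x = x" if "x \<notin> {a, b, c, d}" for x
    proof (cases "x \<in> N")
      case False
      then show ?thesis using permutes_not_in[OF g] by simp
    next
      case True
      then obtain y where y: "y \<in> diagram \<mu>" "x = t y"
        using tableauxD(1)[OF t] unfolding bij_betw_def by blast
      have "y \<noteq> (0, 0)" "y \<noteq> (1, 0)" "y \<noteq> (0, 1)" "y \<noteq> (1, 1)" using y(2) that c by auto
      then obtain j where j: "y = (0, j)" "j < n - 2" "2 \<le> j"
        using y(1) unfolding diagram_eq by (auto simp: numeral_2_eq_2 not_less_eq_eq[symmetric] less_Suc_eq)
      have "t ` diagram_col \<mu> j = {x}" using col_other[OF j(3)] j y by simp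
      then show ?thesis using col[of j] by simp
    qed
    have inj: "inj g" by (rule permutes_inj[OF g])
    have "(g a = a \<and> g b = b) \<or> (g a = b \<and> g b = a)"
      using ab injD[OF inj, of a b] cor(1) by (auto simp: doubleton_eq_iff)
    moreover have "(g c = c \<and> g d = d) \<or> (g c = d \<and> g d = c)"
      using cd injD[OF inj, of c d] cor(1) by (auto simp: doubleton_eq_iff)
    ultimately consider "g a = a" "g b = b" "g c = c" "g d = d" | "g a = b" "g b = a" "g c = c" "g d = d"
      | "g a = a" "g b = b" "g c = d" "g d = c" | "g a = b" "g b = a" "g c = d" "g d = c" by blast
    then show "g \<in> {id, transpose a b, transpose c d, transpose a b \<circ> transpose c d}"
    proof cases
      case 1
      have "g x = id x" for x using 1 fix_other[of x] by (cases "x \<in> {a, b, c, d}") auto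
      then show ?thesis by blast
    next
      case 2
      have "g x = transpose a b x" for x
        using 2 fix_other[of x] cor(1) by (cases "x \<in> {a, b, c, d}") (auto simp: transpose_def)
      then show ?thesis by blast
    next
      case 3
      have "g x = transpose c d x" for x
        using 3 fix_other[of x] cor(1) by (cases "x \<in> {a, b, c, d}") (auto simp: transpose_def)
      then show ?thesis by blast
    next
      case 4
      have "g x = (transpose a b \<circ> transpose c d) x" for x
        using 4 fix_other[of x] cor(1) by (cases "x \<in> {a, b, c, d}") (auto simp: transpose_def)
      then show ?thesis by blast
    qed
  next
    fix g assume "g \<in> {id, transpose a b, transpose c d, transpose a b \<circ> transpose c d}"
    then have g: "g = id \<or> g = transpose a b \<or> g = transpose c d \<or> g = transpose a b \<circ> transpose c d" by blast
    have "g permutes N"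
      using g cor(2) permutes_id permutes_swap_id[of a N b] permutes_swap_id[of c N d]
        permutes_compose[OF permutes_swap_id[of c N d] permutes_swap_id[of a N b]] by auto
    moreover have "g ` t ` diagram_col \<mu> j = t ` diagram_col \<mu> j" for j
    proof -
      consider "j = 0" | "j = 1" | "2 \<le> j" by linarith
      then show ?thesis
      proof cases
        case 1
        then show ?thesis using sets g cor(1) by (auto simp: transpose_def)
      next
        case 2
        then show ?thesis using sets g cor(1) by (auto simp: transpose_def)
      next
        case 3
        show ?thesis
        proof (cases "j < n - 2")
          case True
          have D: "(0, j) \<in> diagram \<mu>" "(0, 0) \<in> diagram \<mu>" "(1, 0) \<in> diagram \<mu>" "(0, 1) \<in> diagram \<mu>" "(1, 1) \<in> diagram \<mu>"
            using True n4 by (auto simp: diagram_eq)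
          have "t (0, j) \<notin> {a, b, c, d}"
            using inj_on_eq_iff[OF bij_betw_imp_inj_on[OF tableauxD(1)[OF t]]] D 3 c by simp
          then have "g (t (0, j)) = t (0, j)" using g by (auto simp: transpose_def)
          then show ?thesis using col_other[OF 3] True by simp
        qed (use col_other[OF 3] in simp)
      qed
    qed
    ultimately show "g \<in> column_group \<mu> t" unfolding column_group_def sum_\<mu> by simp
  qed
qed

lemma polytabloid_eq:
  assumes t: "t \<in> tableaux \<mu>"
  shows "polytabloid \<mu> t = (polytab (t (0, 0)) (t (1, 0)) (t (0, 1)) (t (1, 1)) :: tableau set \<Rightarrow> 'k::field)"
proof
  fix T
  define a b c d where c: "a = t (0, 0)" "b = t (1, 0)" "c = t (0, 1)" "d = t (1, 1)"
  have cor: "distinct [a, b, c, d]" "{a, b, c, d} \<subseteq> N" using tableau_corners[OF t] c by simp_all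
  have tt: "tabloid \<mu> t = pair_tabloid {b, d}" using tabloid_eq_pair_tabloid[OF t] c by (simp add: row1)
  have p: "transpose a b permutes N" "transpose c d permutes N" "(transpose a b \<circ> transpose c d) permutes N"
    using cor(2) permutes_swap_id[of a N b] permutes_swap_id[of c N d]
        permutes_compose[OF permutes_swap_id[of c N d] permutes_swap_id[of a N b]] by auto
  have act: "tabloid_act \<mu> (tabloid \<mu> t) id = pair_tabloid {b, d}" "tabloid_act \<mu> (tabloid \<mu> t) (transpose a b) = pair_tabloid {a, d}"
    "tabloid_act \<mu> (tabloid \<mu> t) (transpose c d) = pair_tabloid {b, c}"
    "tabloid_act \<mu> (tabloid \<mu> t) (transpose a b \<circ> transpose c d) = pair_tabloid {a, c}"
    unfolding tt tabloid_act_pair_tabloid[OF permutes_id] tabloid_act_pair_tabloid[OF p(1)] tabloid_act_pair_tabloid[OF p(2)] tabloid_act_pair_tabloid[OF p(3)]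
    using cor(1) by (auto simp: transpose_def insert_commute)
  have ne: "transpose a b \<noteq> id" "transpose c d \<noteq> id" "transpose a b \<noteq> transpose c d"
    "transpose a b \<circ> transpose c d \<noteq> id" "transpose a b \<circ> transpose c d \<noteq> transpose a b"
    "transpose a b \<circ> transpose c d \<noteq> transpose c d"
    using cor(1) by (auto simp: fun_eq_iff transpose_def)
  have sg: "sign (transpose a b) = -1" "sign (transpose c d) = -1" "sign (transpose a b \<circ> transpose c d) = 1"
    using cor(1) sign_compose[OF permutation_swap_id[of a b] permutation_swap_id[of c d]] by (auto simp: sign_swap_id)
  have "polytabloid \<mu> t T = (\<Sum>g\<in>{id, transpose a b, transpose c d, transpose a b \<circ> transpose c d}.
      of_int (sign g) * (if tabloid_act \<mu> (tabloid \<mu> t) g = T then 1 else 0 :: 'k))"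
    unfolding polytabloid_def column_group_eq[OF t c] ..
  also have "\<dots> = polytab a b c d T"
    using ne by (auto simp: act sg sign_id polytab_def pair_vec_def)
  finally show "polytabloid \<mu> t T = (polytab (t (0, 0)) (t (1, 0)) (t (0, 1)) (t (1, 1)) (T :: tableau set) :: 'k)" by (simp add: c)
qed

lemma polytabloids:
  "(polytabloid \<mu> :: _ \<Rightarrow> tableau set \<Rightarrow> 'k::field) ` tableaux \<mu> = {polytab a b c d | a b c d. corners a b c d}"
proof (intro equalityI subsetI)
  fix x :: "tableau set \<Rightarrow> 'k" assume "x \<in> polytabloid \<mu> ` tableaux \<mu>"
  then show "x \<in> {polytab a b c d | a b c d. corners a b c d}"
    using polytabloid_eq tableau_corners unfolding corners_def by blast
next
  fix x :: "tableau set \<Rightarrow> 'k" assume "x \<in> {polytab a b c d | a b c d. corners a b c d}"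
  then obtain a b c d where x: "x = polytab a b c d" "corners a b c d" by blast
  obtain t where t: "t \<in> tableaux \<mu>" "t (0, 0) = a" "t (1, 0) = b" "t (0, 1) = c" "t (1, 1) = d"
    using tableau_exists x(2) unfolding corners_def by metis
  have "x = polytabloid \<mu> t" using t x by (simp add: polytabloid_eq[OF t(1)])
  then show "x \<in> polytabloid \<mu> ` tableaux \<mu>" using t(1) by blast
qed

end

section \<open>The Specht module\<close>

text \<open>
  Here \<open>f i j\<close> is the coefficient of a vector at the tabloid with second row \<open>{i, j}\<close>, \<open>L\<close> is the inner
  product with the polytabloid of \<open>(a, b, c, d)\<close>, and the second factor is the coefficient of that
  polytabloid at \<open>{x, y}\<close>. Exchanging \<open>a, b\<close>, or \<open>c, d\<close>, changes the sign of both factors, and exchanging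
  \<open>(a, b)\<close> with \<open>(c, d)\<close> preserves them. So the sum is 8 times its part with \<open>b = x\<close> and \<open>d = y\<close>, which the
  vanishing row sums evaluate.
\<close>

lemma frame_sum:
  fixes f :: "nat \<Rightarrow> nat \<Rightarrow> 'k::comm_ring_1" and N :: "nat set"
  assumes N: "finite N" and sym: "\<And>i j. f i j = f j i"
    and row: "\<And>i. i \<in> N \<Longrightarrow> (\<Sum>j\<in>N - {i}. f i j) = 0"
    and xy: "x \<in> N" "y \<in> N" "x \<noteq> y"
  defines "L \<equiv> \<lambda>(a, b, c, d). f b d - f a d - f b c + f a c"
    and "C \<equiv> {(a, b, c, d). distinct [a, b, c, d] \<and> {a, b, c, d} \<subseteq> N}"
  shows "(\<Sum>q\<in>C. L q * (case q of (a, b, c, d) \<Rightarrow> of_bool ({x, y} = {b, d}) - of_bool ({x, y} = {a, d})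
            - of_bool ({x, y} = {b, c}) + of_bool ({x, y} = {a, c})))
         = 8 * (of_nat (card N) - 1) * (of_nat (card N) - 2) * f x y"
proof -
  have fC: "finite C"
    by (rule finite_subset[of _ "N \<times> N \<times> N \<times> N"]) (use N in \<open>auto simp: C_def\<close>)
  \<comment> \<open>The part of the sum in which \<open>{x, y} = {b, d}\<close>; the three others are \<open>W\<close> up to sign.\<close>
  define W where "W = (\<Sum>q\<in>C. L q * (case q of (a, b, c, d) \<Rightarrow> of_bool ({x, y} = {b, d})))"
  have ad: "(\<Sum>q\<in>C. L q * (case q of (a, b, c, d) \<Rightarrow> of_bool ({x, y} = {a, d}))) = - W"
    unfolding W_def sum_negf[symmetric]
    by (rule sum.reindex_bij_witness[where i = "\<lambda>(a, b, c, d). (b, a, c, d)" and j = "\<lambda>(a, b, c, d). (b, a, c, d)"])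
      (auto simp: C_def L_def algebra_simps)
  have bc: "(\<Sum>q\<in>C. L q * (case q of (a, b, c, d) \<Rightarrow> of_bool ({x, y} = {b, c}))) = - W"
    unfolding W_def sum_negf[symmetric]
    by (rule sum.reindex_bij_witness[where i = "\<lambda>(a, b, c, d). (a, b, d, c)" and j = "\<lambda>(a, b, c, d). (a, b, d, c)"])
      (auto simp: C_def L_def algebra_simps)
  have ac: "(\<Sum>q\<in>C. L q * (case q of (a, b, c, d) \<Rightarrow> of_bool ({x, y} = {a, c}))) = W"
    unfolding W_def
    by (rule sum.reindex_bij_witness[where i = "\<lambda>(a, b, c, d). (b, a, d, c)" and j = "\<lambda>(a, b, c, d). (b, a, d, c)"])
      (auto simp: C_def L_def algebra_simps)
  have "L q * (case q of (a, b, c, d) \<Rightarrow> of_bool ({x, y} = {b, d}) - of_bool ({x, y} = {a, d})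
            - of_bool ({x, y} = {b, c}) + of_bool ({x, y} = {a, c}))
      = L q * (case q of (a, b, c, d) \<Rightarrow> of_bool ({x, y} = {b, d}))
      - L q * (case q of (a, b, c, d) \<Rightarrow> of_bool ({x, y} = {a, d}))
      - L q * (case q of (a, b, c, d) \<Rightarrow> of_bool ({x, y} = {b, c}))
      + L q * (case q of (a, b, c, d) \<Rightarrow> of_bool ({x, y} = {a, c}))" for q
    by (cases q) (simp add: algebra_simps)
  then have "(\<Sum>q\<in>C. L q * (case q of (a, b, c, d) \<Rightarrow> of_bool ({x, y} = {b, d}) - of_bool ({x, y} = {a, d})
            - of_bool ({x, y} = {b, c}) + of_bool ({x, y} = {a, c}))) = W - (- W) - (- W) + W"
    by (simp only: sum.distrib sum_subtractf ad bc ac W_def[symmetric])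
  then have total: "(\<Sum>q\<in>C. L q * (case q of (a, b, c, d) \<Rightarrow> of_bool ({x, y} = {b, d}) - of_bool ({x, y} = {a, d})
            - of_bool ({x, y} = {b, c}) + of_bool ({x, y} = {a, c}))) = 4 * W" by simp
  \<comment> \<open>The two orders of \<open>{b, d}\<close> contribute equally.\<close>
  define V where "V = (\<Sum>q\<in>C. L q * (case q of (a, b, c, d) \<Rightarrow> of_bool (b = x \<and> d = y)))"
  have V': "(\<Sum>q\<in>C. L q * (case q of (a, b, c, d) \<Rightarrow> of_bool (b = y \<and> d = x))) = V"
    unfolding V_def
    by (rule sum.reindex_bij_witness[where i = "\<lambda>(a, b, c, d). (c, d, a, b)" and j = "\<lambda>(a, b, c, d). (c, d, a, b)"])
      (auto simp: C_def L_def sym)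
  have "W = V + V"
    unfolding W_def by (subst (2) V'[symmetric], unfold V_def sum.distrib[symmetric])
      (use xy(3) in \<open>auto intro!: sum.cong simp: doubleton_eq_iff\<close>)
  define R where "R = N - {x, y}"
  have Ry: "(\<Sum>a\<in>R. f y a) = - f x y"
  proof -
    have NR: "N - {y} = insert x R" using xy by (auto simp: R_def)
    have "finite R" "x \<notin> R" using N by (auto simp: R_def)
    then have "(\<Sum>j\<in>insert x R. f y j) = f y x + (\<Sum>a\<in>R. f y a)" by (rule sum.insert)
    then have z: "f x y + (\<Sum>a\<in>R. f y a) = 0" using row[OF xy(2)] sym[of y x] unfolding NR by metis
    have "(\<Sum>a\<in>R. f y a) = (f x y + (\<Sum>a\<in>R. f y a)) - f x y" by simp
    then show ?thesis unfolding z by simp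
  qed
  have Rc: "of_nat (card R) = (of_nat (card N) - 2 :: 'k)"
    using card_mono[OF N, of "{x, y}"] xy N by (simp add: R_def card_Diff_subset of_nat_diff)
  have "V = (\<Sum>q\<in>C. if (case q of (a, b, c, d) \<Rightarrow> b = x \<and> d = y) then L q else 0)"
    unfolding V_def by (intro sum.cong refl) (auto simp: of_bool_def split: if_splits)
  also have "\<dots> = (\<Sum>q | q \<in> C \<and> (case q of (a, b, c, d) \<Rightarrow> b = x \<and> d = y). L q)"
    using fC by (simp add: sum.inter_filter)
  also have "\<dots> = (\<Sum>(a, c)\<in>Sigma R (\<lambda>a. R - {a}). L (a, x, c, y))"
    by (rule sum.reindex_bij_witness[where i = "\<lambda>(a, c). (a, x, c, y)" and j = "\<lambda>(a, b, c, d). (a, c)"])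
      (use xy in \<open>auto simp: C_def R_def\<close>)
  also have "\<dots> = (\<Sum>a\<in>R. \<Sum>c\<in>R - {a}. L (a, x, c, y))"
    by (subst sum.Sigma) (use N in \<open>auto simp: R_def\<close>)
  also have "\<dots> = (\<Sum>a\<in>R. (of_nat (card N) - 2) * (f x y - f a y))"
  proof (rule sum.cong[OF refl])
    fix a assume a: "a \<in> R"
    have cR: "of_nat (card (R - {a})) = (of_nat (card N) - 3 :: 'k)"
    proof -
      have "R - {a} = N - {x, y, a}" by (auto simp: R_def)
      then have "card (R - {a}) = card N - 3" using a xy N by (simp add: card_Diff_subset R_def)
      moreover have "3 \<le> card N" using card_mono[OF N, of "{x, y, a}"] a xy by (simp add: R_def)
      ultimately show ?thesis by (simp add: of_nat_diff)
    qed
    have r1: "(\<Sum>c\<in>R - {a}. f a c) = - f a x - f a y"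
    proof -
      have "N - {a} = insert x (insert y (R - {a}))" using a xy by (auto simp: R_def)
      then have "(\<Sum>j\<in>N - {a}. f a j) = f a x + (f a y + (\<Sum>c\<in>R - {a}. f a c))"
        using N xy by (simp add: R_def)
      then have z: "f a x + (f a y + (\<Sum>c\<in>R - {a}. f a c)) = 0" using row[of a] a by (simp add: R_def)
      have "(\<Sum>c\<in>R - {a}. f a c) = (f a x + (f a y + (\<Sum>c\<in>R - {a}. f a c))) - f a x - f a y" by simp
      then show ?thesis unfolding z by simp
    qed
    have r2: "(\<Sum>c\<in>R - {a}. f x c) = - f x y - f x a"
    proof -
      have "N - {x} = insert a (insert y (R - {a}))" using a xy by (auto simp: R_def)
      then have "(\<Sum>j\<in>N - {x}. f x j) = f x a + (f x y + (\<Sum>c\<in>R - {a}. f x c))"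
        using N xy a by (simp add: R_def)
      then have z: "f x a + (f x y + (\<Sum>c\<in>R - {a}. f x c)) = 0" using row[of x] xy by simp
      have "(\<Sum>c\<in>R - {a}. f x c) = (f x a + (f x y + (\<Sum>c\<in>R - {a}. f x c))) - f x y - f x a" by simp
      then show ?thesis unfolding z by simp
    qed
    have "(\<Sum>c\<in>R - {a}. L (a, x, c, y))
        = of_nat (card (R - {a})) * (f x y - f a y) - (\<Sum>c\<in>R - {a}. f x c) + (\<Sum>c\<in>R - {a}. f a c)"
      by (simp add: L_def sum.distrib sum_subtractf)
    also have "\<dots> = (of_nat (card N) - 2) * (f x y - f a y)"
      unfolding cR r1 r2 by (simp add: algebra_simps sym[of a x])
    finally show "(\<Sum>c\<in>R - {a}. L (a, x, c, y)) = (of_nat (card N) - 2) * (f x y - f a y)" .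
  qed
  also have "\<dots> = (of_nat (card N) - 2) * (of_nat (card R) * f x y - (\<Sum>a\<in>R. f y a))"
    by (simp add: sum_distrib_left[symmetric] sum_subtractf sym)
  also have "\<dots> = (of_nat (card N) - 2) * (of_nat (card N) - 1) * f x y"
    unfolding Ry Rc by (simp add: algebra_simps)
  finally have V: "V = (of_nat (card N) - 2) * (of_nat (card N) - 1) * f x y" .
  show ?thesis unfolding total \<open>W = V + V\<close> V by (simp add: algebra_simps)
qed

context two_row
begin

abbreviation SM :: "('k::field, tableau set \<Rightarrow> 'k, nat \<Rightarrow> nat) gmodule" where
  "SM \<equiv> specht_module \<mu>"

abbreviation fspan :: "(tableau set \<Rightarrow> 'k::field) set \<Rightarrow> (tableau set \<Rightarrow> 'k) set" where
  "fspan \<equiv> module.span fun_scale"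

lemma SM_eq: "SM = PM\<lparr>space := fspan {polytab a b c d | a b c d. corners a b c d}\<rparr>"
  by (simp add: specht_module_def polytabloids)

lemma SM_simps [simp]: "scale SM = fun_scale" "act SM = act PM"
  by (simp_all add: SM_eq)

lemma SM_space: "space SM = fspan {polytab a b c d | a b c d. corners a b c d}"
  by (simp add: SM_eq)

lemma SM_subset:
  assumes "module.subspace fun_scale K"
    and "\<And>a b c d. corners a b c d \<Longrightarrow> polytab a b c d \<in> K"
  shows "space (SM :: ('k::field, _, _) gmodule) \<subseteq> K"
proof -
  interpret w: vector_space "fun_scale :: 'k \<Rightarrow> (tableau set \<Rightarrow> 'k) \<Rightarrow> _" by (rule vector_space_fun_scale)
  show ?thesis unfolding SM_space by (rule w.span_minimal) (use assms in auto)
qed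

lemma polytab_SM: "corners a b c d \<Longrightarrow> (polytab a b c d :: _ \<Rightarrow> 'k::field) \<in> space SM"
proof -
  assume c: "corners a b c d"
  interpret w: vector_space "fun_scale :: 'k \<Rightarrow> (tableau set \<Rightarrow> 'k) \<Rightarrow> _" by (rule vector_space_fun_scale)
  show ?thesis unfolding SM_space by (rule w.span_base) (use c in blast)
qed

lemma SM_submodule: "fg_submodule (sym_right n) PM (space (SM :: ('k::field, _, _) gmodule))"
proof -
  interpret PM: fg_mod "sym_right n" "PM :: ('k, _, _) gmodule" using PM_module by (simp add: fg_mod_def)
  interpret w: vector_space "fun_scale :: 'k \<Rightarrow> (tableau set \<Rightarrow> 'k) \<Rightarrow> _" by (rule vector_space_fun_scale)
  have sub: "w.subspace (space SM)" unfolding SM_space by (rule w.subspace_span)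
  have PMs: "w.subspace (space PM)" using PM.subspace_space by simp
  have le: "space SM \<subseteq> space (PM :: ('k, _, _) gmodule)" by (rule SM_subset[OF PMs polytab_space])
  have "act PM u g \<in> space SM" if u: "u \<in> space (SM :: ('k, _, _) gmodule)" and g: "g \<in> carrier (sym_right n)" for u g
  proof -
    let ?K = "{v \<in> space PM. act PM v g \<in> space (SM :: ('k, _, _) gmodule)}"
    have "w.subspace ?K"
      unfolding w.subspace_def
    proof (intro conjI ballI allI)
      show "0 \<in> ?K" using PM.space_zero PM.act_zero[OF g] w.subspace_0[OF sub] by simp
      fix x assume x: "x \<in> ?K"
      show "fun_scale c x \<in> ?K" for c
        using x PM.space_scale[of x c] PM.act_scale[OF _ g, of x c] w.subspace_scale[OF sub] by (simp del: PM_simps(2))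
      fix y assume y: "y \<in> ?K"
      show "x + y \<in> ?K"
        using x y PM.space_add[of x y] PM.act_add[OF _ _ g, of x y] w.subspace_add[OF sub]
        by (simp del: PM_simps(2) plus_fun_apply)
    qed
    moreover have "polytab a b c d \<in> ?K" if c: "corners a b c d" for a b c d
    proof -
      have gp: "g permutes N" using g by simp
      show ?thesis
        by (simp del: PM_simps(2) add: act_polytab[OF c gp] polytab_space[OF c] polytab_SM[OF corners_image[OF c gp]])
    qed
    ultimately have "space SM \<subseteq> ?K" by (rule SM_subset)
    then show ?thesis using u by blast
  qed
  then show ?thesis unfolding fg_submodule_def using le sub by simp
qed

lemma SM_PM: "v \<in> space (SM :: ('k::field, _, _) gmodule) \<Longrightarrow> v \<in> space PM"
  using SM_submodule unfolding fg_submodule_def by blast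

lemma SM_module: "fg_module (sym_right n) (SM :: ('k::field, _, _) gmodule)"
proof -
  interpret PM: fg_mod "sym_right n" "PM :: ('k, _, _) gmodule" using PM_module by (simp add: fg_mod_def)
  have eq: "PM\<lparr>space := space SM\<rparr> = (SM :: ('k, _, _) gmodule)" by (simp add: SM_eq)
  show ?thesis using PM.submodule_module[OF SM_submodule] unfolding eq .
qed

text \<open>
  For vectors of the permutation module: membership in the kernel of the homomorphism to the
  permutation module of shape \<open>(n - 1, 1)\<close> that sends \<open>{i, j}\<close> to \<open>i + j\<close>.
\<close>

definition zero_row_sums :: "(tableau set \<Rightarrow> 'k::field) \<Rightarrow> bool" where
  "zero_row_sums v \<longleftrightarrow> (\<forall>i\<in>N. (\<Sum>j\<in>N - {i}. v (pair_tabloid {i, j})) = 0)"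

lemma row_sum_pair_vec:
  assumes i: "i \<in> N" and B: "B \<in> pairs"
  shows "(\<Sum>j\<in>N - {i}. pair_vec B (pair_tabloid {i, j})) = (of_bool (i \<in> B) :: 'k::field)"
proof -
  have pr: "{i, j} \<in> pairs" if "j \<in> N - {i}" for j using that i by auto
  show ?thesis
  proof (cases "i \<in> B")
    case True
    obtain p q where pq: "B = {p, q}" "p \<noteq> q" using B by (auto simp: card_2_iff)
    define k where "k = (if i = p then q else p)"
    have k: "B = {i, k}" "k \<noteq> i" "k \<in> N" using pq True B by (auto simp: k_def)
    have "(\<Sum>j\<in>N - {i}. pair_vec B (pair_tabloid {i, j})) = (\<Sum>j\<in>N - {i}. if j = k then 1 else 0 :: 'k)"
    proof (rule sum.cong[OF refl])
      fix j assume j: "j \<in> N - {i}"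
      have "pair_vec B (pair_tabloid {i, j}) = (if {i, j} = B then 1 else 0 :: 'k)" by (rule pair_vec_pair_tabloid[OF pr[OF j]])
      then show "pair_vec B (pair_tabloid {i, j}) = (if j = k then 1 else 0 :: 'k)" using k by (auto simp: doubleton_eq_iff)
    qed
    also have "\<dots> = 1" using k by simp
    finally show ?thesis using True by simp
  next
    case False
    have "(\<Sum>j\<in>N - {i}. pair_vec B (pair_tabloid {i, j})) = (0 :: 'k)"
    proof (rule sum.neutral, rule ballI)
      fix j assume "j \<in> N - {i}"
      then have "pair_vec B (pair_tabloid {i, j}) = (if {i, j} = B then 1 else 0 :: 'k)" by (intro pair_vec_pair_tabloid pr)
      then show "pair_vec B (pair_tabloid {i, j}) = (0 :: 'k)" using False by auto
    qed
    then show ?thesis using False by simp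
  qed
qed

lemma zero_row_sums_polytab: "corners a b c d \<Longrightarrow> zero_row_sums (polytab a b c d)"
  unfolding zero_row_sums_def
proof
  fix i assume c: "corners a b c d" and i: "i \<in> N"
  note p = corners_pairs[OF c]
  show "(\<Sum>j\<in>N - {i}. polytab a b c d (pair_tabloid {i, j})) = 0"
    unfolding polytab_def plus_fun_apply minus_apply sum.distrib sum_subtractf
      row_sum_pair_vec[OF i p(1)] row_sum_pair_vec[OF i p(2)] row_sum_pair_vec[OF i p(3)] row_sum_pair_vec[OF i p(4)]
    using c by (simp add: corners_def)
qed

lemma zero_row_sums_subspace: "module.subspace fun_scale {v :: tableau set \<Rightarrow> 'k::field. zero_row_sums v}"
proof -
  interpret w: vector_space "fun_scale :: 'k \<Rightarrow> (tableau set \<Rightarrow> 'k) \<Rightarrow> _" by (rule vector_space_fun_scale)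
  show ?thesis unfolding w.subspace_def zero_row_sums_def
    by (auto simp: sum.distrib fun_scale_def sum_distrib_left[symmetric])
qed

lemma zero_row_sums_SM: "v \<in> space SM \<Longrightarrow> zero_row_sums v"
  using SM_subset[OF zero_row_sums_subspace] zero_row_sums_polytab by blast

text \<open>
  If a column transposition fixes the tabloid \<open>A\<close>, the coefficient of \<open>v\<close> at \<open>A\<close> equals its own negative and
  so vanishes in odd characteristic. The four remaining pairs meet each of \<open>{a, b}\<close> and \<open>{c, d}\<close> once, and the two
  transpositions permute them transitively.
\<close>

lemma antisymmetric_multiple:
  assumes c: "corners a b c d" and v: "v \<in> space PM" and two: "(2 :: 'k::field) \<noteq> 0"
    and ab: "\<And>A. A \<in> pairs \<Longrightarrow> v (pair_tabloid (transpose a b ` A)) = - (v (pair_tabloid A) :: 'k)"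
    and cd: "\<And>A. A \<in> pairs \<Longrightarrow> v (pair_tabloid (transpose c d ` A)) = - v (pair_tabloid A)"
  shows "v = fun_scale (v (pair_tabloid {b, d})) (polytab a b c d)"
proof (rule PM_ext[OF v])
  interpret PM: fg_mod "sym_right n" "PM :: ('k, _, _) gmodule" using PM_module by (simp add: fg_mod_def)
  show "fun_scale (v (pair_tabloid {b, d})) (polytab a b c d) \<in> space PM"
    using PM.space_scale[OF polytab_space[OF c]] by simp
  note p = corners_pairs[OF c]
  have dist: "distinct [a, b, c, d]" using c by (simp add: corners_def)
  have im: "transpose a b ` {b, d} = {a, d}" "transpose c d ` {b, d} = {b, c}" "transpose c d ` {a, d} = {a, c}"
    using dist by (auto simp: transpose_def)
  have vals: "v (pair_tabloid {a, d}) = - v (pair_tabloid {b, d})" "v (pair_tabloid {b, c}) = - v (pair_tabloid {b, d})" "v (pair_tabloid {a, c}) = v (pair_tabloid {b, d})"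
    using ab[OF p(1)] cd[OF p(1)] cd[OF p(2)] unfolding im by simp_all
  have zero: "z = 0" if "z = - z" for z :: 'k
  proof -
    have "2 * z = z + z" by simp
    also have "\<dots> = 0" using that by (metis add.right_inverse)
    finally show ?thesis using two by simp
  qed
  fix A assume A: "A \<in> pairs"
  have E: "polytab a b c d (pair_tabloid A) = (of_bool (A = {b, d}) - of_bool (A = {a, d}) - of_bool (A = {b, c}) + of_bool (A = {a, c}) :: 'k)"
    by (rule polytab_pair_tabloid[OF A])
  show "v (pair_tabloid A) = fun_scale (v (pair_tabloid {b, d})) (polytab a b c d) (pair_tabloid A)"
  proof (cases "(a \<in> A \<longleftrightarrow> b \<in> A) \<or> (c \<in> A \<longleftrightarrow> d \<in> A)")
    case True
    then have "transpose a b ` A = A \<or> transpose c d ` A = A" using transpose_image_eq by metis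
    then have "v (pair_tabloid A) = 0" using zero ab[OF A] cd[OF A] by metis
    moreover have "A \<noteq> {b, d}" "A \<noteq> {a, d}" "A \<noteq> {b, c}" "A \<noteq> {a, c}" using True dist by auto
    ultimately show ?thesis by (simp add: E fun_scale_def)
  next
    case False
    then obtain x y where xy: "x \<in> {a, b}" "y \<in> {c, d}" "{x, y} \<subseteq> A" by blast
    then have "x \<noteq> y" using dist by auto
    then have "A = {x, y}" using xy(3) A card_subset_eq[of A "{x, y}"] finite_subset[of A N] by simp
    then have "A = {b, d} \<or> A = {a, d} \<or> A = {b, c} \<or> A = {a, c}" using xy by auto
    then show ?thesis using dist vals by (auto simp: E fun_scale_def doubleton_eq_iff)
  qed
qed

lemma polytab_swap:
  assumes c: "corners a b c d"
  shows "act PM (polytab a b c d) (transpose a b) = (- polytab a b c d :: _ \<Rightarrow> 'k::field)"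
    "act PM (polytab a b c d) (transpose c d) = (- polytab a b c d :: _ \<Rightarrow> 'k::field)"
proof -
  have p: "transpose a b permutes N" "transpose c d permutes N"
    using c permutes_swap_id[of a N b] permutes_swap_id[of c N d] by (auto simp: corners_def)
  show "act PM (polytab a b c d) (transpose a b) = (- polytab a b c d :: _ \<Rightarrow> 'k::field)"
    unfolding act_polytab[OF c p(1)] using c by (simp add: corners_def transpose_def polytab_def fun_eq_iff)
  show "act PM (polytab a b c d) (transpose c d) = (- polytab a b c d :: _ \<Rightarrow> 'k::field)"
    unfolding act_polytab[OF c p(2)] using c by (simp add: corners_def transpose_def polytab_def fun_eq_iff)
qed

lemma act_swap_pair_tabloid:
  assumes "x \<in> N" "y \<in> N" "A \<in> pairs"
  shows "act PM v (transpose x y) (pair_tabloid A) = v (pair_tabloid (transpose x y ` A))"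
  using act_pair_tabloid[OF permutes_swap_id[OF assms(1,2)] assms(3)] by simp

text \<open>
  In a decomposition \<open>U \<oplus> W\<close> the component in \<open>U\<close> of a polytabloid \<open>e\<close> is negated by the column
  transpositions, as \<open>e\<close> is, hence a multiple of \<open>e\<close>. So \<open>e\<close>, which generates the module, lies in \<open>U\<close> or in
  \<open>W\<close>.
\<close>

lemma SM_indecomposable:
  assumes two: "(2 :: 'k::field) \<noteq> 0"
  shows "fg_indecomposable (sym_right n) (SM :: ('k, _, _) gmodule)"
proof -
  interpret SM: fg_mod "sym_right n" "SM :: ('k, _, _) gmodule" using SM_module by (simp add: fg_mod_def)
  have c: "corners 1 2 3 4" using n4 by (auto simp: corners_def)
  let ?e = "polytab 1 2 3 4 :: tableau set \<Rightarrow> 'k"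
  have eS: "?e \<in> space SM" by (rule polytab_SM[OF c])
  have e1: "?e (pair_tabloid {2, 4}) = 1"
    using polytab_pair_tabloid[OF corners_pairs(1)[OF c], of 1 2 3 4] by (simp add: doubleton_eq_iff)
  then have e0: "?e \<noteq> 0" by auto
  have gen: "space SM \<subseteq> U" if U: "fg_submodule (sym_right n) SM U" and e: "?e \<in> U" for U
  proof (rule SM_subset)
    show "module.subspace fun_scale U" using U by (simp add: fg_submodule_def)
    fix a b c' d assume "corners a b c' d"
    then obtain g where g: "g permutes N" "g 1 = a" "g 2 = b" "g 3 = c'" "g 4 = d"
      using perm_exists unfolding corners_def by metis
    have "act SM ?e g \<in> U" using U e g(1) by (simp add: fg_submodule_def)
    then show "polytab a b c' d \<in> U" unfolding SM_simps act_polytab[OF c g(1)] g(2-5) .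
  qed
  show ?thesis
    unfolding fg_indecomposable_def
  proof (intro conjI allI impI SM_module)
    show "space (SM :: ('k, _, _) gmodule) \<noteq> {0}" using eS e0 by blast
    fix U W :: "(tableau set \<Rightarrow> 'k) set" assume ds: "fg_direct_sum (sym_right n) SM U W"
    then have U: "fg_submodule (sym_right n) SM U" and W: "fg_submodule (sym_right n) SM W"
      and I: "U \<inter> W = {0}" and sum: "space SM = {u + w |u w. u \<in> U \<and> w \<in> W}"
      by (auto simp: fg_direct_sum_def)
    have Us: "U \<subseteq> space SM" "SM.vs.subspace U" and Ws: "W \<subseteq> space SM" "SM.vs.subspace W"
      using U W by (auto simp: fg_submodule_def)
    obtain u w where uw: "u \<in> U" "w \<in> W" "?e = u + w" using eS sum by blast
    have anti: "act SM u s = - u" if s: "s \<in> carrier (sym_right n)" "act PM ?e s = - ?e" for s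
    proof -
      have us: "u \<in> space SM" "w \<in> space SM" using uw Us Ws by auto
      have "act SM u s + act SM w s = - u - w"
        using s(2) SM.act_add[OF us s(1)] unfolding uw(3) by (simp del: SM_simps(2) plus_fun_apply add: SM_simps(2)[symmetric])
      have "act SM u s + u + (act SM w s + w) = (act SM u s + act SM w s) + (u + w)" by (simp only: ac_simps)
      also have "\<dots> = 0" unfolding \<open>act SM u s + act SM w s = - u - w\<close> by (simp add: fun_eq_iff)
      finally have eq: "act SM u s + u = - (act SM w s + w)" by (simp only: eq_neg_iff_add_eq_0)
      have "act SM u s + u \<in> U" using U uw(1) s(1) SM.vs.subspace_add[OF Us(2)] by (simp add: fg_submodule_def)
      moreover have "- (act SM w s + w) \<in> W"
        by (rule SM.vs.subspace_neg[OF Ws(2) SM.vs.subspace_add[OF Ws(2) _ uw(2)]])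
          (use W uw(2) s(1) in \<open>simp add: fg_submodule_def\<close>)
      ultimately have "act SM u s + u \<in> U \<inter> W" unfolding eq by (rule IntI)
      then have "act SM u s + u = 0" unfolding I by blast
      then show ?thesis by (simp add: eq_neg_iff_add_eq_0)
    qed
    have N4: "1 \<in> N" "2 \<in> N" "3 \<in> N" "4 \<in> N" using n4 by auto
    have "u = fun_scale (u (pair_tabloid {2, 4})) ?e"
    proof (rule antisymmetric_multiple[OF c _ two])
      show "u \<in> space PM" using uw(1) Us(1) SM_PM by blast
      fix A assume A: "A \<in> pairs"
      have "act SM u (transpose 1 2) = - u"
        using permutes_swap_id[OF N4(1,2)] polytab_swap(1)[OF c] by (intro anti) simp_all
      moreover have "act SM u (transpose 3 4) = - u"
        using permutes_swap_id[OF N4(3,4)] polytab_swap(2)[OF c] by (intro anti) simp_all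
      ultimately show "u (pair_tabloid (transpose 1 2 ` A)) = - u (pair_tabloid A)" "u (pair_tabloid (transpose 3 4 ` A)) = - u (pair_tabloid A)"
        using act_swap_pair_tabloid[OF N4(1,2) A, of u] act_swap_pair_tabloid[OF N4(3,4) A, of u] by simp_all
    qed
    then obtain x where x: "u = fun_scale x ?e" by blast
    show "U = {0} \<or> W = {0}"
    proof (cases "x = 0")
      case True
      then have "u = 0" using x by (simp add: fun_scale_def fun_eq_iff)
      then have "?e \<in> W" using uw by simp
      then have "U \<subseteq> W" using gen[OF W] Us by blast
      then show ?thesis using I SM.vs.subspace_0[OF Us(2)] by blast
    next
      case False
      then have "?e = fun_scale (inverse x) u" unfolding x by (simp add: fun_scale_def fun_eq_iff)
      then have "?e \<in> U" using SM.vs.subspace_scale[OF Us(2) uw(1), of "inverse x"] by simp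
      then have "W \<subseteq> U" using gen[OF U] Ws by blast
      then show ?thesis using I SM.vs.subspace_0[OF Ws(2)] by blast
    qed
  qed
qed

end

section \<open>The transfer of the column antisymmetrizer\<close>

context two_row
begin

abbreviation "SG \<equiv> sym_right n"

lemma SM_finite_fg_mod: "finite_fg_mod SG (SM :: ('k::field, _, _) gmodule)"
  using SM_module sym_right_finite_group unfolding finite_fg_mod_def fg_mod_def by blast

definition one_minus_swap :: "nat \<Rightarrow> nat \<Rightarrow> (nat \<Rightarrow> nat) \<Rightarrow> 'k::field" where
  "one_minus_swap x y = group_elem id + fun_scale (- 1) (group_elem (transpose x y))"

text \<open>
  The column antisymmetrizer \<open>(1 - (a b))(1 - (c d))\<close>.
\<close>

definition col_antisym :: "nat \<Rightarrow> nat \<Rightarrow> nat \<Rightarrow> nat \<Rightarrow> (nat \<Rightarrow> nat) \<Rightarrow> 'k::field" where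
  "col_antisym a b c d = one_minus_swap a b \<otimes>\<^bsub>group_algebra SG\<^esub> one_minus_swap c d"

definition point_stab :: "(nat \<Rightarrow> nat) set" where
  "point_stab = {h. h permutes N \<and> h 1 = 1 \<and> h 2 = 2 \<and> h 3 = 3 \<and> h 4 = 4}"

lemma point_stab_subgroup: "subgroup point_stab SG"
proof (rule group.subgroupI[OF sym_right_group])
  show "point_stab \<noteq> {}" by (auto simp: point_stab_def permutes_id intro!: exI[of _ id])
  fix g assume g: "g \<in> point_stab"
  then have gp: "g permutes N" by (simp add: point_stab_def)
  have "inv' g x = x" if "g x = x" for x using permutes_inverses(2)[OF gp, of x] that by simp
  then show "inv\<^bsub>SG\<^esub> g \<in> point_stab"
    using g permutes_inv[OF gp] by (simp add: sym_right_inv[OF gp] point_stab_def)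
qed (auto simp: point_stab_def permutes_compose)

lemma conj_one_minus_swap:
  assumes t: "t permutes N" and xy: "x \<in> N" "y \<in> N"
  shows "finite_group.conj_elem SG t (one_minus_swap x y) = (one_minus_swap (t x) (t y) :: _ \<Rightarrow> 'k::field)"
proof -
  interpret FG: finite_group SG by (rule sym_right_finite_group)
  have ge: "FG.conj_elem t (group_elem g) = (group_elem (t \<circ> g \<circ> inv' t) :: _ \<Rightarrow> 'k)" if g: "g permutes N" for g
  proof -
    have c: "t \<in> carrier SG" "inv' t \<in> carrier SG" "g \<in> carrier SG" "g \<circ> inv' t \<in> carrier SG"
      using t g permutes_inv[OF t] permutes_compose[OF permutes_inv[OF t] g] by simp_all
    show ?thesis
      unfolding FG.conj_elem_def sym_right_inv[OF t] FG.group_elem_mult[OF c(2,3)] sym_right_simps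
        FG.group_elem_mult[OF c(4,1), unfolded sym_right_simps]
      by (simp add: comp_assoc)
  qed
  have "t \<circ> transpose x y \<circ> inv' t = transpose (t x) (t y)"
  proof
    fix z
    have "t (inv' t z) = z" "inj t" using permutes_inverses(1)[OF t] permutes_inj[OF t] by auto
    then show "(t \<circ> transpose x y \<circ> inv' t) z = transpose (t x) (t y) z"
      by (auto simp: transpose_def)
  qed
  moreover have "t \<circ> id \<circ> inv' t = id" using permutes_inv_o(1)[OF t] by simp
  moreover have "FG.conj_elem t (one_minus_swap x y) = FG.conj_elem t (group_elem id)
      + (fun_scale (- 1) (FG.conj_elem t (group_elem (transpose x y))) :: _ \<Rightarrow> 'k)"
    unfolding FG.conj_elem_def one_minus_swap_def FG.conv_add_left FG.conv_add_right FG.conv_scale_left FG.conv_scale_right ..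
  ultimately show ?thesis
    unfolding ge[OF permutes_id] ge[OF permutes_swap_id[OF xy]] one_minus_swap_def by simp
qed

lemma conj_col_antisym:
  assumes t: "t permutes N" and c: "corners a b c d"
  shows "finite_group.conj_elem SG t (col_antisym a b c d) = (col_antisym (t a) (t b) (t c) (t d) :: _ \<Rightarrow> 'k::field)"
proof -
  interpret FG: finite_group SG by (rule sym_right_finite_group)
  have tc: "t \<in> carrier SG" using t by simp
  have N: "a \<in> N" "b \<in> N" "c \<in> N" "d \<in> N" using c by (auto simp: corners_def)
  show ?thesis unfolding col_antisym_def FG.conj_elem_conv[OF tc] conj_one_minus_swap[OF t N(1,2)] conj_one_minus_swap[OF t N(3,4)] ..
qed

lemma transpose_image_twice: "transpose x y ` transpose x y ` A = A"
  by (simp add: image_comp)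

lemma aact_one_minus_swap_pair_tabloid:
  assumes v: "v \<in> space (SM :: ('k::field, _, _) gmodule)" and xy: "x \<in> N" "y \<in> N" and A: "A \<in> pairs"
  shows "algebra_act SG SM v (one_minus_swap x y) (pair_tabloid A) = v (pair_tabloid A) - v (pair_tabloid (transpose x y ` A))"
proof -
  interpret M: finite_fg_mod SG "SM :: ('k, _, _) gmodule" by (rule SM_finite_fg_mod)
  have c: "transpose x y \<in> carrier SG" "id \<in> carrier SG" using permutes_swap_id[OF xy] permutes_id by simp_all
  have "algebra_act SG SM v (one_minus_swap x y) = act SM v id + fun_scale (- 1) (act SM v (transpose x y))"
    unfolding one_minus_swap_def M.aact_add_right M.aact_scale_right M.aact_group_elem[OF c(1)] M.aact_group_elem[OF c(2)] by simp
  moreover have "act SM v id = v" using M.act_one[OF v] by simp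
  ultimately show ?thesis using act_swap_pair_tabloid[OF xy A, of v] by (simp add: fun_scale_def)
qed

text \<open>
  The inner product with \<open>polytab a b c d\<close>, for the form that makes the tabloids orthonormal.
\<close>

definition pairing :: "nat \<Rightarrow> nat \<Rightarrow> nat \<Rightarrow> nat \<Rightarrow> (tableau set \<Rightarrow> 'k::field) \<Rightarrow> 'k" where
  "pairing a b c d v = v (pair_tabloid {b, d}) - v (pair_tabloid {a, d}) - v (pair_tabloid {b, c}) + v (pair_tabloid {a, c})"

text \<open>
  The column transpositions negate the left-hand side, so \<open>antisymmetric_multiple\<close> applies; the factor
  is read off at the tabloid \<open>{b, d}\<close>.
\<close>

lemma aact_col_antisym:
  assumes v: "v \<in> space (SM :: ('k::field, _, _) gmodule)" and c: "corners a b c d" and two: "(2 :: 'k) \<noteq> 0"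
  shows "algebra_act SG SM v (col_antisym a b c d) = fun_scale (pairing a b c d v) (polytab a b c d)"
proof -
  interpret M: finite_fg_mod SG "SM :: ('k, _, _) gmodule" by (rule SM_finite_fg_mod)
  have N: "a \<in> N" "b \<in> N" "c \<in> N" "d \<in> N" and dist: "distinct [a, b, c, d]" using c by (auto simp: corners_def)
  define w where "w = algebra_act SG SM v (one_minus_swap a b)"
  define u where "u = algebra_act SG SM v (col_antisym a b c d)"
  have wS: "w \<in> space SM" unfolding w_def by (rule M.aact_closed[OF v])
  have uw: "u = algebra_act SG SM w (one_minus_swap c d)" unfolding u_def w_def col_antisym_def by (rule M.aact_conv[OF v])
  have uS: "u \<in> space SM" unfolding uw by (rule M.aact_closed[OF wS])
  have tA: "transpose x y ` A \<in> pairs" if "A \<in> pairs" "x \<in> N" "y \<in> N" for A x y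
    by (rule image_pairs[OF permutes_swap_id[OF that(2,3)] that(1)])
  have w: "w (pair_tabloid A) = v (pair_tabloid A) - v (pair_tabloid (transpose a b ` A))" if "A \<in> pairs" for A
    unfolding w_def by (rule aact_one_minus_swap_pair_tabloid[OF v N(1,2) that])
  have u: "u (pair_tabloid A) = w (pair_tabloid A) - w (pair_tabloid (transpose c d ` A))" if "A \<in> pairs" for A
    unfolding uw by (rule aact_one_minus_swap_pair_tabloid[OF wS N(3,4) that])
  have comm: "transpose a b ` transpose c d ` A = transpose c d ` transpose a b ` A" for A
    unfolding image_comp by (rule image_cong[OF refl]) (use dist in \<open>auto simp: transpose_def\<close>)
  have "u = fun_scale (u (pair_tabloid {b, d})) (polytab a b c d)"
  proof (rule antisymmetric_multiple[OF c SM_PM[OF uS] two])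
    fix A assume A: "A \<in> pairs"
    show "u (pair_tabloid (transpose c d ` A)) = - u (pair_tabloid A)"
      using u[OF A] u[OF tA[OF A N(3,4)]] by (simp add: transpose_image_twice)
    show "u (pair_tabloid (transpose a b ` A)) = - u (pair_tabloid A)"
      using u[OF A] u[OF tA[OF A N(1,2)]] w[OF A] w[OF tA[OF A N(1,2)]] w[OF tA[OF A N(3,4)]]
        w[OF tA[OF tA[OF A N(1,2)] N(3,4)]]
      by (simp add: transpose_image_twice comm[symmetric])
  qed
  moreover have "u (pair_tabloid {b, d}) = pairing a b c d v"
  proof -
    note p = corners_pairs[OF c]
    have im: "transpose c d ` {b, d} = {b, c}" "transpose a b ` {b, d} = {a, d}" "transpose a b ` {b, c} = {a, c}"
      using dist by (auto simp: transpose_def)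
    show ?thesis using u[OF p(1)] w[OF p(1)] w[OF p(3)] unfolding im by (simp add: pairing_def)
  qed
  ultimately show ?thesis unfolding u_def by simp
qed

lemma transversal_corners:
  assumes T: "right_transversal SG point_stab T"
  shows "bij_betw (\<lambda>t. (t 1, t 2, t 3, t 4)) T {(a, b, c, d). corners a b c d}"
proof (rule bij_betw_imageI)
  interpret FG: finite_group SG by (rule sym_right_finite_group)
  have Tp: "t permutes N" if "t \<in> T" for t using T that by (auto simp: right_transversal_def)
  have c0: "corners 1 2 3 4" using n4 by (auto simp: corners_def)
  show "inj_on (\<lambda>t. (t 1, t 2, t 3, t 4)) T"
  proof (rule inj_onI)
    fix t s assume ts: "t \<in> T" "s \<in> T" and eq: "(t 1, t 2, t 3, t 4) = (s 1, s 2, s 3, s 4)"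
    note tp = Tp[OF ts(1)] and sp = Tp[OF ts(2)]
    define h where "h = inv' s \<circ> t"
    have "h \<in> point_stab"
      using eq permutes_inverses(2)[OF sp] permutes_compose[OF tp permutes_inv[OF sp]]
      by (simp add: point_stab_def h_def)
    moreover have "t = h \<otimes>\<^bsub>SG\<^esub> s"
      using permutes_inverses(1)[OF sp] by (simp add: h_def fun_eq_iff)
    ultimately show "t = s" by (rule FG.transversal_unique[OF T point_stab_subgroup ts])
  qed
  show "(\<lambda>t. (t 1, t 2, t 3, t 4)) ` T = {(a, b, c, d). corners a b c d}"
  proof (intro equalityI subsetI)
    fix q assume "q \<in> (\<lambda>t. (t 1, t 2, t 3, t 4)) ` T"
    then show "q \<in> {(a, b, c, d). corners a b c d}" using corners_image[OF c0] Tp by auto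
  next
    fix q assume "q \<in> {(a, b, c, d). corners a b c d}"
    then obtain a b c d where q: "q = (a, b, c, d)" "corners a b c d" by auto
    obtain g where g: "g permutes N" "g 1 = a" "g 2 = b" "g 3 = c" "g 4 = d"
      using perm_exists q(2) unfolding corners_def by metis
    have "g \<in> carrier SG" using g by simp
    then obtain h t where ht: "h \<in> point_stab" "t \<in> T" "g = h \<otimes>\<^bsub>SG\<^esub> t"
      by (rule FG.transversal_factor[OF T point_stab_subgroup])
    have "q = (t 1, t 2, t 3, t 4)" using g(2-5) ht(1) unfolding ht(3) q(1) by (simp add: point_stab_def)
    then show "q \<in> (\<lambda>t. (t 1, t 2, t 3, t 4)) ` T" using ht(2) by blast
  qed
qed

text \<open>
  A transversal of the pointwise stabilizer of \<open>1, 2, 3, 4\<close> runs through all choices of the first two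
  columns, so the transfer is the frame operator evaluated in \<open>frame_sum\<close>.
\<close>

lemma transfer_col_antisym:
  assumes T: "right_transversal SG point_stab T" and two: "(2 :: 'k::field) \<noteq> 0"
    and v: "v \<in> space (SM :: ('k, _, _) gmodule)"
  shows "(\<Sum>t\<in>T. algebra_act SG SM v (finite_group.conj_elem SG t (col_antisym 1 2 3 4)))
     = fun_scale (8 * (of_nat n - 1) * (of_nat n - 2)) v"
proof (rule PM_ext)
  interpret M: finite_fg_mod SG "SM :: ('k, _, _) gmodule" by (rule SM_finite_fg_mod)
  have Tp: "t permutes N" if "t \<in> T" for t using T that by (auto simp: right_transversal_def)
  have c0: "corners 1 2 3 4" using n4 by (auto simp: corners_def)
  have "(\<Sum>t\<in>T. algebra_act SG SM v (M.conj_elem t (col_antisym 1 2 3 4))) \<in> space SM"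
    by (intro M.space_sum M.aact_closed v)
  then show "(\<Sum>t\<in>T. algebra_act SG SM v (M.conj_elem t (col_antisym 1 2 3 4))) \<in> space PM" by (rule SM_PM)
  have "scale SM (8 * (of_nat n - 1) * (of_nat n - 2)) v \<in> space SM" by (rule M.space_scale[OF v])
  then show "fun_scale (8 * (of_nat n - 1) * (of_nat n - 2)) v \<in> space PM" unfolding SM_simps by (rule SM_PM)
  fix A assume A: "A \<in> pairs"
  obtain x y where xy: "A = {x, y}" "x \<noteq> y" "x \<in> N" "y \<in> N" using A by (auto simp: card_2_iff)
  let ?C = "{(a, b, c, d). distinct [a, b, c, d] \<and> {a, b, c, d} \<subseteq> N}"
  let ?F = "\<lambda>(a, b, c, d). pairing a b c d v * polytab a b c d (pair_tabloid A)"
  have "algebra_act SG SM v (M.conj_elem t (col_antisym 1 2 3 4)) (pair_tabloid A) = ?F (t 1, t 2, t 3, t 4)" if t: "t \<in> T" for t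
    unfolding conj_col_antisym[OF Tp[OF t] c0] aact_col_antisym[OF v corners_image[OF c0 Tp[OF t]] two]
    by (simp add: fun_scale_def)
  then have "(\<Sum>t\<in>T. algebra_act SG SM v (M.conj_elem t (col_antisym 1 2 3 4))) (pair_tabloid A) = (\<Sum>t\<in>T. ?F (t 1, t 2, t 3, t 4))"
    unfolding sum_fun_apply by (rule sum.cong[OF refl])
  also have "\<dots> = sum ?F {(a, b, c, d). corners a b c d}"
    by (rule sum.reindex_bij_betw[OF transversal_corners[OF T]])
  also have "{(a, b, c, d). corners a b c d} = ?C" unfolding corners_def ..
  also have "sum ?F ?C = (\<Sum>q\<in>?C. (case q of (a, b, c, d) \<Rightarrow> v (pair_tabloid {b, d}) - v (pair_tabloid {a, d}) - v (pair_tabloid {b, c}) + v (pair_tabloid {a, c}))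
      * (case q of (a, b, c, d) \<Rightarrow> of_bool ({x, y} = {b, d}) - of_bool ({x, y} = {a, d})
            - of_bool ({x, y} = {b, c}) + of_bool ({x, y} = {a, c})))"
  proof (rule sum.cong[OF refl])
    fix q :: "nat \<times> nat \<times> nat \<times> nat"
    obtain a b c d where q: "q = (a, b, c, d)" by (cases q)
    have "polytab a b c d (pair_tabloid A) = (of_bool ({x, y} = {b, d}) - of_bool ({x, y} = {a, d})
            - of_bool ({x, y} = {b, c}) + of_bool ({x, y} = {a, c}) :: 'k)"
      unfolding xy(1)[symmetric] by (rule polytab_pair_tabloid[OF A])
    then show "?F q = (case q of (a, b, c, d) \<Rightarrow> v (pair_tabloid {b, d}) - v (pair_tabloid {a, d}) - v (pair_tabloid {b, c}) + v (pair_tabloid {a, c}))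
      * (case q of (a, b, c, d) \<Rightarrow> of_bool ({x, y} = {b, d}) - of_bool ({x, y} = {a, d})
            - of_bool ({x, y} = {b, c}) + of_bool ({x, y} = {a, c}))"
      unfolding q by (simp add: pairing_def)
  qed
  also have "\<dots> = 8 * (of_nat (card N) - 1) * (of_nat (card N) - 2) * v (pair_tabloid {x, y})"
  proof (rule frame_sum)
    show "(\<Sum>j\<in>N - {i}. v (pair_tabloid {i, j})) = 0" if "i \<in> N" for i
      using zero_row_sums_SM[OF v] that unfolding zero_row_sums_def by blast
  qed (use xy in \<open>simp_all add: insert_commute\<close>)
  finally show "(\<Sum>t\<in>T. algebra_act SG SM v (M.conj_elem t (col_antisym 1 2 3 4))) (pair_tabloid A)
      = fun_scale (8 * (of_nat n - 1) * (of_nat n - 2)) v (pair_tabloid A)"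
    by (simp add: xy(1) fun_scale_def)
qed

text \<open>
  The group \<open>P\<close> fixes \<open>e = polytab 1 2 3 4\<close> and the functional \<open>\<langle>-, e\<rangle>\<close>, whose value at \<open>e\<close> is 4.
\<close>

lemma point_stab_bound:
  assumes two: "(2 :: 'k::field) \<noteq> 0" and P: "subgroup P SG" "P \<subseteq> point_stab"
    and p: "prime p" "CHAR('k) = p" "card P = p ^ k"
    and R: "rel_projective SG R (SM :: ('k, _, _) gmodule)"
  shows "\<exists>g\<in>carrier SG. \<forall>h\<in>P. g \<otimes>\<^bsub>SG\<^esub> h \<otimes>\<^bsub>SG\<^esub> inv\<^bsub>SG\<^esub> g \<in> R"
proof -
  interpret M: finite_fg_mod SG "SM :: ('k, _, _) gmodule" by (rule SM_finite_fg_mod)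
  have c: "corners 1 2 3 4" using n4 by (auto simp: corners_def)
  note pr = corners_pairs[OF c]
  let ?e = "polytab 1 2 3 4 :: tableau set \<Rightarrow> 'k"
  show ?thesis
  proof (rule M.fixed_functional_bound[OF M.fin P(1) p R, where e = ?e and l = "pairing 1 2 3 4"])
    show "?e \<in> space SM" by (rule polytab_SM[OF c])
    show "act SM ?e h = ?e" if "h \<in> P" for h
    proof -
      have h: "h \<in> point_stab" using that P(2) by blast
      then have "h permutes N" by (simp add: point_stab_def)
      then show ?thesis unfolding SM_simps act_polytab[OF c \<open>h permutes N\<close>] using h by (simp add: point_stab_def)
    qed
    show "pairing 1 2 3 4 (v + w) = pairing 1 2 3 4 v + (pairing 1 2 3 4 w :: 'k)" for v w
      by (simp add: pairing_def algebra_simps)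
    show "pairing 1 2 3 4 (act SM v h) = (pairing 1 2 3 4 v :: 'k)" if "h \<in> P" for v h
    proof -
      have h: "h permutes N" "h 1 = 1" "h 2 = 2" "h 3 = 3" "h 4 = 4" using that P(2) by (auto simp: point_stab_def)
      have "inv' h x = x" if "h x = x" for x using permutes_inverses(2)[OF h(1), of x] that by simp
      then have i: "inv' h 1 = 1" "inv' h 2 = 2" "inv' h 3 = 3" "inv' h 4 = 4" using h by blast+
      show ?thesis
        unfolding pairing_def SM_simps act_pair_tabloid[OF h(1) pr(1)] act_pair_tabloid[OF h(1) pr(2)] act_pair_tabloid[OF h(1) pr(3)] act_pair_tabloid[OF h(1) pr(4)]
          image_insert image_empty i ..
    qed
    have "pairing 1 2 3 4 ?e = 2 * 2"
      unfolding pairing_def polytab_pair_tabloid[OF pr(1)] polytab_pair_tabloid[OF pr(2)] polytab_pair_tabloid[OF pr(3)] polytab_pair_tabloid[OF pr(4)]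
      by (simp add: doubleton_eq_iff)
    then show "pairing 1 2 3 4 ?e \<noteq> 0" using two by (metis no_zero_divisors)
  qed
qed

end

section \<open>The dimension of the Specht module and its vertices\<close>

context two_row
begin

text \<open>
  A vector with vanishing row sums is determined by its coefficients at the pairs that avoid \<open>1\<close> and
  differ from \<open>{2, 3}\<close>: the row sums of \<open>j \<ge> 4\<close> give the coefficients at \<open>{1, j}\<close>, and then those of \<open>1, 2, 3\<close>
  give the coefficients on the triangle \<open>{1, 2}, {1, 3}, {2, 3}\<close>, since 2 is invertible.
\<close>

definition basis_pairs :: "nat set set" where
  "basis_pairs = {A. A \<subseteq> {2..n} \<and> card A = 2} - {{2, 3}}"

text \<open>
  The vector with vanishing row sums that has coefficient 1 at \<open>A\<close> and 0 at the other pairs of the index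
  set.
\<close>

definition basis_vec :: "nat set \<Rightarrow> tableau set \<Rightarrow> 'k::field" where
  "basis_vec A = pair_vec A - (\<Sum>i\<in>A. pair_vec {1, i}) + pair_vec {1, 2} + pair_vec {1, 3} - pair_vec {2, 3}"

lemma finite_basis_pairs: "finite basis_pairs"
  unfolding basis_pairs_def by (rule finite_Diff, rule finite_subset[of _ "Pow {2..n}"]) auto

lemma basis_pairs_pairs: "A \<in> basis_pairs \<Longrightarrow> A \<in> pairs"
  unfolding basis_pairs_def by auto

lemma basis_vec_pair:
  assumes "i \<noteq> j"
  shows "basis_vec {i, j} = pair_vec {i, j} - pair_vec {1, i} - pair_vec {1, j} + pair_vec {1, 2} + pair_vec {1, 3} - pair_vec {2, 3}"
  using assms by (simp add: basis_vec_def fun_eq_iff)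

text \<open>
  The vector for \<open>{i, j}\<close> is a polytabloid if \<open>i\<close> is 2 or 3, and a sum of two if both entries are at least 4.
\<close>

lemma basis_vec_SM:
  assumes A: "A \<in> basis_pairs"
  shows "(basis_vec A :: tableau set \<Rightarrow> 'k::field) \<in> space SM"
proof -
  interpret SM: fg_mod SG "SM :: ('k, _, _) gmodule" using SM_module by (simp add: fg_mod_def)
  have small: "(basis_vec {i, j} :: _ \<Rightarrow> 'k) \<in> space SM"
    if ij: "i < j" "2 \<le> i" "j \<le> n" "{i, j} \<noteq> {2, 3}" for i j
  proof -
    have j4: "4 \<le> j"
    proof (rule ccontr)
      assume "\<not> 4 \<le> j"
      then have "i = 2" "j = 3" using ij by linarith+
      then show False using ij(4) by simp
    qed
    consider "i = 2" | "i = 3" | "4 \<le> i" using ij(2) by linarith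
    then show ?thesis
    proof cases
      case 1
      have "corners 1 2 3 j" using j4 ij by (auto simp: corners_def)
      then have "(polytab 1 2 3 j :: _ \<Rightarrow> 'k) \<in> space SM" by (rule polytab_SM)
      moreover have "basis_vec {i, j} = (polytab 1 2 3 j :: _ \<Rightarrow> 'k)"
        unfolding basis_vec_pair[OF less_imp_neq[OF ij(1)]] unfolding 1 by (simp add: polytab_def fun_eq_iff insert_commute)
      ultimately show ?thesis by simp
    next
      case 2
      have "corners 1 3 2 j" using j4 ij by (auto simp: corners_def)
      then have "(polytab 1 3 2 j :: _ \<Rightarrow> 'k) \<in> space SM" by (rule polytab_SM)
      moreover have "basis_vec {i, j} = (polytab 1 3 2 j :: _ \<Rightarrow> 'k)"
        unfolding basis_vec_pair[OF less_imp_neq[OF ij(1)]] unfolding 2 by (simp add: polytab_def fun_eq_iff insert_commute)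
      ultimately show ?thesis by simp
    next
      case 3
      have "corners 2 i 1 j" "corners 1 2 3 j" using 3 j4 ij by (auto simp: corners_def)
      then have "polytab 2 i 1 j + (polytab 1 2 3 j :: _ \<Rightarrow> 'k) \<in> space SM"
        by (intro SM.space_add polytab_SM)
      moreover have "basis_vec {i, j} = polytab 2 i 1 j + (polytab 1 2 3 j :: _ \<Rightarrow> 'k)"
        unfolding basis_vec_pair[OF less_imp_neq[OF ij(1)]] by (simp add: polytab_def fun_eq_iff insert_commute)
      ultimately show ?thesis by simp
    qed
  qed
  have A': "card A = 2" "A \<subseteq> {2..n}" "A \<noteq> {2, 3}" using A by (auto simp: basis_pairs_def)
  obtain i j where "A = {i, j}" "i \<noteq> j" using A'(1) by (auto simp: card_2_iff)
  then have ij: "A = {i, j}" "i \<noteq> j" "i \<in> {2..n}" "j \<in> {2..n}" "{i, j} \<noteq> {2, 3}" using A' by auto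
  show ?thesis
  proof (cases "i < j")
    case True
    then show ?thesis using small[of i j] ij by simp
  next
    case False
    then have "j < i" using ij(2) by simp
    then show ?thesis using small[of j i] ij by (simp add: insert_commute)
  qed
qed

lemma basis_vec_pair_tabloid:
  assumes A: "A \<in> basis_pairs" and B: "B \<in> basis_pairs"
  shows "basis_vec A (pair_tabloid B) = (of_bool (A = B) :: 'k::field)"
proof -
  have BP: "B \<in> pairs" by (rule basis_pairs_pairs[OF B])
  obtain i j where ij: "A = {i, j}" "i \<noteq> j" using A by (auto simp: basis_pairs_def card_2_iff)
  have ne: "1 \<notin> B" "B \<noteq> {2, 3}" using B by (auto simp: basis_pairs_def)
  have e: "basis_vec A (pair_tabloid B) = pair_vec A (pair_tabloid B) - pair_vec {1, i} (pair_tabloid B) - pair_vec {1, j} (pair_tabloid B) + pair_vec {1, 2} (pair_tabloid B)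
      + pair_vec {1, 3} (pair_tabloid B) - (pair_vec {2, 3} (pair_tabloid B) :: 'k)"
    unfolding ij(1) basis_vec_pair[OF ij(2)] by simp
  have "B \<noteq> {1, z}" for z using ne(1) by auto
  then show ?thesis unfolding e pair_vec_pair_tabloid[OF BP] using ne(2) by auto
qed

lemma zero_row_sums_zero:
  assumes w: "zero_row_sums (w :: tableau set \<Rightarrow> 'k::field)" "w \<in> space PM" and two: "(2 :: 'k) \<noteq> 0"
    and z: "\<And>A. A \<in> basis_pairs \<Longrightarrow> w (pair_tabloid A) = 0"
  shows "w = 0"
proof -
  interpret PM: fg_mod SG "PM :: ('k, _, _) gmodule" using PM_module by (simp add: fg_mod_def)
  have row: "(\<Sum>j\<in>N - {i}. w (pair_tabloid {i, j})) = 0" if "i \<in> N" for i using w(1) that by (auto simp: zero_row_sums_def)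
  have z': "w (pair_tabloid {i, j}) = 0" if "i \<in> {2..n}" "j \<in> {2..n}" "i \<noteq> j" "{i, j} \<noteq> {2, 3}" for i j
    by (rule z) (use that in \<open>auto simp: basis_pairs_def\<close>)
  have rest: "(\<Sum>j\<in>N - {i}. w (pair_tabloid {i, j})) = (\<Sum>j\<in>J. w (pair_tabloid {i, j}))"
    if "J \<subseteq> N - {i}" "\<And>j. j \<in> N - {i} - J \<Longrightarrow> w (pair_tabloid {i, j}) = 0" for i J
    by (rule sum.mono_neutral_right) (use that in auto)
  have r4: "w (pair_tabloid {1, j}) = 0" if j: "4 \<le> j" "j \<le> n" for j
  proof -
    have "(\<Sum>k\<in>N - {j}. w (pair_tabloid {j, k})) = (\<Sum>k\<in>{1}. w (pair_tabloid {j, k}))"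
      by (rule rest) (use j in \<open>auto intro!: z' simp: doubleton_eq_iff\<close>)
    then show ?thesis using row[of j] j by (simp add: insert_commute)
  qed
  define x where "x = w (pair_tabloid {1, 2})"
  have r1: "w (pair_tabloid {1, 2}) + w (pair_tabloid {1, 3}) = 0"
  proof -
    have "(\<Sum>k\<in>N - {1}. w (pair_tabloid {1, k})) = (\<Sum>k\<in>{2, 3}. w (pair_tabloid {1, k}))"
    proof (rule rest)
      fix k assume "k \<in> N - {1} - {2, 3}"
      then have "4 \<le> k" "k \<le> n" by auto
      then show "w (pair_tabloid {1, k}) = 0" by (rule r4)
    qed (use n4 in auto)
    then show ?thesis using row[of 1] n4 by simp
  qed
  have r2: "w (pair_tabloid {1, 2}) + w (pair_tabloid {2, 3}) = 0"
  proof -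
    have "(\<Sum>k\<in>N - {2}. w (pair_tabloid {2, k})) = (\<Sum>k\<in>{1, 3}. w (pair_tabloid {2, k}))"
      by (rule rest) (use n4 in \<open>auto intro!: z' simp: doubleton_eq_iff\<close>)
    then show ?thesis using row[of 2] n4 by (simp add: insert_commute)
  qed
  have r3: "w (pair_tabloid {1, 3}) + w (pair_tabloid {2, 3}) = 0"
  proof -
    have "(\<Sum>k\<in>N - {3}. w (pair_tabloid {3, k})) = (\<Sum>k\<in>{1, 2}. w (pair_tabloid {3, k}))"
      by (rule rest) (use n4 in \<open>auto intro!: z' simp: doubleton_eq_iff\<close>)
    then show ?thesis using row[of 3] n4 by (simp add: insert_commute)
  qed
  have "w (pair_tabloid {1, 3}) = - x" "w (pair_tabloid {2, 3}) = - x" using r1 r2 by (simp_all add: x_def add_eq_0_iff)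
  then have "2 * x = 0" using r3 by simp
  then have x0: "w (pair_tabloid {1, 2}) = 0" "w (pair_tabloid {1, 3}) = 0" "w (pair_tabloid {2, 3}) = 0"
    using two \<open>w (pair_tabloid {1, 3}) = - x\<close> \<open>w (pair_tabloid {2, 3}) = - x\<close> by (simp_all add: x_def)
  show ?thesis
  proof (rule PM_ext[OF w(2)])
    show "(0 :: tableau set \<Rightarrow> 'k) \<in> space PM" by (rule PM.space_zero)
    fix A assume A: "A \<in> pairs"
    have "w (pair_tabloid {i, j}) = 0" if ij: "i < j" "i \<in> N" "j \<in> N" for i j
    proof (cases "i = 1")
      case True
      then consider "j = 2" | "j = 3" | "4 \<le> j" using ij by fastforce
      then show ?thesis using True x0 r4[of j] ij by cases auto
    next
      case False
      then show ?thesis using z'[of i j] x0(3) ij by (cases "{i, j} = {2, 3}") auto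
    qed
    moreover obtain i j where "A = {i, j}" "i < j" "i \<in> N" "j \<in> N"
    proof -
      obtain i j where "A = {i, j}" "i \<noteq> j" "i \<in> N" "j \<in> N" using A by (auto simp: card_2_iff)
      then show ?thesis using that[of i j] that[of j i] by (cases "i < j") (auto simp: insert_commute)
    qed
    ultimately show "w (pair_tabloid A) = 0 (pair_tabloid A)" by simp
  qed
qed

lemma dual_expansion:
  assumes v: "v \<in> space (SM :: ('k::field, _, _) gmodule)" and two: "(2 :: 'k) \<noteq> 0"
  shows "v = (\<Sum>A\<in>basis_pairs. fun_scale (v (pair_tabloid A)) (basis_vec A))"
proof -
  interpret SM: fg_mod SG "SM :: ('k, _, _) gmodule" using SM_module by (simp add: fg_mod_def)
  define s where "s = (\<Sum>A\<in>basis_pairs. fun_scale (v (pair_tabloid A)) (basis_vec A :: _ \<Rightarrow> 'k))"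
  have "fun_scale c (basis_vec A) \<in> space SM" if "A \<in> basis_pairs" for c :: 'k and A
    using SM.space_scale[OF basis_vec_SM[OF that]] by simp
  then have "s \<in> space SM" unfolding s_def by (rule SM.space_sum)
  then have d: "v - s \<in> space SM" by (rule SM.space_diff[OF v])
  have "v - s = 0"
  proof (rule zero_row_sums_zero[OF zero_row_sums_SM[OF d] SM_PM[OF d] two])
    fix B assume B: "B \<in> basis_pairs"
    have "s (pair_tabloid B) = (\<Sum>A\<in>basis_pairs. if A = B then v (pair_tabloid B) else 0)"
      unfolding s_def sum_fun_apply
      by (rule sum.cong[OF refl]) (simp add: fun_scale_def basis_vec_pair_tabloid[OF _ B])
    also have "\<dots> = v (pair_tabloid B)" using finite_basis_pairs B by simp
    finally show "(v - s) (pair_tabloid B) = 0" by simp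
  qed
  then show ?thesis unfolding s_def[symmetric] by (simp only: right_minus_eq)
qed

lemma card_basis_pairs: "Suc (card basis_pairs) = (n - 1) choose 2"
proof -
  have "card {A. A \<subseteq> {2..n} \<and> card A = 2} = (n - 1) choose 2"
    using n_subsets[of "{2..n}" 2] by simp
  moreover have "{2, 3} \<in> {A. A \<subseteq> {2..n} \<and> card A = 2}" using n4 by auto
  moreover have "finite {A. A \<subseteq> {2..n} \<and> card A = 2}" by (rule finite_subset[of _ "Pow {2..n}"]) auto
  ultimately show ?thesis unfolding basis_pairs_def by (metis card_Suc_Diff1)
qed

lemma full_group_bound:
  assumes two: "(2 :: 'k::field) \<noteq> 0" and P: "subgroup P SG"
    and p: "prime p" "CHAR('k) = p" "card P = p ^ k"
    and n12: "(of_nat n - 1) * (of_nat n - 2) = (0 :: 'k)"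
    and R: "rel_projective SG R (SM :: ('k, _, _) gmodule)"
  shows "\<exists>g\<in>carrier SG. \<forall>h\<in>P. g \<otimes>\<^bsub>SG\<^esub> h \<otimes>\<^bsub>SG\<^esub> inv\<^bsub>SG\<^esub> g \<in> R"
proof -
  interpret M: finite_fg_mod SG "SM :: ('k, _, _) gmodule" by (rule SM_finite_fg_mod)
  show ?thesis
  proof (rule M.dimension_bound[OF M.fin P p R finite_basis_pairs, where b = basis_vec and l = "\<lambda>A v. v (pair_tabloid A)"])
    show "basis_vec A \<in> space (SM :: ('k, _, _) gmodule)" if "A \<in> basis_pairs" for A by (rule basis_vec_SM[OF that])
    show "v = (\<Sum>A\<in>basis_pairs. scale SM (v (pair_tabloid A)) (basis_vec A))" if "v \<in> space (SM :: ('k, _, _) gmodule)" for v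
      unfolding SM_simps by (rule dual_expansion[OF that two])
    \<comment> \<open>The dimension is \<open>(n - 1 choose 2) - 1\<close>, which is \<open>-1\<close> in the field.\<close>
    have "2 * ((n - 1) choose 2) = (n - 1) * (n - 2)"
      using n4 by (simp add: choose_two)
    then have "of_nat (2 * ((n - 1) choose 2)) = (of_nat ((n - 1) * (n - 2)) :: 'k)" by (rule arg_cong)
    then have "2 * of_nat ((n - 1) choose 2) = (0 :: 'k)" using n12 n4 by (simp add: of_nat_diff)
    then have "of_nat (Suc (card basis_pairs)) = (0 :: 'k)" unfolding card_basis_pairs using two by (metis mult_eq_0_iff)
    then have "of_nat (card basis_pairs) = (- 1 :: 'k)" by (simp add: add_eq_0_iff)
    moreover have "(\<Sum>A\<in>basis_pairs. basis_vec A (pair_tabloid A)) = (of_nat (card basis_pairs) :: 'k)"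
      by (simp add: basis_vec_pair_tabloid)
    ultimately show "(\<Sum>A\<in>basis_pairs. basis_vec A (pair_tabloid A)) \<noteq> (0 :: 'k)" by simp
  qed (simp_all add: fun_scale_def)
qed

text \<open>
  The two cases differ in \<open>H\<close>: the pointwise stabilizer of \<open>{1, 2, 3, 4}\<close> with the column antisymmetrizer,
  or the whole group with the identity element.
\<close>

theorem specht_vertex:
  assumes p: "prime p" "odd p" "CHAR('k::field) = p"
  shows "\<exists>B. lies_in_block SG (SM :: ('k, _, _) gmodule) B \<and>
       (\<exists>Q. is_vertex SG (SM :: ('k, _, _) gmodule) Q) \<and> (\<exists>D. is_defect_group SG B D) \<and>
       (\<forall>Q D. is_vertex SG (SM :: ('k, _, _) gmodule) Q \<and> is_defect_group SG B D \<longrightarrow> conjugate_subgroups SG Q D)"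
proof -
  interpret M: finite_fg_mod SG "SM :: ('k, _, _) gmodule" by (rule SM_finite_fg_mod)
  have nat0: "(of_nat m :: 'k) = 0 \<longleftrightarrow> p dvd m" for m using p(3) by (simp add: of_nat_eq_0_iff_char_dvd)
  have "\<not> p dvd 2" using p(1,2) by (metis dvd_refl primes_dvd_imp_eq two_is_prime_nat)
  then have two: "(2 :: 'k) \<noteq> 0" using nat0[of 2] by simp
  note ind = SM_indecomposable[OF two]
  show ?thesis
  proof (cases "(of_nat n - 1) * (of_nat n - 2) = (0 :: 'k)")
    case False
    obtain P k T1 where P: "subgroup P SG" "P \<subseteq> point_stab" "card P = p ^ k"
      and T1: "right_transversal (SG\<lparr>carrier := point_stab\<rparr>) P T1" "\<not> p dvd card T1"
      by (rule M.sylow_subgroup[OF M.fin point_stab_subgroup p(1)])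
    obtain T where T: "right_transversal SG point_stab T" by (rule M.transversal_exists[OF point_stab_subgroup])
    have "8 = 2 * (2 * (2 :: 'k))" by simp
    then have c: "8 * (of_nat n - 1) * (of_nat n - 2) \<noteq> (0 :: 'k)" using False two by (metis mult.assoc no_zero_divisors)
    show ?thesis
    proof (rule M.vertices_are_defect_groups[OF ind P(1) point_stab_subgroup P(2) T1(1) _ _ T c])
      show "of_nat (card T1) \<noteq> (0 :: 'k)" using T1(2) nat0 by simp
      have c0: "corners 1 2 3 4" using n4 by (auto simp: corners_def)
      show "M.conj_elem h (col_antisym 1 2 3 4) = (col_antisym 1 2 3 4 :: _ \<Rightarrow> 'k)" if "h \<in> point_stab" for h
        using that conj_col_antisym[OF _ c0, of h] by (simp add: point_stab_def)
      show "(\<Sum>t\<in>T. M.aact v (M.conj_elem t (col_antisym 1 2 3 4))) = scale SM (8 * (of_nat n - 1) * (of_nat n - 2)) v"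
        if "v \<in> space SM" for v
        unfolding SM_simps by (rule transfer_col_antisym[OF T two that])
      show "\<exists>g\<in>carrier SG. \<forall>h\<in>P. g \<otimes>\<^bsub>SG\<^esub> h \<otimes>\<^bsub>SG\<^esub> inv\<^bsub>SG\<^esub> g \<in> R" if "rel_projective SG R (SM :: ('k, _, _) gmodule)" for R
        by (rule point_stab_bound[OF two P(1,2) p(1,3) P(3) that])
    qed
  next
    case True
    have G: "subgroup (carrier SG) SG" by (rule M.subgroup_self)
    obtain P k T1 where P: "subgroup P SG" "P \<subseteq> carrier SG" "card P = p ^ k"
      and T1: "right_transversal (SG\<lparr>carrier := carrier SG\<rparr>) P T1" "\<not> p dvd card T1"
      by (rule M.sylow_subgroup[OF M.fin G p(1)])
    have T: "right_transversal SG (carrier SG) {\<one>\<^bsub>SG\<^esub>}"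
      unfolding right_transversal_def using M.one_closed M.inv_one by (auto simp del: sym_right_simps)
    have c1: "M.conj_elem h (group_elem \<one>\<^bsub>SG\<^esub>) = (group_elem \<one>\<^bsub>SG\<^esub> :: _ \<Rightarrow> 'k)" if "h \<in> carrier SG" for h
      using that by (simp add: M.conj_elem_def M.group_elem_mult del: sym_right_simps)
    show ?thesis
    proof (rule M.vertices_are_defect_groups[OF ind P(1) G P(2) T1(1) _ c1 T, where c = 1])
      show "of_nat (card T1) \<noteq> (0 :: 'k)" using T1(2) nat0 by simp
      show "(\<Sum>t\<in>{\<one>\<^bsub>SG\<^esub>}. M.aact v (M.conj_elem t (group_elem \<one>\<^bsub>SG\<^esub>))) = scale SM 1 v" if "v \<in> space SM" for v
        using that c1[OF M.one_closed] M.aact_one[OF that] by (simp add: fun_scale_def del: sym_right_simps)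
      show "\<exists>g\<in>carrier SG. \<forall>h\<in>P. g \<otimes>\<^bsub>SG\<^esub> h \<otimes>\<^bsub>SG\<^esub> inv\<^bsub>SG\<^esub> g \<in> R" if "rel_projective SG R (SM :: ('k, _, _) gmodule)" for R
        by (rule full_group_bound[OF two P(1) p(1,3) P(3) True that])
      show "(1 :: 'k) \<noteq> 0" by (rule one_neq_zero)
    qed
  qed
qed

end

theorem theorem8p1:
  fixes n p :: nat
    and S :: "('k::field, tableau set \<Rightarrow> 'k, nat \<Rightarrow> nat) gmodule"
  assumes "n \<ge> 4" and "prime p" and "odd p" and "CHAR('k) = p"
  defines "S \<equiv> specht_module [n - 2, 2]"
  shows "fg_indecomposable (sym_right n) S \<and>
    (\<exists>B. lies_in_block (sym_right n) S B \<and>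
       (\<exists>Q. is_vertex (sym_right n) S Q) \<and>
       (\<exists>D. is_defect_group (sym_right n) B D) \<and>
       (\<forall>Q D. is_vertex (sym_right n) S Q \<and> is_defect_group (sym_right n) B D \<longrightarrow>
          conjugate_subgroups (sym_right n) Q D))"
proof -
  interpret two_row n using assms(1) by unfold_locales
  have "(of_nat 2 :: 'k) \<noteq> 0"
    using assms(2-4) by (metis dvd_refl of_nat_eq_0_iff_char_dvd primes_dvd_imp_eq two_is_prime_nat)
  then have two: "(2 :: 'k) \<noteq> 0" by simp
  show ?thesis
    unfolding S_def using SM_indecomposable[OF two] specht_vertex[OF assms(2-4)] by blast
qed

end
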